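(* Let $\alpha\in(0,1)$ and consider a sequence of problems indexed by $n\to\infty$. Suppose $\frac{\lambda}{n}\in\big[6\sigma_0^2\frac{(|\tau_0|+1)\log(p/2)}{n}+t,\ 0.05\,C_{\min}\big]$ for a positive constant $t>0$, and that $\frac{|\tau_0|\log(p)}{n}<0.23$ and $C_{\min}>120\frac{(|\tau_0|+2)\log(p+1)}{n}\sigma_0^2$ when $n$ is large enough. Then for any finite $d$, the model confidence set $\bar\Gamma_\alpha^\tau$ satisfies $$\mathbb P_{(\mathcal U^d,Y)}\{\tau_0\in\bar\Gamma_\alpha^\tau(Y)\}\ge\alpha-o(e^{-c_2n})\quad\text{as }n\to\infty$$ for some $c_2>0$. Further, $\mathbb P_{Y|\mathcal U^d}\{\tau_0\in\bar\Gamma_\alpha^\tau(Y)\}\ge\alpha-o_p(e^{-c_2n})$.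
   Context: Setting. $n,p$ are positive integers and $X\in\mathbb R^{n\times p}$ is a fixed matrix. For $\tau\subset[p]=\{1,\dots,p\}$ (a "model"), $X_\tau$ is the submatrix of the columns of $X$ indexed by $\tau$, $|\tau|$ is the cardinality, and $H_\tau$ is the orthogonal projection matrix onto the column span of $X_\tau$. The data are $Y=X_{\tau_0}\beta_0+\sigma_0U$, where $\tau_0\subset[p]$ (nonempty), $\beta_0\in\mathbb R^{|\tau_0|}$, $\sigma_0>0$ are fixed and $U\sim N(0,I_n)$. In the sequence of problems, $p,X,\tau_0,\beta_0,\lambda$ may depend on $n$, while $d,t,\sigma_0,\alpha$ are fixed. Identifiability: $\tau_0$ is the unique model of smallest cardinality in $\{\tau\subset[p]: X_\tau\beta_\tau=X_{\tau_0}\beta_0\text{ for some }\beta_\tau\}$. Define $$C_{\min}=\min_{\tau\ne\tau_0,\ |\tau|\le|\tau_0|}\ \min_{\beta_\tau\in\mathbb R^{|\tau|}}\ \frac{\|X_{\tau_0}\beta_0-X_\tau\beta_\tau\|_2^2}{n\max(|\tau_0\setminus\tau|,1)}>0.$$ Candidate set. $\mathcal U^d=(U_1^*,\dots,U_d^* )$ are i.i.d. $N(0,I_n)$, independent of $U$. For $\lambda>0$, $\hat\tau_b=\arg\min_{\tau}\min_{\beta_\tau\in\mathbb R^{|\tau|},\sigma\in\mathbb R}\{\|Y-X_\tau\beta_\tau-\sigma U_b^*\|_2^2+\lambda|\tau|\}$ (fixed tie-breaking rule) and $S^{(d)}=\{\hat\tau_b:b=1,\dots,d\}$. Confidence set.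 For $y\in\mathbb R^n$ and a model $\tau$ let $\tilde T(y,\tau)=\arg\min_{\tilde\tau\subset[p],|\tilde\tau|\le|\tau|}\min_{\beta_{\tilde\tau}}\|y-X_{\tilde\tau}\beta_{\tilde\tau}\|^2$ (fixed tie-breaking rule) and $\widetilde W(y,\tau)=(H_\tau y,\ \|(I-H_\tau)y\|)$. For $w=(a,b)$ and a model $\tau'$ let $$p_{(w,\tau)}(\tau')=\mathbb P_{V}\Big\{\tilde T\Big(a+b\tfrac{(I-H_\tau)V}{\|(I-H_\tau)V\|},\tau\Big)=\tau'\Big\},\quad V\sim N(0,I_n),$$ which is the conditional probability mass function of $\tilde T(Y_\theta,\tau)$ given $\widetilde W(Y_\theta,\tau)=w$ when $Y_\theta=X_\tau\beta_\tau+\sigma V$. Let $$B_\alpha(\tau,w)=\Big\{\tau^*\subset[p]:\sum_{\tau':\,p_{(w,\tau)}(\tau')\le p_{(w,\tau)}(\tau^* )}p_{(w,\tau)}(\tau')\ge1-\alpha\Big\},$$ $$\bar\Gamma_\alpha^\tau(Y)=\{\tau\in S^{(d)}:\tilde T(Y,\tau)\in B_\alpha(\tau,\widetilde W(Y,\tau))\}.$$ $\mathbb P_{(\mathcal U^d,Y)}$ is the joint probability over $U$ and $\mathcal U^d$; $\mathbb P_{Y|\mathcal U^d}$ is the conditional probability given $\mathcal U^d$, and $o_p$ is with respect to $\mathcal U^d$ as $n\to\infty$. *)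

theory Defs
  imports "HOL-Probability.Probability"
begin

text \<open>
  Since the dimensions vary along the sequence of problems, a vector in \<open>\<real>\<^sup>n\<close> is a function
  \<open>nat \<Rightarrow> real\<close> of which only the coordinates in \<open>{1..n}\<close> matter, a design matrix is a function
  \<open>nat \<Rightarrow> nat \<Rightarrow> real\<close> (row, column), and a model is a set \<open>\<tau> \<subseteq> {1..p}\<close>.  A coefficient vector
  for \<open>\<tau>\<close> is indexed by the elements of \<open>\<tau>\<close>; its values off \<open>\<tau>\<close> are never used.
  The Euclidean norm on \<open>\<real>\<^sup>n\<close> is \<open>\<lambda>x. L2_set x {1..n}\<close>.

  The minima over coefficients below are minima of a distance to a finite-dimensional linear
  subspace; they are attained, hence equal to the infima used here.
\<close>

definition Xmul :: "(nat \<Rightarrow> nat \<Rightarrow> real) \<Rightarrow> nat set \<Rightarrow> (nat \<Rightarrow> real) \<Rightarrow> nat \<Rightarrow> real" where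
  "Xmul X \<tau> \<beta> = (\<lambda>i. \<Sum>j\<in>\<tau>. X i j * \<beta> j)"

definition col_span :: "nat \<Rightarrow> (nat \<Rightarrow> nat \<Rightarrow> real) \<Rightarrow> nat set \<Rightarrow> (nat \<Rightarrow> real) set" where
  "col_span n X \<tau> = {restrict (Xmul X \<tau> \<beta>) {1..n} |\<beta>. True}"

text \<open>
  \<open>proj n X \<tau> y\<close> is \<open>H\<^sub>\<tau> y\<close>.  The elements of the column span are extensional on \<open>{1..n}\<close>,
  which makes the description definite.
\<close>

definition proj ::
  "nat \<Rightarrow> (nat \<Rightarrow> nat \<Rightarrow> real) \<Rightarrow> nat set \<Rightarrow> (nat \<Rightarrow> real) \<Rightarrow> nat \<Rightarrow> real" where
  "proj n X \<tau> y =
     (THE h. h \<in> col_span n X \<tau> \<and> (\<forall>v\<in>col_span n X \<tau>. (\<Sum>i\<in>{1..n}. (y i - h i) * v i) = 0))"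

definition resid ::
  "nat \<Rightarrow> (nat \<Rightarrow> nat \<Rightarrow> real) \<Rightarrow> nat set \<Rightarrow> (nat \<Rightarrow> real) \<Rightarrow> nat \<Rightarrow> real" where
  "resid n X \<tau> y = (\<lambda>i. y i - proj n X \<tau> y i)"

definition Rn :: "nat \<Rightarrow> (nat \<Rightarrow> real) measure" where
  "Rn n = (\<Pi>\<^sub>M i\<in>{1..n}. borel)"

definition std_gauss :: "nat \<Rightarrow> (nat \<Rightarrow> real) measure" where
  "std_gauss n = (\<Pi>\<^sub>M i\<in>{1..n}. density lborel (\<lambda>x. ennreal (std_normal_density x)))"

definition data ::
  "(nat \<Rightarrow> nat \<Rightarrow> real) \<Rightarrow> nat set \<Rightarrow> (nat \<Rightarrow> real) \<Rightarrow> real \<Rightarrow> (nat \<Rightarrow> real) \<Rightarrow> nat \<Rightarrow> real" where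
  "data X \<tau>0 \<beta>0 \<sigma>0 u = (\<lambda>i. Xmul X \<tau>0 \<beta>0 i + \<sigma>0 * u i)"

definition identifiable ::
  "nat \<Rightarrow> nat \<Rightarrow> (nat \<Rightarrow> nat \<Rightarrow> real) \<Rightarrow> nat set \<Rightarrow> (nat \<Rightarrow> real) \<Rightarrow> bool" where
  "identifiable n p X \<tau>0 \<beta>0 \<longleftrightarrow>
     {\<tau>. is_arg_min card
           (\<lambda>\<tau>. \<tau> \<subseteq> {1..p} \<and> (\<exists>\<beta>. \<forall>i\<in>{1..n}. Xmul X \<tau> \<beta> i = Xmul X \<tau>0 \<beta>0 i)) \<tau>} = {\<tau>0}"

definition Cmin ::
  "nat \<Rightarrow> nat \<Rightarrow> (nat \<Rightarrow> nat \<Rightarrow> real) \<Rightarrow> nat set \<Rightarrow> (nat \<Rightarrow> real) \<Rightarrow> real" where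
  "Cmin n p X \<tau>0 \<beta>0 =
     Min ((\<lambda>\<tau>. INF \<beta>. (L2_set (\<lambda>i. Xmul X \<tau>0 \<beta>0 i - Xmul X \<tau> \<beta> i) {1..n})\<^sup>2
                         / (real n * max (real (card (\<tau>0 - \<tau>))) 1))
          ` {\<tau>. \<tau> \<subseteq> {1..p} \<and> \<tau> \<noteq> \<tau>0 \<and> card \<tau> \<le> card \<tau>0})"

text \<open>A tie-breaking rule selects one element from every set of minimizing models.\<close>

definition tie_break :: "(nat set set \<Rightarrow> nat set) \<Rightarrow> bool" where
  "tie_break tb \<longleftrightarrow> (\<forall>A. finite A \<and> A \<noteq> {} \<longrightarrow> tb A \<in> A)"

definition pen_loss ::
  "nat \<Rightarrow> (nat \<Rightarrow> nat \<Rightarrow> real) \<Rightarrow> real \<Rightarrow> (nat \<Rightarrow> real) \<Rightarrow> (nat \<Rightarrow> real) \<Rightarrow> nat set \<Rightarrow> real" where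
  "pen_loss n X lam y u \<tau> =
     (INF (\<beta>, \<sigma>). (L2_set (\<lambda>i. y i - Xmul X \<tau> \<beta> i - \<sigma> * u i) {1..n})\<^sup>2 + lam * real (card \<tau>))"

definition tau_hat ::
  "nat \<Rightarrow> nat \<Rightarrow> (nat \<Rightarrow> nat \<Rightarrow> real) \<Rightarrow> real \<Rightarrow> (nat set set \<Rightarrow> nat set)
     \<Rightarrow> (nat \<Rightarrow> real) \<Rightarrow> (nat \<Rightarrow> real) \<Rightarrow> nat set" where
  "tau_hat n p X lam tb y u = tb {\<tau>. is_arg_min (pen_loss n X lam y u) (\<lambda>\<tau>. \<tau> \<subseteq> {1..p}) \<tau>}"

definition candidates ::
  "nat \<Rightarrow> nat \<Rightarrow> (nat \<Rightarrow> nat \<Rightarrow> real) \<Rightarrow> real \<Rightarrow> (nat set set \<Rightarrow> nat set) \<Rightarrow> nat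
     \<Rightarrow> (nat \<Rightarrow> real) \<Rightarrow> (nat \<Rightarrow> nat \<Rightarrow> real) \<Rightarrow> nat set set" where
  "candidates n p X lam tb d y us = (\<lambda>b. tau_hat n p X lam tb y (us b)) ` {1..d}"

definition rss :: "nat \<Rightarrow> (nat \<Rightarrow> nat \<Rightarrow> real) \<Rightarrow> (nat \<Rightarrow> real) \<Rightarrow> nat set \<Rightarrow> real" where
  "rss n X y \<tau> = (INF \<beta>. (L2_set (\<lambda>i. y i - Xmul X \<tau> \<beta> i) {1..n})\<^sup>2)"

definition T_tilde ::
  "nat \<Rightarrow> nat \<Rightarrow> (nat \<Rightarrow> nat \<Rightarrow> real) \<Rightarrow> (nat set set \<Rightarrow> nat set)
     \<Rightarrow> (nat \<Rightarrow> real) \<Rightarrow> nat set \<Rightarrow> nat set" where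
  "T_tilde n p X tb y \<tau> =
     tb {\<tau>'. is_arg_min (rss n X y) (\<lambda>\<tau>'. \<tau>' \<subseteq> {1..p} \<and> card \<tau>' \<le> card \<tau>) \<tau>'}"

definition W_tilde ::
  "nat \<Rightarrow> (nat \<Rightarrow> nat \<Rightarrow> real) \<Rightarrow> (nat \<Rightarrow> real) \<Rightarrow> nat set \<Rightarrow> (nat \<Rightarrow> real) \<times> real" where
  "W_tilde n X y \<tau> = (proj n X \<tau> y, L2_set (resid n X \<tau> y) {1..n})"

definition cond_pmf ::
  "nat \<Rightarrow> nat \<Rightarrow> (nat \<Rightarrow> nat \<Rightarrow> real) \<Rightarrow> (nat set set \<Rightarrow> nat set)
     \<Rightarrow> (nat \<Rightarrow> real) \<times> real \<Rightarrow> nat set \<Rightarrow> nat set \<Rightarrow> real" where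
  "cond_pmf n p X tb w \<tau> \<tau>' =
     measure (std_gauss n)
       {v \<in> space (std_gauss n).
          T_tilde n p X tb
            (\<lambda>i. fst w i + snd w * (resid n X \<tau> v i / L2_set (resid n X \<tau> v) {1..n})) \<tau> = \<tau>'}"

definition B_set ::
  "nat \<Rightarrow> nat \<Rightarrow> (nat \<Rightarrow> nat \<Rightarrow> real) \<Rightarrow> (nat set set \<Rightarrow> nat set) \<Rightarrow> real
     \<Rightarrow> nat set \<Rightarrow> (nat \<Rightarrow> real) \<times> real \<Rightarrow> nat set set" where
  "B_set n p X tb \<alpha> \<tau> w =
     {\<tau>s. \<tau>s \<subseteq> {1..p} \<and>
        (\<Sum>\<tau>' \<in> {\<tau>'. \<tau>' \<subseteq> {1..p} \<and> cond_pmf n p X tb w \<tau> \<tau>' \<le> cond_pmf n p X tb w \<tau> \<tau>s}.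
           cond_pmf n p X tb w \<tau> \<tau>') \<ge> 1 - \<alpha>}"

definition conf_set ::
  "nat \<Rightarrow> nat \<Rightarrow> (nat \<Rightarrow> nat \<Rightarrow> real) \<Rightarrow> real \<Rightarrow> (nat set set \<Rightarrow> nat set) \<Rightarrow> (nat set set \<Rightarrow> nat set)
     \<Rightarrow> nat \<Rightarrow> real \<Rightarrow> (nat \<Rightarrow> real) \<Rightarrow> (nat \<Rightarrow> nat \<Rightarrow> real) \<Rightarrow> nat set set" where
  "conf_set n p X lam tbS tbT d \<alpha> y us =
     {\<tau> \<in> candidates n p X lam tbS d y us.
        T_tilde n p X tbT y \<tau> \<in> B_set n p X tbT \<alpha> \<tau> (W_tilde n X y \<tau>)}"

definition sigma_Us ::
  "'w measure \<Rightarrow> nat \<Rightarrow> nat \<Rightarrow> (nat \<Rightarrow> 'w \<Rightarrow> nat \<Rightarrow> real) \<Rightarrow> 'w measure" where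
  "sigma_Us M n d Us =
     vimage_algebra (space M) (\<lambda>\<omega>. \<lambda>b\<in>{1..d}. Us b \<omega>) (\<Pi>\<^sub>M b\<in>{1..d}. Rn n)"

definition cprob :: "'w measure \<Rightarrow> 'w measure \<Rightarrow> 'w set \<Rightarrow> 'w \<Rightarrow> real" where
  "cprob M F A = real_cond_exp M F (indicator A)"

definition small_o_p :: "(nat \<Rightarrow> 'w measure) \<Rightarrow> (nat \<Rightarrow> 'w \<Rightarrow> real) \<Rightarrow> (nat \<Rightarrow> real) \<Rightarrow> bool" where
  "small_o_p M R g \<longleftrightarrow>
     (\<forall>\<epsilon>>0. (\<lambda>n. measure (M n) {\<omega> \<in> space (M n). \<bar>R n \<omega>\<bar> > \<epsilon> * \<bar>g n\<bar>}) \<longlonglongrightarrow> 0)"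

end

theory Submission
  imports Defs
begin

text \<open>
  Householder reflections preserve the standard Gaussian law, so for any design there is a
  measure-preserving rotation that turns a column span into a coordinate subspace; residual sums of
  squares become sums of squares of independent normal variables.

  Coverage given that \<open>\<tau>0\<close> is a candidate: the direction of the residual of \<open>Y\<close> on \<open>\<tau>0\<close> is independent
  of \<open>W_tilde\<close>, so \<open>cond_pmf\<close> is the conditional law of \<open>T_tilde\<close>, and dropping the least likely
  values of total mass below \<open>1 - \<alpha>\<close> leaves mass at least \<open>\<alpha>\<close>.

  Candidates: one synthetic noise vector already recovers \<open>\<tau>0\<close> up to exponentially small
  probability.  A model of size at most \<open>card \<tau>0\<close> loses because projecting out the noise vector
  keeps a third of its signal distance, half of which survives the cross term with \<open>U\<close>; a larger
  model gains at most a chi-square variable on the added columns, which the penalty dominates.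
  Chernoff bounds and union bounds over models give the rates.  The conditional statement follows
  by Markov's inequality applied to the conditional probability of failure.
\<close>

declare One_nat_def [simp del]

text \<open>The constants of the hypotheses come from one balance. Write s for the size of \<tau>0.
  A model may replace all of \<tau>0 and still exceed its size by only j, so a penalty lam * j has
  to pay for up to j * (s + 1) new columns; this is the source of the factor s + 1. A chi-square
  Chernoff bound with exponent 1/4 turns 6 * sigma^2 * (s + 1) * ln (p/2) into 3/2 * (s + 1) * ln
  (p/2), which must beat the weights p^(-|T|) of the union bound. If a model of size at most s
  misses k true columns, a sixth of its signal n * k * C remains (a third, then a half), and lam
  \<le> 0.05 * n * C makes this at least 10/3 * lam * k: more than the lam * k of saved penalty plus
  one lam of noise. Selection and \<open>T_tilde\<close> share the noise U, so coverage is never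
  conditioned on selection: the failure event is subtracted from an event that depends on U alone.
  The dimension n is a variable and the law is a product over {1..n}; invariance of Lebesgue measure
  is therefore reduced to affine substitutions in single coordinates and Fubini.\<close>

section \<open>Rotations adapted to column spans\<close>

definition ip :: "nat \<Rightarrow> (nat \<Rightarrow> real) \<Rightarrow> (nat \<Rightarrow> real) \<Rightarrow> real" where
  "ip n x y = (\<Sum>i\<in>{1..n}. x i * y i)"

text \<open>If \<open>v\<close> vanishes on {1..n}, the quotient is 0 by the convention for division
  and only the restriction remains, so no side condition on \<open>v\<close> is ever needed.\<close>

definition householder :: "nat \<Rightarrow> (nat \<Rightarrow> real) \<Rightarrow> (nat \<Rightarrow> real) \<Rightarrow> nat \<Rightarrow> real" where
  "householder n v x = (\<lambda>i\<in>{1..n}. x i - 2 * ip n v x / ip n v v * v i)"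

text \<open>Generated by reflections instead of being characterised by orthogonality, so that
  linearity, isometry, measurability and Gaussian invariance each follow by induction from a single
  reflection.\<close>

inductive rotation :: "nat \<Rightarrow> ((nat \<Rightarrow> real) \<Rightarrow> nat \<Rightarrow> real) \<Rightarrow> bool" for n where
  rotation_id: "rotation n (\<lambda>x. restrict x {1..n})"
| rotation_step: "rotation n Q \<Longrightarrow> rotation n (\<lambda>x. householder n v (Q x))"

lemma ip_commute: "ip n x y = ip n y x"
  by (simp add: ip_def mult.commute)

lemma ip_cong: "(\<And>i. i \<in> {1..n} \<Longrightarrow> x i = x' i) \<Longrightarrow> (\<And>i. i \<in> {1..n} \<Longrightarrow> y i = y' i) \<Longrightarrow> ip n x y = ip n x' y'"
  by (simp add: ip_def)

lemma ip_lin_left: "ip n (\<lambda>i. x i + c * y i) z = ip n x z + c * ip n y z"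
  by (simp add: ip_def algebra_simps sum.distrib sum_distrib_left)

lemma ip_lin_right: "ip n z (\<lambda>i. x i + c * y i) = ip n z x + c * ip n z y"
  by (simp add: ip_def algebra_simps sum.distrib sum_distrib_left)

lemma ip_self_nonneg: "0 \<le> ip n x x"
  by (simp add: ip_def sum_nonneg)

lemma ip_self_eq_0_iff: "ip n x x = 0 \<longleftrightarrow> (\<forall>i\<in>{1..n}. x i = 0)"
  by (simp add: ip_def sum_nonneg_eq_0_iff)

lemma ip_split:
  assumes "r \<le> n"
  shows "ip n x y = (\<Sum>k\<in>{1..r}. x k * y k) + (\<Sum>k\<in>{r<..n}. x k * y k)"
proof -
  have "{1..n} = {1..r} \<union> {r<..n}" "{1..r} \<inter> {r<..n} = {}" using assms by auto
  then show ?thesis by (simp add: ip_def sum.union_disjoint)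
qed

lemma L2_set_power2: "(L2_set x {1..n})\<^sup>2 = ip n x x"
  by (simp add: L2_set_def ip_def sum_nonneg power2_eq_square)

lemma ip_householder: "ip n (householder n v x) (householder n v y) = ip n x y"
proof -
  define a where "a = - (2 * ip n v x / ip n v v)"
  define b where "b = - (2 * ip n v y / ip n v v)"
  have "ip n (householder n v x) (householder n v y) = ip n (\<lambda>i. x i + a * v i) (\<lambda>i. y i + b * v i)"
    by (rule ip_cong) (auto simp: householder_def a_def b_def)
  also have "\<dots> = ip n x y + b * ip n v x + a * ip n v y + a * b * ip n v v"
    by (simp add: ip_lin_left ip_lin_right ip_commute algebra_simps)
  also have "\<dots> = ip n x y"
    by (cases "ip n v v = 0") (auto simp: a_def b_def field_simps)
  finally show ?thesis .
qed

lemma householder_lin: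
  "k \<in> {1..n} \<Longrightarrow> householder n v (\<lambda>i. x i + c * y i) k = householder n v x k + c * householder n v y k"
  by (simp add: householder_def ip_lin_right add_divide_distrib algebra_simps)

lemma householder_cong:
  "(\<And>i. i \<in> {1..n} \<Longrightarrow> x i = y i) \<Longrightarrow> householder n v x = householder n v y"
  using ip_cong[of n v v x y] by (auto simp: householder_def intro!: restrict_ext)

lemma rotation_lin:
  "rotation n Q \<Longrightarrow> k \<in> {1..n} \<Longrightarrow> Q (\<lambda>i. x i + c * y i) k = Q x k + c * Q y k"
proof (induction arbitrary: k rule: rotation.induct)
  case (rotation_step Q v)
  have "householder n v (Q (\<lambda>i. x i + c * y i)) = householder n v (\<lambda>i. Q x i + c * Q y i)"
    by (rule householder_cong) (use rotation_step.IH in auto)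
  then show ?case using rotation_step.prems by (simp add: householder_lin)
qed auto

lemma rotation_diff:
  "rotation n Q \<Longrightarrow> k \<in> {1..n} \<Longrightarrow> Q (\<lambda>i. x i - c * y i) k = Q x k - c * Q y k"
  using rotation_lin[of n Q k x "- c" y] by simp

lemma rotation_cong:
  "rotation n Q \<Longrightarrow> (\<And>i. i \<in> {1..n} \<Longrightarrow> x i = y i) \<Longrightarrow> Q x = Q y"
  by (induction rule: rotation.induct) (auto intro!: restrict_ext)

lemma rotation_ip: "rotation n Q \<Longrightarrow> ip n (Q x) (Q y) = ip n x y"
proof (induction rule: rotation.induct)
  case rotation_id
  show ?case by (rule ip_cong) auto
qed (auto simp: ip_householder)

text \<open>\<open>Q\<close> maps the column span onto the first \<open>r\<close> coordinates:
  nothing beyond \<open>r\<close> is hit and everything up to \<open>r\<close> is. Hence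
  \<open>r\<close> is the rank, and the coordinates above \<open>r\<close> are those of the
  residual.\<close>

definition adapted ::
  "nat \<Rightarrow> (nat \<Rightarrow> nat \<Rightarrow> real) \<Rightarrow> nat set \<Rightarrow> ((nat \<Rightarrow> real) \<Rightarrow> nat \<Rightarrow> real) \<Rightarrow> nat \<Rightarrow> bool" where
  "adapted n X \<tau> Q r \<longleftrightarrow> rotation n Q \<and> r \<le> n \<and>
     (\<forall>\<beta>. \<forall>k\<in>{r<..n}. Q (Xmul X \<tau> \<beta>) k = 0) \<and>
     (\<forall>z. \<exists>\<beta>. \<forall>k\<in>{1..n}. Q (Xmul X \<tau> \<beta>) k = (if k \<le> r then z k else 0))"

lemma adaptedD:
  assumes "adapted n X \<tau> Q r"
  shows "rotation n Q" "r \<le> n" "k \<in> {r<..n} \<Longrightarrow> Q (Xmul X \<tau> \<beta>) k = 0"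
    "\<exists>\<beta>. \<forall>k\<in>{1..n}. Q (Xmul X \<tau> \<beta>) k = (if k \<le> r then z k else 0)"
  using assms by (auto simp: adapted_def)

lemma adapted_empty: "adapted n X {} (\<lambda>x. restrict x {1..n}) 0"
  by (auto simp: adapted_def rotation_id Xmul_def)

lemma Xmul_insert:
  "finite \<tau> \<Longrightarrow> j \<notin> \<tau> \<Longrightarrow> Xmul X (insert j \<tau>) \<beta> = (\<lambda>i. Xmul X \<tau> \<beta> i + \<beta> j * X i j)"
  by (auto simp: Xmul_def)

lemma Xmul_cong: "(\<And>j. j \<in> \<tau> \<Longrightarrow> \<beta> j = \<gamma> j) \<Longrightarrow> Xmul X \<tau> \<beta> = Xmul X \<tau> \<gamma>"
  by (auto simp: Xmul_def intro!: ext sum.cong)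

text \<open>The reflection in the bisecting hyperplane of two vectors of equal length exchanges
  them: with v = g - w, equal lengths give <v,v> = 2<v,g>, so the reflection subtracts v exactly
  once. If v = 0 there is nothing to move.\<close>

lemma householder_swap:
  assumes "ip n g g = ip n w w" "k \<in> {1..n}"
  shows "householder n (\<lambda>i. g i + (-1) * w i) g k = w k"
proof -
  let ?v = "\<lambda>i. g i + (-1) * w i"
  have 1: "ip n ?v ?v = 2 * ip n ?v g"
    by (simp only: ip_lin_left ip_lin_right) (simp add: assms ip_commute)
  show ?thesis
  proof (cases "ip n ?v ?v = 0")
    case True
    then have "g k = w k" using ip_self_eq_0_iff[of n ?v] assms(2) by auto
    then show ?thesis using assms(2) True by (simp add: householder_def)
  next
    case False
    then have "2 * ip n ?v g / ip n ?v ?v = 1" using 1 by simp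
    then show ?thesis using assms(2) by (simp add: householder_def)
  qed
qed

text \<open>One step of a QR decomposition by Householder reflections.\<close>

lemma adapted_insert:
  assumes ad: "adapted n X \<tau> Q r" and j: "j \<notin> \<tau>" "finite \<tau>"
  shows "\<exists>Q' r'. adapted n X (insert j \<tau>) Q' r' \<and> r \<le> r' \<and> r' \<le> Suc r \<and>
           (\<forall>x. \<forall>k\<in>{1..r}. Q' x k = Q x k)"
proof -
  note rot = adaptedD(1)[OF ad]
  define g where "g = Q (\<lambda>i. X i j)"
  define g' where "g' = (\<lambda>k. if r < k then g k else 0)"
  have QX: "Q (Xmul X (insert j \<tau>) \<beta>) k = Q (Xmul X \<tau> \<beta>) k + \<beta> j * g k" if "k \<in> {1..n}" for \<beta> k
    using that by (simp add: Xmul_insert j rotation_lin[OF rot] g_def)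
  show ?thesis
  proof (cases "\<forall>k\<in>{r<..n}. g k = 0")
    \<comment> \<open>The new column already lies in the old span: the rotation and the rank stay,
      and the new coefficient is set to 0.\<close>
    case True
    have "\<exists>\<beta>. \<forall>k\<in>{1..n}. Q (Xmul X (insert j \<tau>) \<beta>) k = (if k \<le> r then z k else 0)" for z
    proof -
      obtain \<beta> where \<beta>: "\<forall>k\<in>{1..n}. Q (Xmul X \<tau> \<beta>) k = (if k \<le> r then z k else 0)"
        using adaptedD(4)[OF ad] by blast
      have "Xmul X \<tau> (\<beta>(j := 0)) = Xmul X \<tau> \<beta>" by (rule Xmul_cong) (use j in auto)
      then show ?thesis using \<beta> by (intro exI[of _ "\<beta>(j := 0)"]) (auto simp: QX)
    qed
    then have "adapted n X (insert j \<tau>) Q r"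
      using True rot adaptedD(2,3)[OF ad] by (auto simp: adapted_def QX)
    then show ?thesis by (intro exI[of _ Q] exI[of _ r]) auto
  next
    case False
    then have rn: "r < n" by auto
    \<comment> \<open>The part \<open>g'\<close> of the rotated column beyond \<open>r\<close> is
      reflected onto \<rho> times the unit vector number r + 1. The reflecting vector
      \<open>v\<close> vanishes up to \<open>r\<close>, so the old span and the first
      \<open>r\<close> coordinates of every vector are untouched.\<close>
    define \<rho> where "\<rho> = sqrt (ip n g' g')"
    define w where "w = (\<lambda>k. if k = Suc r then \<rho> else 0)"
    define v where "v = (\<lambda>i. g' i + (-1) * w i)"
    define Q' where "Q' = (\<lambda>x. householder n v (Q x))"
    have "ip n w w = \<rho> * \<rho>"
      using rn by (simp add: ip_def w_def if_distrib[of "\<lambda>x. x * _"] cong: if_cong)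
    then have gw: "ip n g' g' = ip n w w"
      by (simp add: \<rho>_def ip_self_nonneg)
    obtain k0 where "k0 \<in> {r<..n}" "g k0 \<noteq> 0" using False by auto
    then have "k0 \<in> {1..n}" "g' k0 \<noteq> 0" by (auto simp: g'_def)
    then have "ip n g' g' \<noteq> 0" unfolding ip_self_eq_0_iff by blast
    then have \<rho>: "\<rho> \<noteq> 0" by (simp add: \<rho>_def)
    have v0: "v k = 0" if "k \<le> r" for k using that by (simp add: v_def g'_def w_def)
    have head: "Q' x k = Q x k" if "k \<in> {1..r}" for x k
      using that rn by (simp add: Q'_def householder_def v0)
    have onS: "Q' (Xmul X \<tau> \<beta>) k = Q (Xmul X \<tau> \<beta>) k" if "k \<in> {1..n}" for \<beta> k
    proof -
      have "ip n v (Q (Xmul X \<tau> \<beta>)) = 0"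
        unfolding ip_def using v0 adaptedD(3)[OF ad]
        by (intro sum.neutral) (metis atLeastAtMost_iff greaterThanAtMost_iff mult_eq_0_iff not_le)
      then show ?thesis using that by (simp add: Q'_def householder_def)
    qed
    have Qj: "Q' (\<lambda>i. X i j) k = (if k \<le> r then g k else w k)" if k: "k \<in> {1..n}" for k
    proof -
      have "ip n v g = ip n v g'" unfolding ip_def using v0 by (intro sum.cong) (auto simp: g'_def)
      then have "Q' (\<lambda>i. X i j) k = (if k \<le> r then g k else householder n v g' k)"
        using k v0 by (auto simp: Q'_def g_def[symmetric] householder_def g'_def)
      then show ?thesis using householder_swap[OF gw k] by (simp add: v_def)
    qed
    have rot': "rotation n Q'" unfolding Q'_def by (rule rotation_step[OF rot])
    have QX': "Q' (Xmul X (insert j \<tau>) \<beta>) k = Q (Xmul X \<tau> \<beta>) k + \<beta> j * (if k \<le> r then g k else w k)"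
      if "k \<in> {1..n}" for \<beta> k
      using that by (simp add: Xmul_insert j rotation_lin[OF rot'] onS Qj)
    have "\<exists>\<beta>. \<forall>k\<in>{1..n}. Q' (Xmul X (insert j \<tau>) \<beta>) k = (if k \<le> Suc r then z k else 0)" for z
    proof -
      \<comment> \<open>The new coefficient is forced by coordinate r + 1; the old coefficients then
        compensate its contribution \<open>b * g k\<close> to the first \<open>r\<close>
        coordinates.\<close>
      define b where "b = z (Suc r) / \<rho>"
      obtain \<beta> where \<beta>: "\<forall>k\<in>{1..n}. Q (Xmul X \<tau> \<beta>) k = (if k \<le> r then z k - b * g k else 0)"
        using adaptedD(4)[OF ad, of "\<lambda>k. z k - b * g k"] by blast
      have "Xmul X \<tau> (\<beta>(j := b)) = Xmul X \<tau> \<beta>" by (rule Xmul_cong) (use j in auto)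
      then show ?thesis using \<beta> \<rho>
        by (intro exI[of _ "\<beta>(j := b)"]) (auto simp: QX' w_def b_def le_Suc_eq)
    qed
    then have "adapted n X (insert j \<tau>) Q' (Suc r)"
      using rot' rn adaptedD(3)[OF ad] by (auto simp: adapted_def QX' w_def)
    then show ?thesis using head by (intro exI[of _ Q'] exI[of _ "Suc r"]) auto
  qed
qed

text \<open>Keeping the first \<open>r\<close> coordinates of \<open>Q\<close> is the point: with
  \<open>adapted_transfer\<close> a single rotation serves both the small and the large span, so
  differences of residual sums of squares can be read off coordinates.\<close>

lemma adapted_union:
  assumes "finite T" "finite \<tau>" "adapted n X \<tau> Q r"
  shows "\<exists>Q' r'. adapted n X (\<tau> \<union> T) Q' r' \<and> r \<le> r' \<and> r' \<le> r + card T \<and>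
           (\<forall>x. \<forall>k\<in>{1..r}. Q' x k = Q x k)"
  using assms(1)
proof (induction T rule: finite_induct)
  case empty
  show ?case using assms by (intro exI[of _ Q] exI[of _ r]) auto
next
  case (insert j T)
  then obtain Q' r' where 1: "adapted n X (\<tau> \<union> T) Q' r'" "r \<le> r'" "r' \<le> r + card T"
      "\<And>x k. k \<in> {1..r} \<Longrightarrow> Q' x k = Q x k" by blast
  show ?case
  proof (cases "j \<in> \<tau> \<union> T")
    case True
    then have "\<tau> \<union> insert j T = \<tau> \<union> T" by auto
    then show ?thesis using 1 insert by (intro exI[of _ Q'] exI[of _ r']) auto
  next
    case False
    then obtain Q'' r'' where 2: "adapted n X (insert j (\<tau> \<union> T)) Q'' r''" "r' \<le> r''" "r'' \<le> Suc r'"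
      "\<And>x k. k \<in> {1..r'} \<Longrightarrow> Q'' x k = Q' x k"
      using adapted_insert[OF 1(1) False] insert assms by blast
    then show ?thesis using 1 insert by (intro exI[of _ Q''] exI[of _ r'']) auto
  qed
qed

lemma adapted_exists:
  assumes "finite \<tau>"
  obtains Q r where "adapted n X \<tau> Q r" "r \<le> card \<tau>"
  using adapted_union[OF assms finite.emptyI adapted_empty, of n X] by auto

text \<open>Both rotations are isometries that agree on the first \<open>r\<close> coordinates, so
  the remaining squares have the same sum. That sum is 0 on the column span under \<open>Q\<close>,
  hence also under \<open>Q'\<close>.\<close>

lemma adapted_transfer:
  assumes ad: "adapted n X \<tau> Q r" and Q': "rotation n Q'" "\<And>x k. k \<in> {1..r} \<Longrightarrow> Q' x k = Q x k"
  shows "adapted n X \<tau> Q' r"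
proof -
  have eq: "(\<Sum>k\<in>{r<..n}. Q' x k * Q' x k) = (\<Sum>k\<in>{r<..n}. Q x k * Q x k)" for x
    using rotation_ip[OF Q'(1), of x x] rotation_ip[OF adaptedD(1)[OF ad], of x x] Q'(2)
    by (simp add: ip_split[OF adaptedD(2)[OF ad]])
  have z: "Q' (Xmul X \<tau> \<beta>) k = 0" if "k \<in> {r<..n}" for \<beta> k
  proof -
    have "(\<Sum>k\<in>{r<..n}. Q' (Xmul X \<tau> \<beta>) k * Q' (Xmul X \<tau> \<beta>) k) = 0"
      unfolding eq using adaptedD(3)[OF ad] by simp
    then show ?thesis using that by (simp add: sum_nonneg_eq_0_iff)
  qed
  have "\<exists>\<beta>. \<forall>k\<in>{1..n}. Q' (Xmul X \<tau> \<beta>) k = (if k \<le> r then z k else 0)" for z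
  proof -
    obtain \<beta> where "\<forall>k\<in>{1..n}. Q (Xmul X \<tau> \<beta>) k = (if k \<le> r then z k else 0)"
      using adaptedD(4)[OF ad] by blast
    then show ?thesis using Q'(2) z by (intro exI[of _ \<beta>]) auto
  qed
  then show ?thesis using z Q'(1) adaptedD(2)[OF ad] by (auto simp: adapted_def)
qed

section \<open>Residual sums of squares in rotated coordinates\<close>

lemma adapted_rss:
  assumes ad: "adapted n X \<tau> Q r"
  shows "rss n X y \<tau> = (\<Sum>k\<in>{r<..n}. (Q y k)\<^sup>2)"
    and "\<exists>\<beta>. rss n X y \<tau> = (L2_set (\<lambda>i. y i - Xmul X \<tau> \<beta> i) {1..n})\<^sup>2"
proof -
  note rot = adaptedD(1)[OF ad]
  \<comment> \<open>Pythagoras: the coefficients act only on the first \<open>r\<close> rotated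
    coordinates, and the others form an irreducible remainder.\<close>
  have eq: "(L2_set (\<lambda>i. y i - Xmul X \<tau> \<beta> i) {1..n})\<^sup>2
      = (\<Sum>k\<in>{1..r}. (Q y k - Q (Xmul X \<tau> \<beta>) k)\<^sup>2) + (\<Sum>k\<in>{r<..n}. (Q y k)\<^sup>2)" for \<beta>
  proof -
    have "(L2_set (\<lambda>i. y i - Xmul X \<tau> \<beta> i) {1..n})\<^sup>2 = ip n (\<lambda>i. y i - Xmul X \<tau> \<beta> i) (\<lambda>i. y i - Xmul X \<tau> \<beta> i)"
      by (simp add: L2_set_power2)
    also have "\<dots> = ip n (\<lambda>k. Q y k - Q (Xmul X \<tau> \<beta>) k) (\<lambda>k. Q y k - Q (Xmul X \<tau> \<beta>) k)"
      unfolding rotation_ip[OF rot, symmetric, of "\<lambda>i. y i - Xmul X \<tau> \<beta> i"]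
      by (rule ip_cong) (use rotation_diff[OF rot, of _ y 1 "Xmul X \<tau> \<beta>"] in \<open>simp_all only: mult_1\<close>)
    also have "\<dots> = (\<Sum>k\<in>{1..r}. (Q y k - Q (Xmul X \<tau> \<beta>) k)\<^sup>2) + (\<Sum>k\<in>{r<..n}. (Q y k)\<^sup>2)"
      unfolding ip_split[OF adaptedD(2)[OF ad]] using adaptedD(3)[OF ad]
      by (simp add: power2_eq_square)
    finally show ?thesis .
  qed
  \<comment> \<open>Surjectivity onto the first \<open>r\<close> coordinates provides coefficients
    that cancel them completely, so the infimum is attained.\<close>
  obtain \<beta>0 where "\<forall>k\<in>{1..n}. Q (Xmul X \<tau> \<beta>0) k = (if k \<le> r then Q y k else 0)"
    using adaptedD(4)[OF ad] by blast
  then have min: "(L2_set (\<lambda>i. y i - Xmul X \<tau> \<beta>0 i) {1..n})\<^sup>2 = (\<Sum>k\<in>{r<..n}. (Q y k)\<^sup>2)"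
    using adaptedD(2)[OF ad] unfolding eq by simp
  show 1: "rss n X y \<tau> = (\<Sum>k\<in>{r<..n}. (Q y k)\<^sup>2)"
    unfolding rss_def
  proof (rule cInf_eq_minimum)
    show "(\<Sum>k\<in>{r<..n}. (Q y k)\<^sup>2) \<in> range (\<lambda>\<beta>. (L2_set (\<lambda>i. y i - Xmul X \<tau> \<beta> i) {1..n})\<^sup>2)"
      by (rule image_eqI[of _ _ \<beta>0]) (simp_all only: min UNIV_I)
  qed (auto simp: eq sum_nonneg)
  show "\<exists>\<beta>. rss n X y \<tau> = (L2_set (\<lambda>i. y i - Xmul X \<tau> \<beta> i) {1..n})\<^sup>2"
    by (rule exI[of _ \<beta>0]) (simp only: min 1)
qed

lemma rss_le: "finite \<tau> \<Longrightarrow> rss n X y \<tau> \<le> (L2_set (\<lambda>i. y i - Xmul X \<tau> \<beta> i) {1..n})\<^sup>2"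
  unfolding rss_def by (rule cINF_lower) (auto intro!: bdd_belowI[of _ 0])

lemma rss_antimono:
  assumes "\<tau> \<subseteq> \<tau>'" "finite \<tau>'" shows "rss n X y \<tau>' \<le> rss n X y \<tau>"
proof -
  have fin: "finite \<tau>" using assms finite_subset by auto
  obtain Q r where "adapted n X \<tau> Q r" by (rule adapted_exists[OF fin])
  then obtain \<beta> where \<beta>: "rss n X y \<tau> = (L2_set (\<lambda>i. y i - Xmul X \<tau> \<beta> i) {1..n})\<^sup>2"
    using adapted_rss(2) by blast
  have "Xmul X \<tau>' (\<lambda>j. if j \<in> \<tau> then \<beta> j else 0) i = Xmul X \<tau> \<beta> i" for i
    unfolding Xmul_def using assms
    by (intro sum.mono_neutral_cong_right) auto
  then show ?thesis
    using rss_le[OF assms(2), of n X y "\<lambda>j. if j \<in> \<tau> then \<beta> j else 0"] by (simp add: \<beta>)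
qed

lemma rss_cong:
  "(\<And>i. i \<in> {1..n} \<Longrightarrow> y i = y' i) \<Longrightarrow> rss n X y \<tau> = rss n X y' \<tau>"
  unfolding rss_def by (intro INF_cong refl arg_cong[where f = "\<lambda>x. x\<^sup>2"] L2_set_cong) auto

lemma rss_shift:
  assumes "finite \<tau>"
  shows "rss n X (\<lambda>i. Xmul X \<tau> \<beta> i + y i) \<tau> = rss n X y \<tau>"
proof -
  obtain Q r where ad: "adapted n X \<tau> Q r" by (rule adapted_exists[OF assms])
  have "Q (\<lambda>i. Xmul X \<tau> \<beta> i + 1 * y i) k = 0 + Q y k" if "k \<in> {r<..n}" for k
    using that adaptedD(1)[OF ad] adaptedD(3)[OF ad]
    by (subst rotation_lin) auto
  then show ?thesis by (simp add: adapted_rss[OF ad])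
qed

lemma rss_scale: 
  assumes "finite \<tau>" shows "rss n X (\<lambda>i. c * y i) \<tau> = c\<^sup>2 * rss n X y \<tau>"
proof -
  obtain Q r where ad: "adapted n X \<tau> Q r" by (rule adapted_exists[OF assms])
  note rot = adaptedD(1)[OF ad]
  have "Q (\<lambda>i. c * y i) k = c * Q y k" if "k \<in> {r<..n}" for k
  proof -
    have "Q (\<lambda>i. 0) k = 0" using that rotation_lin[OF rot, of k "\<lambda>_. 0" 1 "\<lambda>_. 0"] by auto
    then show ?thesis using that rotation_lin[OF rot, of k "\<lambda>_. 0" c y] by auto
  qed
  then show ?thesis by (simp add: adapted_rss[OF ad] power_mult_distrib sum_distrib_left)
qed

section \<open>The noise vector as an additional column\<close>

text \<open>Column 0, which belongs to no model, carries the synthetic noise vector.\<close>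

definition aug :: "(nat \<Rightarrow> nat \<Rightarrow> real) \<Rightarrow> (nat \<Rightarrow> real) \<Rightarrow> nat \<Rightarrow> nat \<Rightarrow> real" where
  "aug X u i j = (if j = 0 then u i else X i j)"

text \<open>The inner minimum over coefficients and noise scale is again a least squares problem, so
  everything proved for \<open>rss\<close> with an arbitrary design applies to it.\<close>

definition rss1 ::
  "nat \<Rightarrow> (nat \<Rightarrow> nat \<Rightarrow> real) \<Rightarrow> (nat \<Rightarrow> real) \<Rightarrow> (nat \<Rightarrow> real) \<Rightarrow> nat set \<Rightarrow> real" where
  "rss1 n X u y \<tau> = rss n (aug X u) y (insert 0 \<tau>)"

lemma Xmul_aug: "0 \<notin> \<tau> \<Longrightarrow> Xmul (aug X u) \<tau> = Xmul X \<tau>"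
  by (auto simp: Xmul_def aug_def fun_eq_iff intro!: sum.cong)

lemma Xmul_aug_insert:
  "0 \<notin> \<tau> \<Longrightarrow> finite \<tau> \<Longrightarrow> Xmul (aug X u) (insert 0 \<tau>) \<beta> = (\<lambda>i. Xmul X \<tau> \<beta> i + \<beta> 0 * u i)"
  by (simp add: Xmul_insert Xmul_aug aug_def)

lemma adapted_aug: "0 \<notin> \<tau> \<Longrightarrow> adapted n (aug X u) \<tau> Q r \<longleftrightarrow> adapted n X \<tau> Q r"
  by (simp add: adapted_def Xmul_aug)

lemma rss1_eq_INF:
  assumes "0 \<notin> \<tau>" "finite \<tau>"
  shows "rss1 n X u y \<tau> = (INF (\<beta>, \<sigma>). (L2_set (\<lambda>i. y i - Xmul X \<tau> \<beta> i - \<sigma> * u i) {1..n})\<^sup>2)"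
proof -
  have "(\<lambda>\<beta>. (L2_set (\<lambda>i. y i - Xmul (aug X u) (insert 0 \<tau>) \<beta> i) {1..n})\<^sup>2) ` UNIV
     = (\<lambda>(\<beta>, \<sigma>). (L2_set (\<lambda>i. y i - Xmul X \<tau> \<beta> i - \<sigma> * u i) {1..n})\<^sup>2) ` UNIV" (is "range ?f = range ?g")
  proof (intro equalityI image_subsetI)
    fix \<beta> show "?f \<beta> \<in> range ?g"
      by (rule image_eqI[of _ _ "(\<beta>, \<beta> 0)"]) (auto simp: Xmul_aug_insert assms algebra_simps)
  next
    fix b :: "(nat \<Rightarrow> real) \<times> real"
    obtain \<beta> \<sigma> where b: "b = (\<beta>, \<sigma>)" by fastforce
    have "Xmul X \<tau> (\<beta>(0 := \<sigma>)) = Xmul X \<tau> \<beta>" by (rule Xmul_cong) (use assms in auto)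
    then show "?g b \<in> range ?f"
      by (intro image_eqI[of _ _ "\<beta>(0 := \<sigma>)"]) (auto simp: b Xmul_aug_insert assms algebra_simps)
  qed
  then show ?thesis by (simp add: rss1_def rss_def)
qed

lemma INF_add_const:
  fixes f :: "'a \<Rightarrow> real"
  assumes "bdd_below (range f)"
  shows "(INF b. f b + c) = (INF b. f b) + c"
proof (rule antisym)
  have "bdd_below (range (\<lambda>b. f b + c))"
    using assms by (auto simp: bdd_below_def intro: add_right_mono)
  then have "(INF b. f b + c) \<le> f b + c" for b by (rule cINF_lower) auto
  then have "(INF b. f b + c) - c \<le> (INF b. f b)" by (intro cINF_greatest) (auto simp: algebra_simps)
  then show "(INF b. f b + c) \<le> (INF b. f b) + c" by simp
  show "(INF b. f b) + c \<le> (INF b. f b + c)"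
    by (rule cINF_greatest) (auto intro: cINF_lower[OF assms])
qed

lemma pen_loss_eq:
  assumes "0 \<notin> \<tau>" "finite \<tau>"
  shows "pen_loss n X lam y u \<tau> = rss1 n X u y \<tau> + lam * real (card \<tau>)"
proof -
  have "pen_loss n X lam y u \<tau> =
    (INF b. (case b of (\<beta>, \<sigma>) \<Rightarrow> (L2_set (\<lambda>i. y i - Xmul X \<tau> \<beta> i - \<sigma> * u i) {1..n})\<^sup>2) + lam * real (card \<tau>))"
    unfolding pen_loss_def by (rule INF_cong) auto
  also have "\<dots> = (INF (\<beta>, \<sigma>). (L2_set (\<lambda>i. y i - Xmul X \<tau> \<beta> i - \<sigma> * u i) {1..n})\<^sup>2) + lam * real (card \<tau>)"
    by (rule INF_add_const) (auto intro!: bdd_belowI[of _ 0])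
  finally show ?thesis by (simp add: rss1_eq_INF assms)
qed

text \<open>For a fixed noise scale the minimum over coefficients is a quadratic A - 2 * \<sigma> *
  B + \<sigma>^2 * D, minimal at \<sigma> = B / D. The rotation here depends on the design alone and
  not on \<open>u\<close>, unlike a rotation adapted to the augmented design, which is what makes
  the formula usable when \<open>u\<close> is random.\<close>

lemma rss1_closed_form:
  assumes ad: "adapted n X \<tau> Q r" and \<tau>: "0 \<notin> \<tau>" "finite \<tau>"
  shows "rss1 n X u y \<tau> = (\<Sum>k\<in>{r<..n}. (Q y k)\<^sup>2)
     - (\<Sum>k\<in>{r<..n}. Q y k * Q u k)\<^sup>2 / (\<Sum>k\<in>{r<..n}. (Q u k)\<^sup>2)"
proof -
  note rot = adaptedD(1)[OF ad]
  define A where "A = (\<Sum>k\<in>{r<..n}. (Q y k)\<^sup>2)"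
  define B where "B = (\<Sum>k\<in>{r<..n}. Q y k * Q u k)"
  define D where "D = (\<Sum>k\<in>{r<..n}. (Q u k)\<^sup>2)"
  have shift: "rss n X (\<lambda>i. y i - \<sigma> * u i) \<tau> = A - 2 * \<sigma> * B + \<sigma>\<^sup>2 * D" for \<sigma>
  proof -
    have "rss n X (\<lambda>i. y i - \<sigma> * u i) \<tau> = (\<Sum>k\<in>{r<..n}. (Q y k)\<^sup>2 - 2 * \<sigma> * (Q y k * Q u k) + \<sigma>\<^sup>2 * (Q u k)\<^sup>2)"
      unfolding adapted_rss(1)[OF ad]
    proof (rule sum.cong)
      fix k assume "k \<in> {r<..n}"
      then have "Q (\<lambda>i. y i - \<sigma> * u i) k = Q y k - \<sigma> * Q u k"
        by (intro rotation_diff[OF rot]) auto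
      then show "(Q (\<lambda>i. y i - \<sigma> * u i) k)\<^sup>2 = (Q y k)\<^sup>2 - 2 * \<sigma> * (Q y k * Q u k) + \<sigma>\<^sup>2 * (Q u k)\<^sup>2"
        by (simp only:) (simp add: power2_eq_square algebra_simps)
    qed simp
    then show ?thesis
      by (simp add: A_def B_def D_def sum.distrib sum_subtractf sum_distrib_left)
  qed
  define F where "F = (\<lambda>(\<beta>, \<sigma>). (L2_set (\<lambda>i. y i - Xmul X \<tau> \<beta> i - \<sigma> * u i) {1..n})\<^sup>2)"
  have attained: "\<exists>\<beta>. F (\<beta>, \<sigma>) = A - 2 * \<sigma> * B + \<sigma>\<^sup>2 * D" for \<sigma>
    using adapted_rss(2)[OF ad, of "\<lambda>i. y i - \<sigma> * u i"]
    by (auto simp: F_def shift algebra_simps)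
  have lower: "A - 2 * \<sigma> * B + \<sigma>\<^sup>2 * D \<le> F (\<beta>, \<sigma>)" for \<beta> \<sigma>
    using rss_le[OF \<tau>(2), of n X "\<lambda>i. y i - \<sigma> * u i" \<beta>] by (simp add: F_def shift algebra_simps)
  have D0: "D \<ge> 0" by (simp add: D_def sum_nonneg)
  \<comment> \<open>If the noise vector lies in the column span, D = 0 forces B = 0, and the
    convention x / 0 = 0 makes the formula correct in this case too.\<close>
  have B0: "B = 0" if "D = 0"
  proof -
    have "Q u k = 0" if "k \<in> {r<..n}" for k
      using that \<open>D = 0\<close> by (simp add: D_def sum_nonneg_eq_0_iff)
    then show ?thesis by (simp add: B_def)
  qed
  have quad: "A - B\<^sup>2 / D \<le> A - 2 * \<sigma> * B + \<sigma>\<^sup>2 * D" for \<sigma>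
  proof (cases "D = 0")
    case False
    then have "A - 2 * \<sigma> * B + \<sigma>\<^sup>2 * D - (A - B\<^sup>2 / D) = (\<sigma> * D - B)\<^sup>2 / D"
      by (simp add: field_simps power2_eq_square)
    then show ?thesis using D0 by (metis diff_ge_0_iff_ge divide_nonneg_nonneg zero_le_power2)
  qed (simp add: B0)
  have "(INF b. F b) = A - B\<^sup>2 / D"
  proof (rule cInf_eq_minimum)
    obtain \<beta> where "F (\<beta>, B / D) = A - 2 * (B / D) * B + (B / D)\<^sup>2 * D" using attained by blast
    also have "\<dots> = A - B\<^sup>2 / D" by (cases "D = 0") (auto simp: field_simps power2_eq_square)
    finally show "A - B\<^sup>2 / D \<in> range F" by (metis rangeI)
    show "A - B\<^sup>2 / D \<le> x" if x: "x \<in> range F" for x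
    proof -
      obtain b where "x = F b" using x by blast
      then show ?thesis using lower[of "snd b" "fst b"] quad[of "snd b"] by simp
    qed
  qed
  then show ?thesis unfolding rss1_eq_INF[OF \<tau>] F_def A_def B_def D_def by simp
qed

text \<open>The numbers \<open>Q (\<lambda>l. of_bool (l = i)) k\<close> are the matrix entries of
  the rotation, so the sums transport rotated coordinates back: those up to \<open>r\<close> give
  the projection, the others the residual.\<close>

lemma proj_resid_adapted:
  assumes ad: "adapted n X \<tau> Q r"
  defines "h \<equiv> (\<lambda>y. \<lambda>i\<in>{1..n}. \<Sum>k\<in>{1..r}. Q (\<lambda>l. of_bool (l = i)) k * Q y k)"
  shows "proj n X \<tau> y = h y"
    and "i \<in> {1..n} \<Longrightarrow> resid n X \<tau> y i = (\<Sum>k\<in>{r<..n}. Q (\<lambda>l. of_bool (l = i)) k * Q y k)"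
    and "(L2_set (resid n X \<tau> y) {1..n})\<^sup>2 = (\<Sum>k\<in>{r<..n}. (Q y k)\<^sup>2)"
proof -
  note rot = adaptedD(1)[OF ad]
  note rn = adaptedD(2)[OF ad]
  have coord: "x i = ip n (Q (\<lambda>l. of_bool (l = i))) (Q x)" if "i \<in> {1..n}" for x :: "nat \<Rightarrow> real" and i
    unfolding rotation_ip[OF rot] using that by (simp add: ip_def)
  obtain \<beta> where \<beta>: "\<forall>k\<in>{1..n}. Q (Xmul X \<tau> \<beta>) k = (if k \<le> r then Q y k else 0)"
    using adaptedD(4)[OF ad] by blast
  have hX: "h y i = Xmul X \<tau> \<beta> i" if "i \<in> {1..n}" for i
    using that coord[OF that, of "Xmul X \<tau> \<beta>"] \<beta> rn by (simp add: h_def ip_split[OF rn])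
  have h_eq: "h y = restrict (Xmul X \<tau> \<beta>) {1..n}"
    using hX by (auto simp: h_def fun_eq_iff restrict_def)
  have Qh: "Q (h y) k = (if k \<le> r then Q y k else 0)" if "k \<in> {1..n}" for k
    using rotation_cong[OF rot, of "h y" "Xmul X \<tau> \<beta>"] hX \<beta> that by simp
  have Qd: "Q (\<lambda>i. y i - h y i) k = (if k \<le> r then 0 else Q y k)" if "k \<in> {1..n}" for k
    using rotation_lin[OF rot that, of y "-1" "h y"] Qh[OF that] by simp
  have orth: "(\<Sum>i\<in>{1..n}. (y i - h y i) * v i) = 0" if v: "v \<in> col_span n X \<tau>" for v
  proof -
    obtain \<gamma> where "v = restrict (Xmul X \<tau> \<gamma>) {1..n}" using v by (auto simp: col_span_def)
    then have Qv: "Q v = Q (Xmul X \<tau> \<gamma>)" by (intro rotation_cong[OF rot]) auto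
    have "(\<Sum>i\<in>{1..n}. (y i - h y i) * v i) = ip n (Q (\<lambda>i. y i - h y i)) (Q v)"
      unfolding rotation_ip[OF rot] by (simp add: ip_def)
    also have "\<dots> = 0"
      unfolding Qv ip_split[OF rn] using Qd adaptedD(3)[OF ad] rn by simp
    finally show ?thesis .
  qed
  show pr: "proj n X \<tau> y = h y"
    unfolding proj_def
  proof (rule the_equality)
    show "h y \<in> col_span n X \<tau> \<and> (\<forall>v\<in>col_span n X \<tau>. (\<Sum>i = 1..n. (y i - h y i) * v i) = 0)"
      using h_eq orth by (auto simp: col_span_def)
  next
    fix h' assume h': "h' \<in> col_span n X \<tau> \<and> (\<forall>v\<in>col_span n X \<tau>. (\<Sum>i = 1..n. (y i - h' i) * v i) = 0)"
    then obtain \<gamma> where \<gamma>: "h' = restrict (Xmul X \<tau> \<gamma>) {1..n}" by (auto simp: col_span_def)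
    define v where "v = restrict (Xmul X \<tau> (\<lambda>j. \<beta> j - \<gamma> j)) {1..n}"
    have v: "v \<in> col_span n X \<tau>" by (auto simp: v_def col_span_def)
    have vi: "v i = h y i - h' i" if "i \<in> {1..n}" for i
      using that hX[OF that] by (simp add: v_def \<gamma> Xmul_def sum_subtractf algebra_simps)
    \<comment> \<open>Two vectors that satisfy the description of the projection differ by an
      element of the span orthogonal to the span, hence to itself.\<close>
    have "ip n v v = (\<Sum>i = 1..n. (y i - h' i) * v i) - (\<Sum>i = 1..n. (y i - h y i) * v i)"
      unfolding ip_def sum_subtractf[symmetric] by (rule sum.cong) (auto simp: vi algebra_simps)
    also have "\<dots> = 0" using orth[OF v] h' v by simp
    finally have "\<forall>i\<in>{1..n}. v i = 0" by (simp add: ip_self_eq_0_iff)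
    then show "h' = h y"
      using vi by (auto simp: fun_eq_iff h_def \<gamma> restrict_def)
  qed
  show "resid n X \<tau> y i = (\<Sum>k\<in>{r<..n}. Q (\<lambda>l. of_bool (l = i)) k * Q y k)" if i: "i \<in> {1..n}"
    using coord[OF i, of y] i by (simp add: resid_def pr h_def ip_split[OF rn])
  have "(L2_set (resid n X \<tau> y) {1..n})\<^sup>2 = ip n (Q (\<lambda>i. y i - h y i)) (Q (\<lambda>i. y i - h y i))"
    unfolding rotation_ip[OF rot] by (simp add: L2_set_power2 resid_def pr)
  also have "\<dots> = (\<Sum>k\<in>{r<..n}. (Q y k)\<^sup>2)"
    unfolding ip_split[OF rn] using Qd rn by (simp add: power2_eq_square)
  finally show "(L2_set (resid n X \<tau> y) {1..n})\<^sup>2 = (\<Sum>k\<in>{r<..n}. (Q y k)\<^sup>2)" .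
qed

section \<open>Rotation invariance of the Gaussian law\<close>

abbreviation N01 :: "real measure" where
  "N01 \<equiv> density lborel (\<lambda>x. ennreal (std_normal_density x))"

definition gauss :: "nat set \<Rightarrow> (nat \<Rightarrow> real) measure" where
  "gauss J = (\<Pi>\<^sub>M i\<in>J. N01)"

abbreviation leb :: "nat set \<Rightarrow> (nat \<Rightarrow> real) measure" where
  "leb J \<equiv> \<Pi>\<^sub>M i\<in>J. lborel"

interpretation leb: product_sigma_finite "\<lambda>_::nat. lborel :: real measure"
  by standard

interpretation N01: prob_space N01
  by (rule prob_space_normal_density) simp

interpretation gauss1: product_sigma_finite "\<lambda>_::nat. N01"
  by standard

lemma std_gauss_eq: "std_gauss n = gauss {1..n}"
  by (simp add: std_gauss_def gauss_def)

lemma prob_space_gauss: "prob_space (gauss J)"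
  unfolding gauss_def by (rule prob_space_PiM) (rule N01.prob_space_axioms)

lemma sets_gauss [measurable_cong, simp]: "sets (gauss J) = sets (\<Pi>\<^sub>M i\<in>J. borel)"
  unfolding gauss_def by (intro sets_PiM_cong) auto

lemma space_gauss: "space (gauss J) = Pi\<^sub>E J (\<lambda>_. UNIV)"
  by (simp add: gauss_def space_PiM)

lemma gauss_eq_density:
  assumes "finite J"
  shows "gauss J = density (leb J) (\<lambda>x. \<Prod>i\<in>J. ennreal (std_normal_density (x i)))"
  unfolding gauss_def
proof (rule gauss1.PiM_eqI[symmetric, OF assms])
  show "sets (density (leb J) (\<lambda>x. \<Prod>i\<in>J. ennreal (std_normal_density (x i)))) = sets (\<Pi>\<^sub>M i\<in>J. N01)"
    by (simp cong: sets_PiM_cong)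
next
  fix A assume "\<And>i. i \<in> J \<Longrightarrow> A i \<in> sets N01"
  then have A[measurable]: "\<And>i. i \<in> J \<Longrightarrow> A i \<in> sets borel" by simp
  then have Pi: "Pi\<^sub>E J A \<in> sets (leb J)" using assms by (intro sets_PiM_I_finite) auto
  have "emeasure (density (leb J) (\<lambda>x. \<Prod>i\<in>J. ennreal (std_normal_density (x i)))) (Pi\<^sub>E J A)
     = (\<integral>\<^sup>+x. (\<Prod>i\<in>J. ennreal (std_normal_density (x i))) * indicator (Pi\<^sub>E J A) x \<partial>leb J)"
    using Pi by (subst emeasure_density) auto
  also have "\<dots> = (\<integral>\<^sup>+x. (\<Prod>i\<in>J. ennreal (std_normal_density (x i)) * indicator (A i) (x i)) \<partial>leb J)"
  proof (rule nn_integral_cong)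
    fix x assume "x \<in> space (leb J)"
    then have "indicator (Pi\<^sub>E J A) x = (\<Prod>i\<in>J. indicator (A i) (x i) :: ennreal)"
      using assms by (auto simp: space_PiM indicator_def PiE_iff prod_zero_iff)
    then show "(\<Prod>i\<in>J. ennreal (std_normal_density (x i))) * indicator (Pi\<^sub>E J A) x
        = (\<Prod>i\<in>J. ennreal (std_normal_density (x i)) * indicator (A i) (x i))"
      by (simp add: prod.distrib)
  qed
  also have "\<dots> = (\<Prod>i\<in>J. \<integral>\<^sup>+x. ennreal (std_normal_density x) * indicator (A i) x \<partial>lborel)"
    using A assms by (intro leb.product_nn_integral_prod) auto
  also have "\<dots> = (\<Prod>i\<in>J. emeasure N01 (A i))"
    using A by (intro prod.cong) (auto simp: emeasure_density)
  finally show "emeasure (density (leb J) (\<lambda>x. \<Prod>i\<in>J. ennreal (std_normal_density (x i)))) (Pi\<^sub>E J A) = \<dots>" .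
qed

text \<open>The joint Gaussian density as a function of the squared radius alone; in this form its
  invariance under isometries is immediate.\<close>

definition gdens :: "nat set \<Rightarrow> real \<Rightarrow> ennreal" where
  "gdens J t = ennreal ((1 / sqrt (2 * pi)) ^ card J * exp (- t / 2))"

lemma measurable_gdens [measurable]: "gdens J \<in> borel_measurable borel"
  unfolding gdens_def[abs_def] by measurable

lemma prod_std_normal_density:
  assumes "finite J"
  shows "(\<Prod>i\<in>J. ennreal (std_normal_density (x i))) = gdens J (\<Sum>i\<in>J. (x i)\<^sup>2)"
proof -
  have "(\<Prod>i\<in>J. ennreal (std_normal_density (x i))) = ennreal (\<Prod>i\<in>J. std_normal_density (x i))"
    by (rule prod_ennreal) simp
  also have "(\<Prod>i\<in>J. std_normal_density (x i)) = (1 / sqrt (2 * pi)) ^ card J * exp (\<Sum>i\<in>J. - (x i)\<^sup>2 / 2)"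
    using assms by (simp only: std_normal_density_def prod.distrib prod_constant exp_sum)
  also have "(\<Sum>i\<in>J. - (x i)\<^sup>2 / 2) = - (\<Sum>i\<in>J. (x i)\<^sup>2) / 2"
    by (simp add: sum_divide_distrib sum_negf)
  finally show ?thesis by (simp add: gdens_def)
qed

lemma nn_integral_gauss:
  assumes "finite J" "f \<in> borel_measurable (\<Pi>\<^sub>M i\<in>J. borel)"
  shows "(\<integral>\<^sup>+x. f x \<partial>gauss J) = (\<integral>\<^sup>+x. gdens J (\<Sum>i\<in>J. (x i)\<^sup>2) * f x \<partial>leb J)"
  unfolding gauss_eq_density[OF assms(1)]
  using assms(2) by (subst nn_integral_density) (auto simp: prod_std_normal_density[OF assms(1)] cong: measurable_cong_sets sets_PiM_cong)

text \<open>Only diagonal affine maps are treated: they send boxes to boxes, so the one-dimensional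
  substitution rule in each factor determines the product measure. Translations and dilations are
  the cases used.\<close>

lemma leb_affine:
  assumes J: "finite J" and c: "\<And>i. i \<in> J \<Longrightarrow> c i \<noteq> 0"
    and f: "f \<in> borel_measurable (\<Pi>\<^sub>M i\<in>J. borel)"
  shows "(\<integral>\<^sup>+x. f x \<partial>leb J) = (\<Prod>i\<in>J. ennreal \<bar>c i\<bar>) * (\<integral>\<^sup>+x. f (\<lambda>i\<in>J. a i + c i * x i) \<partial>leb J)"
proof -
  define T where "T = (\<lambda>x. \<lambda>i\<in>J. a i + c i * x i :: real)"
  have T[measurable]: "T \<in> measurable (leb J) (leb J)"
    unfolding T_def by measurable
  have "density (distr (leb J) (leb J) T) (\<lambda>_. \<Prod>i\<in>J. ennreal \<bar>c i\<bar>) = leb J"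
  proof (rule leb.PiM_eqI[OF J])
    fix A assume A: "\<And>i. i \<in> J \<Longrightarrow> A i \<in> sets (lborel :: real measure)"
    then have Pi[measurable]: "Pi\<^sub>E J A \<in> sets (leb J)" using J by (intro sets_PiM_I_finite) auto
    have B: "(\<lambda>x. a i + c i * x) -` A i \<in> sets lborel" if "i \<in> J" for i
      using measurable_sets[of "\<lambda>x. a i + c i * x" borel borel "A i"] A[OF that] by simp
    have vi: "T -` Pi\<^sub>E J A \<inter> space (leb J) = Pi\<^sub>E J (\<lambda>i. (\<lambda>x. a i + c i * x) -` A i)"
      by (auto simp: T_def space_PiM PiE_iff)
    have "emeasure (density (distr (leb J) (leb J) T) (\<lambda>_. \<Prod>i\<in>J. ennreal \<bar>c i\<bar>)) (Pi\<^sub>E J A)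
      = (\<Prod>i\<in>J. ennreal \<bar>c i\<bar>) * emeasure (leb J) (Pi\<^sub>E J (\<lambda>i. (\<lambda>x. a i + c i * x) -` A i))"
      by (subst emeasure_density_const) (auto simp: emeasure_distr vi)
    also have "\<dots> = (\<Prod>i\<in>J. ennreal \<bar>c i\<bar> * emeasure lborel ((\<lambda>x. a i + c i * x) -` A i))"
      using B J by (subst leb.emeasure_PiM) (auto simp: prod.distrib)
    also have "\<dots> = (\<Prod>i\<in>J. emeasure lborel (A i))"
    proof (rule prod.cong)
      fix i assume i: "i \<in> J"
      show "ennreal \<bar>c i\<bar> * emeasure lborel ((\<lambda>x. a i + c i * x) -` A i) = emeasure lborel (A i)"
        using A[OF i] by (subst (2) lborel_real_affine[OF c[OF i], of "a i"])
          (simp add: emeasure_density_const emeasure_distr)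
    qed simp
    finally show "emeasure (density (distr (leb J) (leb J) T) (\<lambda>_. \<Prod>i\<in>J. ennreal \<bar>c i\<bar>)) (Pi\<^sub>E J A)
      = (\<Prod>i\<in>J. emeasure lborel (A i))" .
  qed simp
  then have "(\<integral>\<^sup>+x. f x \<partial>leb J) = (\<integral>\<^sup>+x. f x \<partial>density (distr (leb J) (leb J) T) (\<lambda>_. \<Prod>i\<in>J. ennreal \<bar>c i\<bar>))"
    by simp
  also have "\<dots> = (\<Prod>i\<in>J. ennreal \<bar>c i\<bar>) * (\<integral>\<^sup>+x. f (T x) \<partial>leb J)"
  proof -
    have f'[measurable]: "f \<in> borel_measurable (leb J)"
      using f by (simp cong: measurable_cong_sets sets_PiM_cong)
    show ?thesis
      by (simp add: nn_integral_density nn_integral_distr nn_integral_cmult)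
  qed
  finally show ?thesis by (simp add: T_def)
qed

lemma measurable_householder [measurable]:
  "householder n v \<in> measurable (\<Pi>\<^sub>M i\<in>{1..n}. borel) (\<Pi>\<^sub>M i\<in>{1..n}. borel)"
  unfolding householder_def ip_def by measurable

text \<open>In the coordinates where \<open>x i\<close> is replaced by \<open>l = \<langle>v, x\<rangle>\<close> a reflection is a translation
  of the other coordinates by a multiple of \<open>l\<close>, followed by \<open>l \<mapsto> -l\<close>.\<close>

lemma leb_householder:
  assumes f[measurable]: "f \<in> borel_measurable (\<Pi>\<^sub>M i\<in>{1..n}. borel)"
  shows "(\<integral>\<^sup>+x. f (householder n v x) \<partial>leb {1..n}) = (\<integral>\<^sup>+x. f x \<partial>leb {1..n})"
proof (cases "\<forall>i\<in>{1..n}. v i = 0")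
  case True
  then have "householder n v x = x" if "x \<in> space (leb {1..n})" for x
    using that by (auto simp: householder_def space_PiM PiE_iff extensional_def)
  then show ?thesis by (intro nn_integral_cong) simp
next
  case False
  then obtain i where i: "i \<in> {1..n}" "v i \<noteq> 0" by auto
  define I where "I = {1..n} - {i}"
  have I: "finite I" "i \<notin> I" and ins: "{1..n} = insert i I" using i by (auto simp: I_def)
  define q where "q = ip n v v"
  have q0: "q \<noteq> 0" using i ip_self_eq_0_iff[of n v] by (auto simp: q_def)
  define s where "s = (\<Sum>k\<in>I. v k * v k)"
  have qs: "q = v i * v i + s" using I by (simp add: q_def s_def ip_def ins)
  define a where "a x = (\<Sum>k\<in>I. v k * x k)" for x :: "nat \<Rightarrow> real"
  have ipv: "ip n v x = v i * x i + a x" for x using I by (simp add: ip_def ins a_def)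
  have a_upd: "a (x(i := y)) = a x" for x y unfolding a_def using I by (intro sum.cong) auto
  have fm[measurable]: "f \<in> borel_measurable (leb (insert i I))"
    using f unfolding ins by (simp cong: measurable_cong_sets sets_PiM_cong)
  have hm: "(\<lambda>x. f (householder n v x)) \<in> borel_measurable (leb (insert i I))"
    using measurable_compose[OF measurable_householder f] unfolding ins
    by (simp cong: measurable_cong_sets sets_PiM_cong)
  have am[measurable]: "a \<in> borel_measurable (leb I)"
    unfolding a_def[abs_def] by measurable
  \<comment> \<open>\<open>G l x\<close> evaluates f at the point with other coordinates
    \<open>x\<close> whose scalar product with \<open>v\<close> is -l, the sign being that of the
    reflected point. \<open>T l\<close> is the translation of the other coordinates by the
    reflection when that product is l.\<close>
  define G where "G l x = f (x(i := (- l - a x) / v i))" for l x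
  define T where "T l x = (\<lambda>k\<in>I. - 2 * l / q * v k + 1 * x k)" for l and x :: "nat \<Rightarrow> real"
  have upd[measurable]: "(\<lambda>(x, y). x(i := y)) \<in> measurable (leb I \<Otimes>\<^sub>M borel) (leb (insert i I))"
    using measurable_add_dim[of i I "\<lambda>_. lborel"] by (simp cong: measurable_cong_sets sets_pair_measure_cong)
  have Gm[measurable]: "(\<lambda>(l, x). G l x) \<in> borel_measurable (borel \<Otimes>\<^sub>M leb I)"
  proof -
    have "(\<lambda>p. (snd p, (- fst p - a (snd p)) / v i)) \<in> measurable (borel \<Otimes>\<^sub>M leb I) (leb I \<Otimes>\<^sub>M borel)"
      by measurable
    from measurable_compose[OF measurable_compose[OF this upd] fm]
    show ?thesis by (simp add: G_def case_prod_beta')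
  qed
  have Tm[measurable]: "(\<lambda>(l, x). T l x) \<in> measurable (borel \<Otimes>\<^sub>M leb I) (leb I)"
    unfolding T_def case_prod_beta' by measurable
  have GTm: "(\<lambda>(l, x). G l (T l x)) \<in> borel_measurable (borel \<Otimes>\<^sub>M leb I)"
  proof -
    have "(\<lambda>p. (fst p, T (fst p) (snd p))) \<in> measurable (borel \<Otimes>\<^sub>M leb I) (borel \<Otimes>\<^sub>M leb I)"
      using Tm by (intro measurable_Pair) (auto simp: case_prod_beta')
    from measurable_compose[OF this Gm] show ?thesis by (simp add: case_prod_beta')
  qed
  have psf: "pair_sigma_finite (lborel :: real measure) (leb I)"
  proof -
    interpret finite_product_sigma_finite "\<lambda>_. lborel :: real measure" I by standard (fact I)
    show ?thesis by standard
  qed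
  have swap: "(\<integral>\<^sup>+x. (\<integral>\<^sup>+l. F l x \<partial>lborel) \<partial>leb I) = (\<integral>\<^sup>+l. (\<integral>\<^sup>+x. F l x \<partial>leb I) \<partial>lborel)"
    if "(\<lambda>(l, x). F l x) \<in> borel_measurable (borel \<Otimes>\<^sub>M leb I)" for F :: "real \<Rightarrow> (nat \<Rightarrow> real) \<Rightarrow> ennreal"
    by (rule pair_sigma_finite.Fubini'[OF psf]) (use that in \<open>simp cong: measurable_cong_sets sets_pair_measure_cong\<close>)
  have updx: "(\<lambda>y. g (x(i := y))) \<in> borel_measurable borel"
    if x: "x \<in> space (leb I)" and g: "g \<in> borel_measurable (leb (insert i I))" for g :: "_ \<Rightarrow> ennreal" and x
  proof -
    have "(\<lambda>y. (x, y)) \<in> measurable borel (leb I \<Otimes>\<^sub>M borel)" using x by measurable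
    from measurable_compose[OF measurable_compose[OF this upd] g] show ?thesis by simp
  qed
  have "(\<integral>\<^sup>+x. f (householder n v x) \<partial>leb {1..n})
      = (\<integral>\<^sup>+x. (\<integral>\<^sup>+y. f (householder n v (x(i := y))) \<partial>lborel) \<partial>leb I)"
    unfolding ins by (rule leb.product_nn_integral_insert[OF I hm])
  also have "\<dots> = (\<integral>\<^sup>+x. ennreal \<bar>1 / v i\<bar> * (\<integral>\<^sup>+l. G l (T l x) \<partial>lborel) \<partial>leb I)"
  proof (rule nn_integral_cong)
    fix x assume x: "x \<in> space (leb I)"
    have "(\<integral>\<^sup>+y. f (householder n v (x(i := y))) \<partial>lborel)
      = ennreal \<bar>1 / v i\<bar> * (\<integral>\<^sup>+l. f (householder n v (x(i := - a x / v i + 1 / v i * l))) \<partial>lborel)"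
      using i by (intro nn_integral_real_affine updx[OF x hm]) auto
    also have "(\<lambda>l. f (householder n v (x(i := - a x / v i + 1 / v i * l)))) = (\<lambda>l. G l (T l x))"
    proof
      \<comment> \<open>The substitution y = (l - a x) / v i makes l the scalar product with
        \<open>v\<close>, so the reflection becomes explicit in (l, x).\<close>
      fix l
      let ?x = "x(i := - a x / v i + 1 / v i * l)"
      have l: "ip n v ?x = l" unfolding ipv a_upd using i by (simp add: field_simps)
      have aT: "a (T l x) = a x - 2 * l / q * s"
        by (simp add: a_def T_def s_def algebra_simps sum.distrib sum_distrib_left sum_subtractf)
      have "- a x / v i + 1 / v i * l - 2 * l / q * v i = (- l - a (T l x)) / v i"
        unfolding aT using i q0 qs by (simp add: field_simps)
      then have "householder n v ?x k = ((T l x)(i := (- l - a (T l x)) / v i)) k" for k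
        using I i unfolding householder_def l q_def[symmetric]
        by (cases "k = i") (auto simp: T_def ins algebra_simps)
      then show "f (householder n v ?x) = G l (T l x)" unfolding G_def by (intro arg_cong[where f = f]) (rule ext)
    qed
    finally show "(\<integral>\<^sup>+y. f (householder n v (x(i := y))) \<partial>lborel) = ennreal \<bar>1 / v i\<bar> * (\<integral>\<^sup>+l. G l (T l x) \<partial>lborel)" .
  qed
  also have "\<dots> = ennreal \<bar>1 / v i\<bar> * (\<integral>\<^sup>+x. (\<integral>\<^sup>+l. G l (T l x) \<partial>lborel) \<partial>leb I)"
    by (rule nn_integral_cmult) (use GTm in measurable)
  also have "(\<integral>\<^sup>+x. (\<integral>\<^sup>+l. G l (T l x) \<partial>lborel) \<partial>leb I) = (\<integral>\<^sup>+l. (\<integral>\<^sup>+x. G l (T l x) \<partial>leb I) \<partial>lborel)"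
    by (rule swap[OF GTm])
  also have "\<dots> = (\<integral>\<^sup>+l. (\<integral>\<^sup>+x. G l x \<partial>leb I) \<partial>lborel)"
  proof (rule nn_integral_cong)
    \<comment> \<open>For fixed l the map \<open>T l\<close> is a pure translation, which Lebesgue
      measure ignores; this is why the order of integration was exchanged.\<close>
    fix l
    have "G l \<in> borel_measurable (\<Pi>\<^sub>M i\<in>I. borel)"
      using measurable_compose[OF measurable_Pair1' Gm, of l] by (simp cong: measurable_cong_sets sets_PiM_cong)
    from leb_affine[OF I(1) _ this, of "\<lambda>_. 1" "\<lambda>k. - 2 * l / q * v k"]
    show "(\<integral>\<^sup>+x. G l (T l x) \<partial>leb I) = (\<integral>\<^sup>+x. G l x \<partial>leb I)" by (simp add: T_def)
  qed
  also have "\<dots> = (\<integral>\<^sup>+x. (\<integral>\<^sup>+l. G l x \<partial>lborel) \<partial>leb I)"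
    by (rule swap[OF Gm, symmetric])
  also have "ennreal \<bar>1 / v i\<bar> * \<dots> = (\<integral>\<^sup>+x. ennreal \<bar>1 / v i\<bar> * (\<integral>\<^sup>+l. G l x \<partial>lborel) \<partial>leb I)"
    by (rule nn_integral_cmult[symmetric]) (use Gm in measurable)
  also have "\<dots> = (\<integral>\<^sup>+x. (\<integral>\<^sup>+y. f (x(i := y)) \<partial>lborel) \<partial>leb I)"
  proof (rule nn_integral_cong)
    fix x assume x: "x \<in> space (leb I)"
    have "(\<integral>\<^sup>+y. f (x(i := y)) \<partial>lborel)
      = ennreal \<bar>- 1 / v i\<bar> * (\<integral>\<^sup>+l. f (x(i := - a x / v i + - 1 / v i * l)) \<partial>lborel)"
      using i by (intro nn_integral_real_affine updx[OF x fm]) auto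
    moreover have "- a x / v i + - 1 / v i * l = (- l - a x) / v i" for l
      using i by (simp add: field_simps)
    ultimately show "ennreal \<bar>1 / v i\<bar> * (\<integral>\<^sup>+l. G l x \<partial>lborel) = (\<integral>\<^sup>+y. f (x(i := y)) \<partial>lborel)"
      by (simp add: G_def)
  qed
  also have "\<dots> = (\<integral>\<^sup>+x. f x \<partial>leb {1..n})"
    unfolding ins by (rule leb.product_nn_integral_insert[OF I fm, symmetric])
  finally show ?thesis .
qed

text \<open>A reflection preserves the squared norm, so the Gaussian density may be evaluated at the
  reflected point and invariance of Lebesgue measure finishes the argument.\<close>

lemma gauss_householder:
  assumes f[measurable]: "f \<in> borel_measurable (\<Pi>\<^sub>M i\<in>{1..n}. borel)"
  shows "(\<integral>\<^sup>+x. f (householder n v x) \<partial>gauss {1..n}) = (\<integral>\<^sup>+x. f x \<partial>gauss {1..n})"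
proof -
  have sq: "(\<Sum>i\<in>{1..n}. (x i)\<^sup>2) = ip n x x" for x by (simp add: ip_def power2_eq_square)
  have "(\<integral>\<^sup>+x. f (householder n v x) \<partial>gauss {1..n})
     = (\<integral>\<^sup>+x. gdens {1..n} (\<Sum>i\<in>{1..n}. (x i)\<^sup>2) * f (householder n v x) \<partial>leb {1..n})"
    by (rule nn_integral_gauss) auto
  also have "\<dots> = (\<integral>\<^sup>+x. gdens {1..n} (\<Sum>i\<in>{1..n}. (householder n v x i)\<^sup>2) * f (householder n v x) \<partial>leb {1..n})"
    by (simp only: sq ip_householder)
  also have "\<dots> = (\<integral>\<^sup>+x. gdens {1..n} (\<Sum>i\<in>{1..n}. (x i)\<^sup>2) * f x \<partial>leb {1..n})"
    by (rule leb_householder) auto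
  also have "\<dots> = (\<integral>\<^sup>+x. f x \<partial>gauss {1..n})"
    by (rule nn_integral_gauss[symmetric]) auto
  finally show ?thesis .
qed

lemma measurable_rotation:
  "rotation n Q \<Longrightarrow> Q \<in> measurable (\<Pi>\<^sub>M i\<in>{1..n}. borel) (\<Pi>\<^sub>M i\<in>{1..n}. borel)"
proof (induction rule: rotation.induct)
  case (rotation_step Q v)
  from measurable_compose[OF this(2) measurable_householder] show ?case .
qed measurable

lemma gauss_rotation:
  "rotation n Q \<Longrightarrow> f \<in> borel_measurable (\<Pi>\<^sub>M i\<in>{1..n}. borel) \<Longrightarrow>
    (\<integral>\<^sup>+x. f (Q x) \<partial>gauss {1..n}) = (\<integral>\<^sup>+x. f x \<partial>gauss {1..n})"
proof (induction arbitrary: f rule: rotation.induct)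
  case rotation_id
  show ?case by (rule nn_integral_cong) (auto simp: space_gauss PiE_restrict)
next
  case (rotation_step Q v)
  have "(\<lambda>x. f (householder n v x)) \<in> borel_measurable (\<Pi>\<^sub>M i\<in>{1..n}. borel)"
    by (rule measurable_compose[OF measurable_householder rotation_step.prems])
  from rotation_step.IH[OF this] gauss_householder[OF rotation_step.prems] show ?case by simp
qed

section \<open>Chernoff bounds for residual sums of squares\<close>

text \<open>The tilted density is s times the centred normal density of standard deviation s, where
  s^2 = 1 / (1 - 2 * a).\<close>

lemma N01_exp_quadratic:
  assumes "a < 1 / 2"
  shows "(\<integral>\<^sup>+z. ennreal (exp (a * z\<^sup>2)) \<partial>N01) = ennreal (1 / sqrt (1 - 2 * a))"
proof -
  define s where "s = 1 / sqrt (1 - 2 * a)"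
  have s: "s > 0" "1 / s\<^sup>2 = 1 - 2 * a" using assms by (auto simp: s_def power_divide)
  interpret P: prob_space "density lborel (normal_density 0 s)"
    by (rule prob_space_normal_density[OF s(1)])
  have eq: "std_normal_density z * exp (a * z\<^sup>2) = s * normal_density 0 s z" for z
  proof -
    have "s / sqrt (2 * pi * s\<^sup>2) = 1 / sqrt (2 * pi)"
      using s(1) by (simp add: real_sqrt_mult)
    moreover have "- z\<^sup>2 / (2 * s\<^sup>2) = - z\<^sup>2 / 2 + a * z\<^sup>2"
    proof -
      have "- z\<^sup>2 / (2 * s\<^sup>2) = - z\<^sup>2 / 2 * (1 / s\<^sup>2)" by simp
      then show ?thesis unfolding s(2) by (simp add: algebra_simps)
    qed
    moreover have "s * normal_density 0 s z = s / sqrt (2 * pi * s\<^sup>2) * exp (- z\<^sup>2 / (2 * s\<^sup>2))"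
      by (simp add: normal_density_def)
    ultimately have "s * normal_density 0 s z = 1 / sqrt (2 * pi) * (exp (- z\<^sup>2 / 2) * exp (a * z\<^sup>2))"
      by (simp only: exp_add)
    then show ?thesis by (simp add: std_normal_density_def)
  qed
  have "(\<integral>\<^sup>+z. ennreal (exp (a * z\<^sup>2)) \<partial>N01) = (\<integral>\<^sup>+z. ennreal s * ennreal (normal_density 0 s z) \<partial>lborel)"
    by (subst nn_integral_density) (auto simp: ennreal_mult''[symmetric] eq less_imp_le[OF s(1)] simp flip: ennreal_mult)
  also have "\<dots> = ennreal s * emeasure (density lborel (normal_density 0 s)) (space lborel)"
    by (subst nn_integral_cmult) (auto simp: emeasure_density)
  also have "\<dots> = ennreal s" using P.emeasure_space_1 by simp
  finally show ?thesis by (simp add: s_def)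
qed

text \<open>Completing the square turns the tilted density into the normal density with mean
  \<open>b\<close>.\<close>

lemma N01_exp_linear:
  "(\<integral>\<^sup>+z. ennreal (exp (b * z)) \<partial>N01) = ennreal (exp (b\<^sup>2 / 2))"
proof -
  interpret P: prob_space "density lborel (normal_density b 1)"
    by (rule prob_space_normal_density) simp
  have eq: "std_normal_density z * exp (b * z) = exp (b\<^sup>2 / 2) * normal_density b 1 z" for z
  proof -
    have "- z\<^sup>2 / 2 + b * z = b\<^sup>2 / 2 - (z - b)\<^sup>2 / 2"
      by (simp add: power2_eq_square field_simps)
    then have "exp (- z\<^sup>2 / 2) * exp (b * z) = exp (b\<^sup>2 / 2) * exp (- (z - b)\<^sup>2 / 2)"
      by (simp add: exp_add[symmetric])
    then show ?thesis by (simp add: normal_density_def)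
  qed
  have "(\<integral>\<^sup>+z. ennreal (exp (b * z)) \<partial>N01) = (\<integral>\<^sup>+z. ennreal (exp (b\<^sup>2 / 2)) * ennreal (normal_density b 1 z) \<partial>lborel)"
    by (subst nn_integral_density) (auto simp: eq simp flip: ennreal_mult)
  also have "\<dots> = ennreal (exp (b\<^sup>2 / 2)) * emeasure (density lborel (normal_density b 1)) (space lborel)"
    by (subst nn_integral_cmult) (auto simp: emeasure_density)
  also have "\<dots> = ennreal (exp (b\<^sup>2 / 2))" using P.emeasure_space_1 by simp
  finally show ?thesis .
qed

lemma gauss_exp_quadratic:
  assumes J: "finite J" and a: "\<And>k. k \<in> J \<Longrightarrow> a k < 1 / 2"
  shows "(\<integral>\<^sup>+z. ennreal (exp (\<Sum>k\<in>J. a k * (z k)\<^sup>2)) \<partial>gauss J) = ennreal (\<Prod>k\<in>J. 1 / sqrt (1 - 2 * a k))"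
proof -
  have "(\<integral>\<^sup>+z. ennreal (exp (\<Sum>k\<in>J. a k * (z k)\<^sup>2)) \<partial>gauss J)
      = (\<integral>\<^sup>+z. (\<Prod>k\<in>J. ennreal (exp (a k * (z k)\<^sup>2))) \<partial>gauss J)"
    by (simp add: exp_sum J prod_ennreal)
  also have "\<dots> = (\<Prod>k\<in>J. \<integral>\<^sup>+z. ennreal (exp (a k * z\<^sup>2)) \<partial>N01)"
    unfolding gauss_def by (rule gauss1.product_nn_integral_prod[OF J]) auto
  also have "\<dots> = (\<Prod>k\<in>J. ennreal (1 / sqrt (1 - 2 * a k)))"
    using a by (intro prod.cong refl N01_exp_quadratic) auto
  also have "\<dots> = ennreal (\<Prod>k\<in>J. 1 / sqrt (1 - 2 * a k))"
    using a by (intro prod_ennreal) (fastforce intro: less_imp_le)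
  finally show ?thesis .
qed

lemma gauss_exp_linear:
  assumes J: "finite J"
  shows "(\<integral>\<^sup>+z. ennreal (exp (\<Sum>k\<in>J. a k * z k)) \<partial>gauss J) = ennreal (exp ((\<Sum>k\<in>J. (a k)\<^sup>2) / 2))"
proof -
  have "(\<integral>\<^sup>+z. ennreal (exp (\<Sum>k\<in>J. a k * z k)) \<partial>gauss J)
      = (\<integral>\<^sup>+z. (\<Prod>k\<in>J. ennreal (exp (a k * z k))) \<partial>gauss J)"
    by (simp add: exp_sum J prod_ennreal)
  also have "\<dots> = (\<Prod>k\<in>J. \<integral>\<^sup>+z. ennreal (exp (a k * z)) \<partial>N01)"
    unfolding gauss_def by (rule gauss1.product_nn_integral_prod[OF J]) auto
  also have "\<dots> = (\<Prod>k\<in>J. ennreal (exp ((a k)\<^sup>2 / 2)))"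
    by (intro prod.cong refl N01_exp_linear)
  also have "\<dots> = ennreal (exp ((\<Sum>k\<in>J. (a k)\<^sup>2) / 2))"
    by (simp add: prod_ennreal sum_divide_distrib exp_sum J)
  finally show ?thesis .
qed

section \<open>Tail bounds under the Gaussian law\<close>

lemma measurable_rotation_component:
  assumes "rotation n Q" "k \<in> {1..n}" "f \<in> measurable N (\<Pi>\<^sub>M i\<in>{1..n}. borel)"
  shows "(\<lambda>x. Q (f x) k) \<in> borel_measurable N"
  using measurable_compose[OF measurable_compose[OF assms(3) measurable_rotation[OF assms(1)]]
      measurable_component_singleton[OF assms(2)]] by simp

lemma measurable_rss:
  assumes "finite \<tau>" "f \<in> measurable N (\<Pi>\<^sub>M i\<in>{1..n}. borel)"
  shows "(\<lambda>x. rss n X (f x) \<tau>) \<in> borel_measurable N"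
proof -
  obtain Q r where ad: "adapted n X \<tau> Q r" by (rule adapted_exists[OF assms(1)])
  have [measurable]: "(\<lambda>x. Q (f x) k) \<in> borel_measurable N" if "k \<in> {r<..n}" for k
    using that assms(2) by (intro measurable_rotation_component[OF adaptedD(1)[OF ad]]) auto
  show ?thesis unfolding adapted_rss(1)[OF ad] by measurable
qed

text \<open>The rotation of the augmented design would vary with the random vector
  \<open>g x\<close>, so measurability is taken from the closed form, whose rotation is
  fixed.\<close>

lemma measurable_rss1:
  assumes "finite \<tau>" "0 \<notin> \<tau>" "f \<in> measurable N (\<Pi>\<^sub>M i\<in>{1..n}. borel)" "g \<in> measurable N (\<Pi>\<^sub>M i\<in>{1..n}. borel)"
  shows "(\<lambda>x. rss1 n X (g x) (f x) \<tau>) \<in> borel_measurable N"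
proof -
  obtain Q r where ad: "adapted n X \<tau> Q r" by (rule adapted_exists[OF assms(1)])
  have [measurable]: "(\<lambda>x. Q (f x) k) \<in> borel_measurable N" "(\<lambda>x. Q (g x) k) \<in> borel_measurable N"
    if "k \<in> {r<..n}" for k
    using that assms(3,4) by (auto intro!: measurable_rotation_component[OF adaptedD(1)[OF ad]])
  show ?thesis unfolding rss1_closed_form[OF ad assms(2,1)] by measurable
qed

text \<open>The Chernoff step shared by all tail bounds: an exponent that is nonnegative on the
  event dominates its indicator, and the rotation is then removed by invariance, leaving an integral
  over independent normal coordinates.\<close>

lemma emeasure_le_rotated_exp:
  assumes Q: "rotation n Q" and A: "A \<in> sets (\<Pi>\<^sub>M i\<in>{1..n}. borel)"
    and g: "g \<in> borel_measurable (\<Pi>\<^sub>M i\<in>{1..n}. borel)"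
    and le: "\<And>u. u \<in> A \<Longrightarrow> 0 \<le> g (Q u)"
  shows "emeasure (gauss {1..n}) A \<le> (\<integral>\<^sup>+z. ennreal (exp (g z)) \<partial>gauss {1..n})"
proof -
  have "emeasure (gauss {1..n}) A = (\<integral>\<^sup>+u. indicator A u \<partial>gauss {1..n})"
    using A by simp
  also have "\<dots> \<le> (\<integral>\<^sup>+u. ennreal (exp (g (Q u))) \<partial>gauss {1..n})"
  proof (rule nn_integral_mono)
    fix u show "indicator A u \<le> ennreal (exp (g (Q u)))"
    proof (cases "u \<in> A")
      case True
      then have "1 \<le> exp (g (Q u))" using le by simp
      then show ?thesis using True ennreal_leI[of 1] by simp
    qed simp
  qed
  also have "\<dots> = (\<integral>\<^sup>+z. ennreal (exp (g z)) \<partial>gauss {1..n})"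
    using g by (intro gauss_rotation[OF Q, of "\<lambda>z. ennreal (exp (g z))"]) measurable
  finally show ?thesis .
qed

text \<open>With one rotation for both spans the drop is a sum of r' - r \<le> card T squares of
  independent standard normals. The exponent 1/4 costs a factor 1 / sqrt (1 - 1/2) = sqrt 2 per
  square.\<close>

lemma gauss_rss_drop_tail:
  assumes fin: "finite \<tau>" "finite T"
  shows "emeasure (gauss {1..n}) {u \<in> space (gauss {1..n}). x \<le> rss n X u \<tau> - rss n X u (\<tau> \<union> T)}
    \<le> ennreal (sqrt 2 ^ card T * exp (- x / 4))" (is "emeasure _ ?A \<le> _")
proof -
  obtain Q r where ad: "adapted n X \<tau> Q r" by (rule adapted_exists[OF fin(1)])
  obtain Q' r' where ad': "adapted n X (\<tau> \<union> T) Q' r'" and r': "r \<le> r'" "r' \<le> r + card T"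
    and ag: "\<And>x k. k \<in> {1..r} \<Longrightarrow> Q' x k = Q x k"
    using adapted_union[OF fin(2,1) ad] by blast
  note rot = adaptedD(1)[OF ad']
  have ad0: "adapted n X \<tau> Q' r" by (rule adapted_transfer[OF ad rot ag])
  have r'n: "r' \<le> n" by (rule adaptedD(2)[OF ad'])
  have diff: "rss n X u \<tau> - rss n X u (\<tau> \<union> T) = (\<Sum>k\<in>{r<..r'}. (Q' u k)\<^sup>2)" for u
  proof -
    have "{r<..n} = {r<..r'} \<union> {r'<..n}" "{r<..r'} \<inter> {r'<..n} = {}" using r' r'n by auto
    then show ?thesis by (simp add: adapted_rss(1)[OF ad0] adapted_rss(1)[OF ad'] sum.union_disjoint)
  qed
  define a where "a k = (if k \<in> {r<..r'} then 1 / 4 else 0 :: real)" for k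
  have asum: "(\<Sum>k\<in>{1..n}. a k * (z k)\<^sup>2) = (\<Sum>k\<in>{r<..r'}. (z k)\<^sup>2) / 4" for z :: "nat \<Rightarrow> real"
    using r'n unfolding sum_divide_distrib
    by (intro sum.mono_neutral_cong_right) (auto simp: a_def)
  have [measurable]: "(\<lambda>u. rss n X u \<tau>) \<in> borel_measurable (gauss {1..n})"
    "(\<lambda>u. rss n X u (\<tau> \<union> T)) \<in> borel_measurable (gauss {1..n})"
    using fin by (auto intro!: measurable_rss)
  have A: "?A \<in> sets (gauss {1..n})" by measurable
  have "emeasure (gauss {1..n}) ?A \<le> (\<integral>\<^sup>+z. ennreal (exp ((\<Sum>k\<in>{1..n}. a k * (z k)\<^sup>2) + - x / 4)) \<partial>gauss {1..n})"
  proof (rule emeasure_le_rotated_exp[OF rot])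
    show "?A \<in> sets (\<Pi>\<^sub>M i\<in>{1..n}. borel)" using A by simp
    show "(\<lambda>z. (\<Sum>k\<in>{1..n}. a k * (z k)\<^sup>2) + - x / 4) \<in> borel_measurable (\<Pi>\<^sub>M i\<in>{1..n}. borel)"
      by measurable
  qed (auto simp: asum diff)
  also have "\<dots> = (\<integral>\<^sup>+z. ennreal (exp (\<Sum>k\<in>{1..n}. a k * (z k)\<^sup>2)) * ennreal (exp (- x / 4)) \<partial>gauss {1..n})"
    by (simp only: exp_add) (simp add: ennreal_mult)
  also have "\<dots> = (\<integral>\<^sup>+z. ennreal (exp (\<Sum>k\<in>{1..n}. a k * (z k)\<^sup>2)) \<partial>gauss {1..n}) * ennreal (exp (- x / 4))"
    by (rule nn_integral_multc) measurable
  also have "\<dots> = ennreal (\<Prod>k\<in>{1..n}. 1 / sqrt (1 - 2 * a k)) * ennreal (exp (- x / 4))"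
    by (subst gauss_exp_quadratic) (auto simp: a_def)
  also have "(\<Prod>k\<in>{1..n}. 1 / sqrt (1 - 2 * a k)) = (\<Prod>k\<in>{r<..r'}. sqrt 2)"
    using r'n by (intro prod.mono_neutral_cong_right) (auto simp: a_def real_sqrt_divide)
  also have "ennreal (\<Prod>k\<in>{r<..r'}. sqrt 2) * ennreal (exp (- x / 4)) \<le> ennreal (sqrt 2 ^ card T) * ennreal (exp (- x / 4))"
    using r' by (intro mult_right_mono ennreal_leI) (auto intro!: power_increasing)
  finally show ?thesis by (simp add: ennreal_mult)
qed

text \<open>Expanding the square, the event says that the cross term lies below -N / 2, where N is
  the residual sum of squares of \<open>m\<close>. That term is centred normal with variance 4 *
  \<sigma>^2 * N, and the optimal tilt -Q m / (4 * \<sigma>) gives the exponent (N / 2)^2 / (8 *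
  \<sigma>^2 * N) = N / (32 * \<sigma>^2).\<close>

lemma gauss_rss_shift_tail:
  assumes fin: "finite \<tau>" and s: "0 < \<sigma>"
  shows "emeasure (gauss {1..n}) {u \<in> space (gauss {1..n}).
      rss n X (\<lambda>i. m i + \<sigma> * u i) \<tau> < rss n X m \<tau> / 2 + \<sigma>\<^sup>2 * rss n X u \<tau>}
    \<le> ennreal (exp (- rss n X m \<tau> / (32 * \<sigma>\<^sup>2)))" (is "emeasure _ ?A \<le> _")
proof -
  obtain Q r where ad: "adapted n X \<tau> Q r" by (rule adapted_exists[OF fin(1)])
  note rot = adaptedD(1)[OF ad] and rn = adaptedD(2)[OF ad]
  define N where "N = rss n X m \<tau>"
  have N: "N = (\<Sum>k\<in>{r<..n}. (Q m k)\<^sup>2)" by (simp add: N_def adapted_rss[OF ad])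
  have expand: "rss n X (\<lambda>i. m i + \<sigma> * u i) \<tau> = N + 2 * \<sigma> * (\<Sum>k\<in>{r<..n}. Q m k * Q u k) + \<sigma>\<^sup>2 * rss n X u \<tau>" for u
  proof -
    have "rss n X (\<lambda>i. m i + \<sigma> * u i) \<tau> = (\<Sum>k\<in>{r<..n}. (Q m k)\<^sup>2 + 2 * \<sigma> * (Q m k * Q u k) + \<sigma>\<^sup>2 * (Q u k)\<^sup>2)"
      unfolding adapted_rss(1)[OF ad]
    proof (rule sum.cong)
      fix k assume "k \<in> {r<..n}"
      then have "Q (\<lambda>i. m i + \<sigma> * u i) k = Q m k + \<sigma> * Q u k"
        by (intro rotation_lin[OF rot]) auto
      then show "(Q (\<lambda>i. m i + \<sigma> * u i) k)\<^sup>2 = (Q m k)\<^sup>2 + 2 * \<sigma> * (Q m k * Q u k) + \<sigma>\<^sup>2 * (Q u k)\<^sup>2"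
        by (simp only:) (simp add: power2_eq_square algebra_simps)
    qed simp
    then show ?thesis by (simp add: N adapted_rss(1)[OF ad] sum.distrib sum_distrib_left)
  qed
  define a where "a k = (if k \<in> {r<..n} then - Q m k / (4 * \<sigma>) else 0)" for k
  have asum: "(\<Sum>k\<in>{1..n}. a k * z k) = - (\<Sum>k\<in>{r<..n}. Q m k * z k) / (4 * \<sigma>)" for z
  proof -
    have "(\<Sum>k\<in>{1..n}. a k * z k) = (\<Sum>k\<in>{r<..n}. - (Q m k * z k) / (4 * \<sigma>))"
      using rn by (intro sum.mono_neutral_cong_right) (auto simp: a_def)
    then show ?thesis by (simp add: sum_divide_distrib sum_negf)
  qed
  have a2: "(\<Sum>k\<in>{1..n}. (a k)\<^sup>2) = N / (16 * \<sigma>\<^sup>2)"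
  proof -
    have "(\<Sum>k\<in>{1..n}. (a k)\<^sup>2) = (\<Sum>k\<in>{r<..n}. (Q m k)\<^sup>2 / (16 * \<sigma>\<^sup>2))"
      using rn by (intro sum.mono_neutral_cong_right) (auto simp: a_def power_divide power_mult_distrib)
    then show ?thesis by (simp add: N sum_divide_distrib)
  qed
  have [measurable]: "(\<lambda>u. rss n X u \<tau>) \<in> borel_measurable (\<Pi>\<^sub>M i\<in>{1..n}. borel)"
    using fin by (auto intro!: measurable_rss)
  have Qm: "(\<lambda>u. Q u k) \<in> borel_measurable (\<Pi>\<^sub>M i\<in>{1..n}. borel)" if "k \<in> {r<..n}" for k
    using that rot by (intro measurable_rotation_component) auto
  have A: "?A \<in> sets (gauss {1..n})" unfolding expand
    using Qm by measurable
  have le: "0 \<le> (\<Sum>k\<in>{1..n}. a k * Q u k) + - N / (16 * \<sigma>\<^sup>2)" if "u \<in> ?A" for u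
  proof -
    have "2 * \<sigma> * (\<Sum>k\<in>{r<..n}. Q m k * Q u k) < - N / 2"
      using that unfolding expand by (simp add: N_def[symmetric])
    then have "N / (16 * \<sigma>\<^sup>2) \<le> - (\<Sum>k\<in>{r<..n}. Q m k * Q u k) / (4 * \<sigma>)"
      using s by (simp add: field_simps power2_eq_square)
    then show ?thesis by (simp add: asum)
  qed
  have "emeasure (gauss {1..n}) ?A \<le> (\<integral>\<^sup>+z. ennreal (exp ((\<Sum>k\<in>{1..n}. a k * z k) + - N / (16 * \<sigma>\<^sup>2))) \<partial>gauss {1..n})"
  proof (rule emeasure_le_rotated_exp[OF rot])
    show "?A \<in> sets (\<Pi>\<^sub>M i\<in>{1..n}. borel)" using A by simp
    show "(\<lambda>z. (\<Sum>k\<in>{1..n}. a k * z k) + - N / (16 * \<sigma>\<^sup>2)) \<in> borel_measurable (\<Pi>\<^sub>M i\<in>{1..n}. borel)"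
      by measurable
  qed (rule le)
  also have "\<dots> = (\<integral>\<^sup>+z. ennreal (exp (\<Sum>k\<in>{1..n}. a k * z k)) * ennreal (exp (- N / (16 * \<sigma>\<^sup>2))) \<partial>gauss {1..n})"
    by (simp only: exp_add) (simp add: ennreal_mult)
  also have "\<dots> = (\<integral>\<^sup>+z. ennreal (exp (\<Sum>k\<in>{1..n}. a k * z k)) \<partial>gauss {1..n}) * ennreal (exp (- N / (16 * \<sigma>\<^sup>2)))"
    by (rule nn_integral_multc) measurable
  also have "\<dots> = ennreal (exp (N / (16 * \<sigma>\<^sup>2) / 2)) * ennreal (exp (- N / (16 * \<sigma>\<^sup>2)))"
    by (subst gauss_exp_linear) (auto simp: a2)
  also have "\<dots> = ennreal (exp (N / (16 * \<sigma>\<^sup>2) / 2 + - N / (16 * \<sigma>\<^sup>2)))"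
    by (simp only: exp_add) (simp add: ennreal_mult)
  also have "N / (16 * \<sigma>\<^sup>2) / 2 + - N / (16 * \<sigma>\<^sup>2) = - N / (32 * \<sigma>\<^sup>2)"
    using s by (simp add: field_simps)
  finally show ?thesis by (simp add: N_def)
qed

text \<open>After rotation the residual of \<open>m\<close> is a single coordinate c. Removing the
  direction of \<open>u\<close> leaves c^2 * E / (b + E), where b is the square of that coordinate
  of \<open>u\<close> and E the sum of its other residual squares. Losing more than two thirds
  forces 2 * E \<le> b; the exponent b / 4 - E / 2 costs sqrt 2 for b and gains 1 / sqrt 2 for every
  square in E.\<close>

lemma gauss_rss1_shrink_tail:
  assumes fin: "finite \<tau>" "0 \<notin> \<tau>"
  shows "emeasure (gauss {1..n}) {u \<in> space (gauss {1..n}). rss1 n X u m \<tau> < rss n X m \<tau> / 3}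
    \<le> ennreal (sqrt 2 * (1 / sqrt 2) ^ (n - card \<tau> - 1))" (is "emeasure _ ?A \<le> _")
proof -
  obtain Q0 r where ad0: "adapted n X \<tau> Q0 r" and r: "r \<le> card \<tau>" by (rule adapted_exists[OF fin(1)])
  \<comment> \<open>Here column 0 carries the deterministic vector \<open>m\<close>, not a noise
    vector: adapting to it concentrates the residual of \<open>m\<close> in at most one
    coordinate.\<close>
  then have ad0': "adapted n (aug X m) \<tau> Q0 r" by (simp add: adapted_aug fin)
  obtain Q r' where ad': "adapted n (aug X m) (insert 0 \<tau>) Q r'" and r': "r \<le> r'" "r' \<le> Suc r"
    and ag: "\<And>x k. k \<in> {1..r} \<Longrightarrow> Q x k = Q0 x k"
    using adapted_insert[OF ad0' fin(2,1)] by blast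
  note rot = adaptedD(1)[OF ad']
  have ad: "adapted n X \<tau> Q r" by (rule adapted_transfer[OF ad0 rot ag])
  have Qm: "Q m k = 0" if "k \<in> {r'<..n}" for k
  proof -
    have "Xmul (aug X m) (insert 0 \<tau>) (\<lambda>j. of_bool (j = 0)) = m"
      using fin by (auto simp: Xmul_aug_insert Xmul_def aug_def intro!: ext sum.neutral)
    then show ?thesis using adaptedD(3)[OF ad' that] by metis
  qed
  have rss1: "rss1 n X u m \<tau> = (\<Sum>k\<in>{r<..n}. (Q m k)\<^sup>2)
     - (\<Sum>k\<in>{r<..n}. Q m k * Q u k)\<^sup>2 / (\<Sum>k\<in>{r<..n}. (Q u k)\<^sup>2)" for u
    by (rule rss1_closed_form[OF ad fin(2,1)])
  show ?thesis
  proof (cases "r' = r")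
    \<comment> \<open>If \<open>m\<close> already lies in the span, both residual sums vanish and
      the strict inequality cannot hold.\<close>
    case True
    then have "?A = {}" using Qm by (simp add: rss1 adapted_rss(1)[OF ad])
    then show ?thesis by (simp only: emeasure_empty) simp
  next
    case False
    then have r'_eq: "r' = Suc r" using r' by simp
    then have rn: "Suc r \<le> n" using adaptedD(2)[OF ad'] by simp
    have split: "{r<..n} = insert (Suc r) {Suc r<..n}" using rn by auto
    define c where "c = Q m (Suc r)"
    have Am: "(\<Sum>k\<in>{r<..n}. (Q m k)\<^sup>2) = c\<^sup>2" "(\<Sum>k\<in>{r<..n}. Q m k * Q u k) = c * Q u (Suc r)" for u
      unfolding split using Qm by (auto simp: c_def r'_eq)
    define a where "a k = (if k = Suc r then 1 / 4 else if Suc r < k then - 1 / 2 else 0 :: real)" for k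
    have asum: "(\<Sum>k\<in>{1..n}. a k * (z k)\<^sup>2) = (z (Suc r))\<^sup>2 / 4 - (\<Sum>k\<in>{Suc r<..n}. (z k)\<^sup>2) / 2" for z :: "nat \<Rightarrow> real"
    proof -
      have "(\<Sum>k\<in>{1..n}. a k * (z k)\<^sup>2) = (\<Sum>k\<in>{r<..n}. a k * (z k)\<^sup>2)"
        by (intro sum.mono_neutral_right) (auto simp: a_def)
      also have "\<dots> = (z (Suc r))\<^sup>2 / 4 + (\<Sum>k\<in>{Suc r<..n}. - ((z k)\<^sup>2 / 2))"
        unfolding split by (simp add: a_def)
      finally show ?thesis by (simp add: sum_negf sum_divide_distrib)
    qed
    have "(\<lambda>u. rss1 n X u m \<tau>) \<in> borel_measurable (gauss {1..n})"
    proof -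
      have "(\<lambda>u. Q u k) \<in> borel_measurable (\<Pi>\<^sub>M i\<in>{1..n}. borel)" if "k \<in> {r<..n}" for k
        using that rot by (intro measurable_rotation_component) auto
      then show ?thesis unfolding rss1 by measurable
    qed
    then have A: "?A \<in> sets (gauss {1..n})" by measurable
    have le: "0 \<le> (\<Sum>k\<in>{1..n}. a k * (Q u k)\<^sup>2)" if "u \<in> ?A" for u
    proof -
      define b where "b = (Q u (Suc r))\<^sup>2"
      define E where "E = (\<Sum>k\<in>{Suc r<..n}. (Q u k)\<^sup>2)"
      have E: "E \<ge> 0" "b \<ge> 0" by (auto simp: E_def b_def sum_nonneg)
      have D: "(\<Sum>k\<in>{r<..n}. (Q u k)\<^sup>2) = b + E" unfolding split by (simp add: b_def E_def)
      have "rss1 n X u m \<tau> < rss n X m \<tau> / 3" using that by simp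
      then have "c\<^sup>2 - c\<^sup>2 * b / (b + E) < c\<^sup>2 / 3"
        unfolding rss1 adapted_rss(1)[OF ad] Am D by (simp add: power_mult_distrib b_def)
      then have "c \<noteq> 0 \<and> 1 - b / (b + E) < 1 / 3"
      proof -
        assume *: "c\<^sup>2 - c\<^sup>2 * b / (b + E) < c\<^sup>2 / 3"
        then have c: "c \<noteq> 0" by auto
        have "c\<^sup>2 * (1 - b / (b + E)) < c\<^sup>2 * (1 / 3)" using * by (simp add: algebra_simps)
        then show ?thesis using c by (subst (asm) mult_less_cancel_left_pos) auto
      qed
      moreover have "b + E > 0" using E calculation by (cases "b + E = 0") auto
      ultimately have "2 * E \<le> b" by (simp add: field_simps)
      then show ?thesis unfolding asum b_def E_def by simp
    qed
    have "emeasure (gauss {1..n}) ?A \<le> (\<integral>\<^sup>+z. ennreal (exp (\<Sum>k\<in>{1..n}. a k * (z k)\<^sup>2)) \<partial>gauss {1..n})"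
      using A le by (intro emeasure_le_rotated_exp[OF rot]) auto
    also have "\<dots> = ennreal (\<Prod>k\<in>{1..n}. 1 / sqrt (1 - 2 * a k))"
      by (rule gauss_exp_quadratic) (auto simp: a_def)
    also have "(\<Prod>k\<in>{1..n}. 1 / sqrt (1 - 2 * a k)) = (\<Prod>k\<in>{r<..n}. 1 / sqrt (1 - 2 * a k))"
      by (intro prod.mono_neutral_right) (auto simp: a_def)
    also have "\<dots> = sqrt 2 * (1 / sqrt 2) ^ (n - Suc r)"
      unfolding split by (simp add: a_def real_sqrt_divide)
    also have "\<dots> \<le> sqrt 2 * (1 / sqrt 2) ^ (n - card \<tau> - 1)"
      using r by (intro mult_left_mono power_decreasing) auto
    finally show ?thesis by (simp add: ennreal_leI)
  qed
qed

section \<open>Independence of radius and direction\<close>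

text \<open>The zero vector gets direction 0 by the convention for division, so radius times
  direction recovers \<open>x\<close> on finite \<open>J\<close> without exception.\<close>

definition dirn :: "nat set \<Rightarrow> (nat \<Rightarrow> real) \<Rightarrow> nat \<Rightarrow> real" where
  "dirn J x = (\<lambda>i\<in>J. x i / L2_set x J)"

lemma measurable_L2_set [measurable]:
  "(\<lambda>x. L2_set x J) \<in> borel_measurable (\<Pi>\<^sub>M i\<in>J. borel)"
  unfolding L2_set_def by measurable

lemma measurable_dirn [measurable]: "dirn J \<in> measurable (\<Pi>\<^sub>M i\<in>J. borel) (\<Pi>\<^sub>M i\<in>J. borel)"
  unfolding dirn_def[abs_def] by measurable

lemma L2_set_scale: "0 < \<rho> \<Longrightarrow> L2_set (\<lambda>i\<in>J. \<rho> * x i) J = \<rho> * L2_set x J"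
  by (simp add: L2_set_def power_mult_distrib sum_distrib_left[symmetric] real_sqrt_mult)

lemma dirn_scale:
  assumes "0 < \<rho>" shows "dirn J (\<lambda>i\<in>J. \<rho> * x i) = dirn J x"
  unfolding dirn_def L2_set_scale[OF assms] using assms by (intro restrict_ext) simp

text \<open>Scaling shows that the radial distribution function of Lebesgue measure on a cone is a
  multiple of \<open>\<rho> ^ card J\<close>, so that the radial laws on any two cones are proportional.\<close>

lemma leb_radial_proportional:
  assumes J: "finite J" and D: "A \<in> sets (\<Pi>\<^sub>M i\<in>J. borel)"
    and f[measurable]: "f \<in> borel_measurable borel"
  defines "K \<equiv> \<lambda>B. \<integral>\<^sup>+x. indicator B (dirn J x) * indicator {..<1} (L2_set x J) \<partial>leb J"
  shows "K UNIV * (\<integral>\<^sup>+x. indicator A (dirn J x) * f (L2_set x J) \<partial>leb J)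
       = K A * (\<integral>\<^sup>+x. f (L2_set x J) \<partial>leb J)"
    and "K UNIV \<noteq> \<infinity>" and "K UNIV \<noteq> 0"
proof -
  have [measurable]: "(\<lambda>x. L2_set x J) \<in> borel_measurable (leb J)"
    unfolding L2_set_def by measurable
  have dm: "dirn J \<in> measurable (leb J) (\<Pi>\<^sub>M i\<in>J. borel)"
    using measurable_dirn[of J] by (simp cong: measurable_cong_sets sets_PiM_cong)
  have Am[measurable]: "(\<lambda>x. indicator A (dirn J x) :: ennreal) \<in> borel_measurable (leb J)"
    by (rule measurable_compose[OF dm]) (use D in measurable)
  have scale: "(\<integral>\<^sup>+x. indicator B (dirn J x) * indicator {..<\<rho>} (L2_set x J) \<partial>leb J) = ennreal (\<rho> ^ card J) * K B"
    if \<rho>: "0 < \<rho>" and B: "(\<lambda>x. indicator B (dirn J x) :: ennreal) \<in> borel_measurable (leb J)" for \<rho> B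
  proof -
    let ?g = "\<lambda>x. indicator B (dirn J x) * indicator {..<\<rho>} (L2_set x J) :: ennreal"
    have "?g \<in> borel_measurable (leb J)" using B by measurable
    then have "?g \<in> borel_measurable (\<Pi>\<^sub>M i\<in>J. borel)" by (simp cong: measurable_cong_sets sets_PiM_cong)
    from leb_affine[OF J _ this, of "\<lambda>_. \<rho>" "\<lambda>_. 0"]
    have "(\<integral>\<^sup>+x. ?g x \<partial>leb J) = (\<Prod>i\<in>J. ennreal \<rho>) *
        (\<integral>\<^sup>+x. indicator B (dirn J (\<lambda>i\<in>J. \<rho> * x i)) * indicator {..<\<rho>} (L2_set (\<lambda>i\<in>J. \<rho> * x i) J) \<partial>leb J)"
      using \<rho> by simp
    also have "(\<integral>\<^sup>+x. indicator B (dirn J (\<lambda>i\<in>J. \<rho> * x i)) * indicator {..<\<rho>} (L2_set (\<lambda>i\<in>J. \<rho> * x i) J) \<partial>leb J) = K B"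
      unfolding K_def using \<rho> by (intro nn_integral_cong) (simp add: dirn_scale L2_set_scale indicator_def)
    also have "(\<Prod>i\<in>J. ennreal \<rho>) = ennreal (\<rho> ^ card J)" using \<rho> by (simp add: ennreal_power)
    finally show ?thesis .
  qed
  have KA: "K A \<le> K UNIV" unfolding K_def by (intro nn_integral_mono) (auto simp: indicator_def)
  \<comment> \<open>The unit ball lies in the cube with sides [-1, 1], which has finite
    measure.\<close>
  show fin: "K UNIV \<noteq> \<infinity>"
  proof -
    have "K UNIV \<le> (\<integral>\<^sup>+x. indicator (Pi\<^sub>E J (\<lambda>_. {-1..1})) x \<partial>leb J)"
      unfolding K_def
    proof (rule nn_integral_mono)
      fix x assume x: "x \<in> space (leb J)"
      have "x \<in> Pi\<^sub>E J (\<lambda>_. {-1..1})" if "L2_set x J < 1"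
      proof -
        have "\<bar>x i\<bar> \<le> 1" if "i \<in> J" for i
        proof -
          have "\<bar>x i\<bar> \<le> L2_set (\<lambda>i. \<bar>x i\<bar>) J" using J that by (rule member_le_L2_set)
          also have "\<dots> = L2_set x J" by (simp add: L2_set_def)
          finally show ?thesis using \<open>L2_set x J < 1\<close> by simp
        qed
        then show ?thesis using x by (force simp: space_PiM PiE_iff abs_le_iff)
      qed
      then show "indicator UNIV (dirn J x) * indicator {..<1} (L2_set x J) \<le> (indicator (Pi\<^sub>E J (\<lambda>_. {-1..1})) x :: ennreal)"
        by (auto simp: indicator_def)
    qed
    also have "\<dots> = emeasure (leb J) (Pi\<^sub>E J (\<lambda>_. {-1..1}))"
      using J by (intro nn_integral_indicator sets_PiM_I_finite) auto
    also have "\<dots> = (\<Prod>i\<in>J. emeasure lborel {-1..1::real})"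
      by (rule leb.emeasure_PiM[OF J]) auto
    also have "\<dots> < \<infinity>"
      by (simp add: power_less_top_ennreal)
    finally show ?thesis by simp
  qed
  \<comment> \<open>If the unit ball were null, scaling would make every ball null, and with them
    the whole space, contradicting the total Gaussian mass 1.\<close>
  show "K UNIV \<noteq> 0"
  proof
    assume K0: "K UNIV = 0"
    have "AE x in leb J. \<forall>k::nat. \<not> L2_set x J < real (Suc k)"
      unfolding AE_all_countable
    proof
      fix k
      have "(\<integral>\<^sup>+x. indicator UNIV (dirn J x) * indicator {..<real (Suc k)} (L2_set x J) \<partial>leb J) = 0"
        by (subst scale) (auto simp: K0)
      then show "AE x in leb J. \<not> L2_set x J < real (Suc k)"
        by (subst (asm) nn_integral_0_iff_AE) (auto simp: indicator_def)
    qed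
    then have "AE x in leb J. False"
    proof eventually_elim
      case (elim x)
      obtain k where "L2_set x J < real k" using reals_Archimedean2 by blast
      then show ?case using elim[rule_format, of k] by simp
    qed
    then have "(\<integral>\<^sup>+x. gdens J (\<Sum>i\<in>J. (x i)\<^sup>2) * 1 \<partial>leb J) = (\<integral>\<^sup>+x. 0 \<partial>leb J)"
      by (intro nn_integral_cong_AE) auto
    then have "(\<integral>\<^sup>+x. 1 \<partial>gauss J) = 0" by (subst nn_integral_gauss[OF J]) auto
    then show False using prob_space.emeasure_space_1[OF prob_space_gauss[of J]] by simp
  qed
  \<comment> \<open>Radial laws on the cone and on the whole space, each weighted with the unit ball
    mass of the other so that no division in \<open>ennreal\<close> is needed. They agree on all
    half-lines, an intersection-stable generator.\<close>
  define M1 where "M1 = distr (density (leb J) (\<lambda>x. K UNIV * indicator A (dirn J x))) borel (\<lambda>x. L2_set x J)"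
  define M2 where "M2 = distr (density (leb J) (\<lambda>x. K A)) borel (\<lambda>x. L2_set x J)"
  have M1: "(\<integral>\<^sup>+t. g t \<partial>M1) = K UNIV * (\<integral>\<^sup>+x. indicator A (dirn J x) * g (L2_set x J) \<partial>leb J)"
    if [measurable]: "g \<in> borel_measurable borel" for g
    unfolding M1_def by (subst nn_integral_distr) (auto simp: nn_integral_density mult.assoc nn_integral_cmult)
  have M2: "(\<integral>\<^sup>+t. g t \<partial>M2) = K A * (\<integral>\<^sup>+x. g (L2_set x J) \<partial>leb J)"
    if [measurable]: "g \<in> borel_measurable borel" for g
    unfolding M2_def by (subst nn_integral_distr) (auto simp: nn_integral_density nn_integral_cmult)
  have e1: "emeasure M1 {..<\<rho>} = (if 0 < \<rho> then K UNIV * (ennreal (\<rho> ^ card J) * K A) else 0)" for \<rho>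
  proof -
    have "emeasure M1 {..<\<rho>} = (\<integral>\<^sup>+t. indicator {..<\<rho>} t \<partial>M1)"
      by (subst nn_integral_indicator) (auto simp: M1_def)
    also have "\<dots> = K UNIV * (\<integral>\<^sup>+x. indicator A (dirn J x) * indicator {..<\<rho>} (L2_set x J) \<partial>leb J)"
      by (rule M1) auto
    also have "\<dots> = (if 0 < \<rho> then K UNIV * (ennreal (\<rho> ^ card J) * K A) else 0)"
    proof (cases "0 < \<rho>")
      case False
      then have "indicator {..<\<rho>} (L2_set x J) = (0::ennreal)" for x
        using L2_set_nonneg[of x J] by (auto simp: indicator_def simp del: L2_set_nonneg)
      then show ?thesis using False by simp
    qed (simp add: scale)
    finally show ?thesis .
  qed
  have e2: "emeasure M2 {..<\<rho>} = (if 0 < \<rho> then K UNIV * (ennreal (\<rho> ^ card J) * K A) else 0)" for \<rho>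
  proof -
    have "emeasure M2 {..<\<rho>} = (\<integral>\<^sup>+t. indicator {..<\<rho>} t \<partial>M2)"
      by (subst nn_integral_indicator) (auto simp: M2_def)
    also have "\<dots> = K A * (\<integral>\<^sup>+x. indicator UNIV (dirn J x) * indicator {..<\<rho>} (L2_set x J) \<partial>leb J)"
      by (subst M2) auto
    also have "\<dots> = (if 0 < \<rho> then K UNIV * (ennreal (\<rho> ^ card J) * K A) else 0)"
    proof (cases "0 < \<rho>")
      case False
      then have "indicator {..<\<rho>} (L2_set x J) = (0::ennreal)" for x
        using L2_set_nonneg[of x J] by (auto simp: indicator_def simp del: L2_set_nonneg)
      then show ?thesis using False by simp
    next
      case True
      then show ?thesis using scale[OF True, of UNIV] by (simp add: mult.commute mult.left_commute)
    qed
    finally show ?thesis .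
  qed
  have "M1 = M2"
  proof (rule measure_eqI_generator_eq[where E = "range lessThan" and \<Omega> = UNIV and A = "\<lambda>k. {..<real k}"])
    show "Int_stable (range lessThan :: real set set)"
    proof (rule Int_stableI)
      fix a b :: "real set" assume "a \<in> range lessThan" "b \<in> range lessThan"
      then obtain s t where "a = {..<s}" "b = {..<t}" by auto
      then have "a \<inter> b = {..<min s t}" by auto
      then show "a \<inter> b \<in> range lessThan" by simp
    qed
    show "sets M1 = sigma_sets UNIV (range lessThan)" "sets M2 = sigma_sets UNIV (range lessThan)"
      unfolding M1_def M2_def by (simp_all add: borel_Iio)
    show "(\<Union>i. {..<real i}) = UNIV" using reals_Archimedean2 by auto
    show "emeasure M1 X = emeasure M2 X" if "X \<in> range lessThan" for X
      using that e1 e2 by auto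
    show "emeasure M1 {..<real i} \<noteq> \<infinity>" for i
      using fin KA by (auto simp: e1 ennreal_mult_eq_top_iff top_unique)
  qed auto
  then show "K UNIV * (\<integral>\<^sup>+x. indicator A (dirn J x) * f (L2_set x J) \<partial>leb J)
       = K A * (\<integral>\<^sup>+x. f (L2_set x J) \<partial>leb J)"
    using M1[OF f] M2[OF f] by simp
qed

text \<open>The Gaussian density depends on the radius only, so it can be absorbed into the radial
  function of \<open>leb_radial_proportional\<close>. The case of an unrestricted radius identifies
  the constant, and the finite nonzero factor \<open>K UNIV\<close> cancels.\<close>

lemma gauss_radius_direction_indep:
  assumes J: "finite J" and A[measurable]: "A \<in> sets (\<Pi>\<^sub>M i\<in>J. borel)" and E[measurable]: "E \<in> sets borel"
  shows "(\<integral>\<^sup>+x. indicator E (L2_set x J) * indicator A (dirn J x) \<partial>gauss J)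
     = (\<integral>\<^sup>+x. indicator E (L2_set x J) \<partial>gauss J) * (\<integral>\<^sup>+x. indicator A (dirn J x) \<partial>gauss J)"
proof -
  define K where "K B = (\<integral>\<^sup>+x. indicator B (dirn J x) * indicator {..<1} (L2_set x J) \<partial>leb J)" for B
  note rad = leb_radial_proportional[OF J A, folded K_def]
  have sq: "gdens J (\<Sum>i\<in>J. (x i)\<^sup>2) = gdens J ((L2_set x J)\<^sup>2)" for x
    by (simp add: L2_set_def sum_nonneg)
  have 1: "K UNIV * (\<integral>\<^sup>+x. indicator F (L2_set x J) * indicator A (dirn J x) \<partial>gauss J)
     = K A * (\<integral>\<^sup>+x. indicator F (L2_set x J) \<partial>gauss J)" if [measurable]: "F \<in> sets borel" for F
  proof -
    have "(\<integral>\<^sup>+x. indicator F (L2_set x J) * indicator A (dirn J x) \<partial>gauss J)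
      = (\<integral>\<^sup>+x. indicator A (dirn J x) * (gdens J ((L2_set x J)\<^sup>2) * indicator F (L2_set x J)) \<partial>leb J)"
      by (subst nn_integral_gauss[OF J]) (auto simp: sq mult_ac)
    moreover have "(\<integral>\<^sup>+x. indicator F (L2_set x J) \<partial>gauss J)
      = (\<integral>\<^sup>+x. gdens J ((L2_set x J)\<^sup>2) * indicator F (L2_set x J) \<partial>leb J)"
      by (subst nn_integral_gauss[OF J]) (auto simp: sq)
    ultimately show ?thesis
      using rad(1)[of "\<lambda>t. gdens J (t\<^sup>2) * indicator F t"] by simp
  qed
  have tot: "(\<integral>\<^sup>+x. 1 \<partial>gauss J) = 1"
    using prob_space.emeasure_space_1[OF prob_space_gauss[of J]] by simp
  have 2: "K UNIV * (\<integral>\<^sup>+x. indicator A (dirn J x) \<partial>gauss J) = K A"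
    using 1[of UNIV] tot by simp
  have "K UNIV * (\<integral>\<^sup>+x. indicator E (L2_set x J) * indicator A (dirn J x) \<partial>gauss J)
     = K UNIV * ((\<integral>\<^sup>+x. indicator E (L2_set x J) \<partial>gauss J) * (\<integral>\<^sup>+x. indicator A (dirn J x) \<partial>gauss J))"
    unfolding 1[OF E] 2[symmetric] by (simp add: mult_ac)
  then show ?thesis using rad(2,3)[of "\<lambda>_. 0"] by (simp add: ennreal_mult_cancel_left)
qed

text \<open>Independence on rectangles makes the joint law of radius and direction a product
  measure; Fubini then replaces the direction by that of a fresh copy.\<close>

lemma gauss_polar:
  assumes J: "finite J" and g[measurable]: "g \<in> borel_measurable (borel \<Otimes>\<^sub>M (\<Pi>\<^sub>M i\<in>J. borel))"
  shows "(\<integral>\<^sup>+x. g (L2_set x J, dirn J x) \<partial>gauss J) = (\<integral>\<^sup>+x. (\<integral>\<^sup>+y. g (L2_set x J, dirn J y) \<partial>gauss J) \<partial>gauss J)"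
proof -
  interpret prob_space "gauss J" by (rule prob_space_gauss)
  define R where "R = distr (gauss J) borel (\<lambda>x. L2_set x J)"
  define S where "S = distr (gauss J) (\<Pi>\<^sub>M i\<in>J. borel) (dirn J)"
  interpret R: prob_space R unfolding R_def by (rule prob_space_distr) measurable
  interpret S: prob_space S unfolding S_def by (rule prob_space_distr) measurable
  have eq: "R \<Otimes>\<^sub>M S = distr (gauss J) (borel \<Otimes>\<^sub>M (\<Pi>\<^sub>M i\<in>J. borel)) (\<lambda>x. (L2_set x J, dirn J x))"
  proof (rule pair_measure_eqI)
    show "sigma_finite_measure R" "sigma_finite_measure S" by unfold_locales
    show "sets (R \<Otimes>\<^sub>M S) = sets (distr (gauss J) (borel \<Otimes>\<^sub>M (\<Pi>\<^sub>M i\<in>J. borel)) (\<lambda>x. (L2_set x J, dirn J x)))"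
      by (simp add: R_def S_def cong: sets_pair_measure_cong)
    fix E A assume "E \<in> sets R" "A \<in> sets S"
    then have [measurable]: "E \<in> sets borel" "A \<in> sets (\<Pi>\<^sub>M i\<in>J. borel)" by (auto simp: R_def S_def)
    have "emeasure R E = (\<integral>\<^sup>+x. indicator E x \<partial>R)" by (subst nn_integral_indicator) (auto simp: R_def)
    also have "\<dots> = (\<integral>\<^sup>+x. indicator E (L2_set x J) \<partial>gauss J)"
      unfolding R_def by (rule nn_integral_distr) measurable
    finally have R: "emeasure R E = \<dots>" .
    have "emeasure S A = (\<integral>\<^sup>+x. indicator A x \<partial>S)" by (subst nn_integral_indicator) (auto simp: S_def)
    also have "\<dots> = (\<integral>\<^sup>+x. indicator A (dirn J x) \<partial>gauss J)"
      unfolding S_def by (rule nn_integral_distr) measurable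
    finally have S: "emeasure S A = \<dots>" .
    let ?D = "distr (gauss J) (borel \<Otimes>\<^sub>M (\<Pi>\<^sub>M i\<in>J. borel)) (\<lambda>x. (L2_set x J, dirn J x))"
    have "emeasure ?D (E \<times> A) = (\<integral>\<^sup>+x. indicator (E \<times> A) x \<partial>?D)" by (subst nn_integral_indicator) auto
    also have "\<dots> = (\<integral>\<^sup>+x. indicator (E \<times> A) (L2_set x J, dirn J x) \<partial>gauss J)"
      by (rule nn_integral_distr) measurable
    also have "\<dots> = (\<integral>\<^sup>+x. indicator E (L2_set x J) * indicator A (dirn J x) \<partial>gauss J)"
      by (simp add: indicator_times)
    finally show "emeasure R E * emeasure S A = emeasure ?D (E \<times> A)"
      unfolding R S by (simp add: gauss_radius_direction_indep[OF J])
  qed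
  have gRS: "g \<in> borel_measurable (R \<Otimes>\<^sub>M S)"
    using g by (simp add: R_def S_def cong: measurable_cong_sets sets_pair_measure_cong)
  have "(\<integral>\<^sup>+x. g (L2_set x J, dirn J x) \<partial>gauss J) = (\<integral>\<^sup>+p. g p \<partial>(R \<Otimes>\<^sub>M S))"
    unfolding eq by (subst nn_integral_distr) auto
  also have "\<dots> = (\<integral>\<^sup>+t. (\<integral>\<^sup>+s. g (t, s) \<partial>S) \<partial>R)"
    by (rule S.nn_integral_fst[OF gRS, symmetric])
  also have "\<dots> = (\<integral>\<^sup>+t. (\<integral>\<^sup>+y. g (t, dirn J y) \<partial>gauss J) \<partial>R)"
    unfolding S_def by (intro nn_integral_cong nn_integral_distr) measurable
  also have "\<dots> = (\<integral>\<^sup>+x. (\<integral>\<^sup>+y. g (L2_set x J, dirn J y) \<partial>gauss J) \<partial>gauss J)"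
    unfolding R_def by (rule nn_integral_distr) measurable
  finally show ?thesis .
qed

section \<open>Coverage of the rank set\<close>

lemma argmin_exists:
  fixes f :: "'a \<Rightarrow> 'b :: linorder"
  assumes "finite {x. P x}" "P a"
  shows "{x. is_arg_min f P x} \<noteq> {}"
  using ex_is_arg_min_if_finite[of "{x. P x}" f] assms by auto

lemma tie_break_argmin:
  fixes f :: "nat set \<Rightarrow> 'b :: linorder"
  assumes "tie_break tb" "finite {x. P x}" "P a"
  shows "is_arg_min f P (tb {x. is_arg_min f P x})"
proof -
  have "finite {x. is_arg_min f P x}"
    by (rule finite_subset[OF _ assms(2)]) (auto simp: is_arg_min_def)
  moreover have "{x. is_arg_min f P x} \<noteq> {}" by (rule argmin_exists[OF assms(2,3)])
  ultimately have "tb {x. is_arg_min f P x} \<in> {x. is_arg_min f P x}"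
    using assms(1) unfolding tie_break_def by blast
  then show ?thesis by simp
qed

text \<open>The set of minimisers takes finitely many values, each cut out by comparisons of
  measurable functions. Any selection rule may be applied afterwards, because every function on a
  discrete space is measurable.\<close>

lemma measurable_argmin:
  fixes F :: "'w \<Rightarrow> 'a \<Rightarrow> real"
  assumes fin: "finite {x. P x}" and F: "\<And>x. P x \<Longrightarrow> (\<lambda>w. F w x) \<in> borel_measurable N"
  shows "(\<lambda>w. tb {x. is_arg_min (F w) P x}) \<in> measurable N (count_space UNIV)"
proof -
  let ?C = "{x. P x}"
  define S where "S w = {x. is_arg_min (F w) P x}" for w
  have S: "S w \<in> Pow ?C" for w by (auto simp: S_def is_arg_min_def)
  have eq: "S -` {a} \<inter> space N = {w \<in> space N. \<forall>x\<in>?C. x \<in> a \<longleftrightarrow> (\<forall>y\<in>?C. \<not> F w y < F w x)}" if "a \<in> Pow ?C" for a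
  proof -
    have "S w = a \<longleftrightarrow> (\<forall>x\<in>?C. x \<in> a \<longleftrightarrow> (\<forall>y\<in>?C. \<not> F w y < F w x))" for w
      using that by (auto simp: S_def is_arg_min_def)
    then show ?thesis by auto
  qed
  have "S \<in> measurable N (count_space (Pow ?C))"
    unfolding measurable_count_space_eq2[OF finite_Pow_iff[THEN iffD2, OF fin]]
  proof (intro conjI ballI)
    fix a assume a: "a \<in> Pow ?C"
    have le: "{w \<in> space N. \<forall>y\<in>?C. \<not> F w y < F w x} \<in> sets N" if "P x" for x
      using F that by (intro sets.sets_Collect_finite_All fin sets.sets_Collect_neg borel_measurable_less) auto
    have "{w \<in> space N. x \<in> a \<longleftrightarrow> (\<forall>y\<in>?C. \<not> F w y < F w x)} \<in> sets N" if "P x" for x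
      using le[OF that] sets.sets_Collect_neg[OF le[OF that]] by (cases "x \<in> a") auto
    then show "S -` {a} \<inter> space N \<in> sets N"
      unfolding eq[OF a] using fin by (intro sets.sets_Collect_finite_All) auto
  qed (use S in auto)
  then have "(\<lambda>w. tb (S w)) \<in> measurable N (count_space UNIV)"
    by (rule measurable_compose) simp
  then show ?thesis by (simp add: S_def)
qed

lemma T_tilde_cong:
  assumes "\<And>i. i \<in> {1..n} \<Longrightarrow> y i = y' i"
  shows "T_tilde n p X tb y \<tau> = T_tilde n p X tb y' \<tau>"
proof -
  have "rss n X y = rss n X y'" by (intro ext rss_cong assms)
  then show ?thesis by (simp add: T_tilde_def)
qed

lemma finite_models: "finite {\<tau>' :: nat set. \<tau>' \<subseteq> {1..p} \<and> R \<tau>'}"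
  by (rule finite_subset[of _ "Pow {1..p}"]) auto

lemma T_tilde_subset: "tie_break tb \<Longrightarrow> T_tilde n p X tb y \<tau> \<subseteq> {1..p}"
  using tie_break_argmin[of tb "\<lambda>\<tau>'. \<tau>' \<subseteq> {1..p} \<and> card \<tau>' \<le> card \<tau>" "{}" "rss n X y"]
  by (simp add: T_tilde_def is_arg_min_def finite_models)

lemma measurable_T_tilde:
  assumes f: "\<And>i. i \<in> {1..n} \<Longrightarrow> (\<lambda>w. f w i) \<in> borel_measurable N"
  shows "(\<lambda>w. T_tilde n p X tb (f w) \<tau>) \<in> measurable N (count_space UNIV)"
proof -
  have r: "(\<lambda>w. restrict (f w) {1..n}) \<in> measurable N (\<Pi>\<^sub>M i\<in>{1..n}. borel)"
    using f by (intro measurable_restrict) auto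
  have "(\<lambda>w. T_tilde n p X tb (restrict (f w) {1..n}) \<tau>) \<in> measurable N (count_space UNIV)"
    unfolding T_tilde_def
    by (intro measurable_argmin finite_models measurable_rss[OF _ r]) (auto intro: finite_subset)
  also have "(\<lambda>w. T_tilde n p X tb (restrict (f w) {1..n}) \<tau>) = (\<lambda>w. T_tilde n p X tb (f w) \<tau>)"
    by (intro ext T_tilde_cong) auto
  finally show ?thesis .
qed

lemma measurable_resid:
  assumes "finite \<tau>" "i \<in> {1..n}"
  shows "(\<lambda>v. resid n X \<tau> v i) \<in> borel_measurable (\<Pi>\<^sub>M i\<in>{1..n}. borel)"
    and "(\<lambda>v. L2_set (resid n X \<tau> v) {1..n}) \<in> borel_measurable (\<Pi>\<^sub>M i\<in>{1..n}. borel)"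
proof -
  obtain Q r where ad: "adapted n X \<tau> Q r" by (rule adapted_exists[OF assms(1)])
  have Qm: "(\<lambda>u. Q u k) \<in> borel_measurable (\<Pi>\<^sub>M i\<in>{1..n}. borel)" if "k \<in> {r<..n}" for k
    using that adaptedD(1)[OF ad] by (intro measurable_rotation_component) auto
  have "(\<lambda>v. resid n X \<tau> v i) \<in> borel_measurable (\<Pi>\<^sub>M i\<in>{1..n}. borel)" if "i \<in> {1..n}" for i
    unfolding proj_resid_adapted(2)[OF ad that] using Qm by measurable
  then show "(\<lambda>v. resid n X \<tau> v i) \<in> borel_measurable (\<Pi>\<^sub>M i\<in>{1..n}. borel)"
    "(\<lambda>v. L2_set (resid n X \<tau> v) {1..n}) \<in> borel_measurable (\<Pi>\<^sub>M i\<in>{1..n}. borel)"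
    using assms(2) unfolding L2_set_def by measurable
qed

text \<open>The argument of \<open>T_tilde\<close> inside \<open>cond_pmf\<close>: the statistics
  \<open>w\<close> are held fixed and only the residual direction is drawn afresh from
  \<open>v\<close>.\<close>

definition resample ::
  "nat \<Rightarrow> (nat \<Rightarrow> nat \<Rightarrow> real) \<Rightarrow> nat set \<Rightarrow> (nat \<Rightarrow> real) \<times> real \<Rightarrow> (nat \<Rightarrow> real) \<Rightarrow> nat \<Rightarrow> real" where
  "resample n X \<tau> w v i = fst w i + snd w * (resid n X \<tau> v i / L2_set (resid n X \<tau> v) {1..n})"

lemma cond_pmf_resample:
  "cond_pmf n p X tb w \<tau> \<tau>' = measure (gauss {1..n}) {v \<in> space (gauss {1..n}). T_tilde n p X tb (resample n X \<tau> w v) \<tau> = \<tau>'}"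
  by (simp add: cond_pmf_def resample_def[abs_def] std_gauss_eq)

text \<open>The values are measures of the sections of one jointly measurable set, as in
  Tonelli.\<close>

lemma measurable_cond_pmf:
  assumes "finite \<tau>" and w: "\<And>i. i \<in> {1..n} \<Longrightarrow> (\<lambda>x. fst (w x) i) \<in> borel_measurable N"
    "(\<lambda>x. snd (w x)) \<in> borel_measurable N"
  shows "(\<lambda>x. cond_pmf n p X tb (w x) \<tau> \<tau>') \<in> borel_measurable N"
proof -
  interpret prob_space "gauss {1..n}" by (rule prob_space_gauss)
  have "(\<lambda>z. T_tilde n p X tb (resample n X \<tau> (w (fst z)) (snd z)) \<tau>) \<in> measurable (N \<Otimes>\<^sub>M gauss {1..n}) (count_space UNIV)"
  proof (rule measurable_T_tilde)
    fix i assume i: "i \<in> {1..n}"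
    have [measurable]: "(\<lambda>v. resid n X \<tau> v i) \<in> borel_measurable (gauss {1..n})"
      "(\<lambda>v. L2_set (resid n X \<tau> v) {1..n}) \<in> borel_measurable (gauss {1..n})"
      using measurable_resid[OF assms(1) i] by auto
    note w(1)[OF i, measurable] w(2)[measurable]
    show "(\<lambda>z. resample n X \<tau> (w (fst z)) (snd z) i) \<in> borel_measurable (N \<Otimes>\<^sub>M gauss {1..n})"
      unfolding resample_def by measurable
  qed
  then have S: "{z \<in> space (N \<Otimes>\<^sub>M gauss {1..n}). T_tilde n p X tb (resample n X \<tau> (w (fst z)) (snd z)) \<tau> = \<tau>'} \<in> sets (N \<Otimes>\<^sub>M gauss {1..n})"
    (is "?S \<in> _") by measurable
  have "(\<lambda>x. measure (gauss {1..n}) (Pair x -` ?S)) \<in> borel_measurable N"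
    unfolding measure_def using measurable_emeasure_Pair[OF S] by measurable
  moreover have "cond_pmf n p X tb (w x) \<tau> \<tau>' = measure (gauss {1..n}) (Pair x -` ?S)" if "x \<in> space N" for x
    unfolding cond_pmf_resample using that by (intro arg_cong2[where f = measure]) (auto simp: space_pair_measure)
  ultimately show ?thesis by (simp cong: measurable_cong)
qed

text \<open>The index set of the sum in \<open>B_set\<close> moves with the point. Splitting over
  the finitely many values of \<open>T_tilde\<close> and summing conditional terms over all models
  leaves only comparisons of measurable functions.\<close>

lemma measurable_T_in_B:
  assumes fin: "finite \<tau>" and tb: "tie_break tb"
    and f: "\<And>i. i \<in> {1..n} \<Longrightarrow> (\<lambda>x. f x i) \<in> borel_measurable N"
    and w: "\<And>i. i \<in> {1..n} \<Longrightarrow> (\<lambda>x. fst (w x) i) \<in> borel_measurable N" "(\<lambda>x. snd (w x)) \<in> borel_measurable N"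
  shows "{x \<in> space N. T_tilde n p X tb (f x) \<tau> \<in> B_set n p X tb \<alpha> \<tau> (w x)} \<in> sets N"
proof -
  note [measurable] = measurable_cond_pmf[OF fin w, where p = p and X = X and tb = tb]
    measurable_T_tilde[OF f, where p = p and X = X and tb = tb and \<tau> = \<tau>]
  have eq: "{x \<in> space N. T_tilde n p X tb (f x) \<tau> \<in> B_set n p X tb \<alpha> \<tau> (w x)}
    = {x \<in> space N. \<exists>\<tau>s\<in>Pow {1..p}. T_tilde n p X tb (f x) \<tau> = \<tau>s \<and>
        1 - \<alpha> \<le> (\<Sum>\<tau>'\<in>Pow {1..p}. if cond_pmf n p X tb (w x) \<tau> \<tau>' \<le> cond_pmf n p X tb (w x) \<tau> \<tau>s
           then cond_pmf n p X tb (w x) \<tau> \<tau>' else 0)}"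
  proof -
    have "(\<Sum>\<tau>' \<in> {\<tau>'. \<tau>' \<subseteq> {1..p} \<and> g \<tau>' \<le> c}. g \<tau>') = (\<Sum>\<tau>'\<in>Pow {1..p}. if g \<tau>' \<le> c then g \<tau>' else 0)"
      for g :: "nat set \<Rightarrow> real" and c
      by (simp add: sum.inter_filter[symmetric] Pow_def)
    then show ?thesis using T_tilde_subset[OF tb] by (auto simp: B_set_def)
  qed
  show ?thesis unfolding eq
    by (intro sets.sets_Collect_finite_Ex) (auto intro!: sets.sets_Collect_conj)
qed

text \<open>Let s be a likeliest excluded value. Every excluded value is at most as likely as s, so
  together they lie in the lower set of s, and exclusion of s means that this set has mass below 1 -
  \<alpha>.\<close>

lemma rank_set_mass:
  fixes q :: "'a \<Rightarrow> real"
  assumes "finite C" "\<And>s. s \<in> C \<Longrightarrow> 0 \<le> q s" "sum q C = 1" "\<alpha> \<le> 1"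
  shows "\<alpha> \<le> sum q {s \<in> C. 1 - \<alpha> \<le> sum q {t \<in> C. q t \<le> q s}}"
proof -
  define G where "G = {s \<in> C. 1 - \<alpha> \<le> sum q {t \<in> C. q t \<le> q s}}"
  have split: "sum q C = sum q G + sum q (C - G)"
    using assms(1) by (subst sum.subset_diff[of G C]) (auto simp: G_def)
  show ?thesis
  proof (cases "C - G = {}")
    case True
    then show ?thesis using split assms by (simp only: G_def[symmetric] sum.empty)
  next
    case False
    obtain s where s: "s \<in> C - G" "\<And>t. t \<in> C - G \<Longrightarrow> q t \<le> q s"
    proof -
      have "finite (q ` (C - G))" "q ` (C - G) \<noteq> {}" using assms(1) False by auto
      from Max_in[OF this] obtain s where "s \<in> C - G" "q s = Max (q ` (C - G))" by auto
      then show ?thesis using that[of s] Max_ge[OF \<open>finite (q ` (C - G))\<close>] by auto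
    qed
    have "sum q (C - G) \<le> sum q {t \<in> C. q t \<le> q s}"
      using s assms by (intro sum_mono2) auto
    also have "\<dots> < 1 - \<alpha>" using s(1) by (auto simp: G_def)
    finally show ?thesis using split assms(3) by (simp add: G_def)
  qed
qed

text \<open>With \<open>w\<close> fixed, the rank set is deterministic and built from the very law
  of the resampled \<open>T_tilde\<close>, so \<open>rank_set_mass\<close> applies to its
  probability masses.\<close>

lemma resample_coverage:
  assumes tb: "tie_break tb" and fin: "finite \<tau>" and \<alpha>: "\<alpha> \<le> 1"
  shows "\<alpha> \<le> measure (gauss {1..n}) {v \<in> space (gauss {1..n}). T_tilde n p X tb (resample n X \<tau> w v) \<tau> \<in> B_set n p X tb \<alpha> \<tau> w}"
proof -
  interpret prob_space "gauss {1..n}" by (rule prob_space_gauss)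
  define T where "T v = T_tilde n p X tb (resample n X \<tau> w v) \<tau>" for v
  define q where "q = cond_pmf n p X tb w \<tau>"
  have q: "q s = prob {v \<in> space (gauss {1..n}). T v = s}" for s
    by (simp add: q_def cond_pmf_resample T_def)
  have [measurable]: "T \<in> measurable (gauss {1..n}) (count_space UNIV)"
    unfolding T_def[abs_def]
  proof (rule measurable_T_tilde)
    fix i assume i: "i \<in> {1..n}"
    have [measurable]: "(\<lambda>v. resid n X \<tau> v i) \<in> borel_measurable (gauss {1..n})"
      "(\<lambda>v. L2_set (resid n X \<tau> v) {1..n}) \<in> borel_measurable (gauss {1..n})"
      using measurable_resid[OF fin i] by auto
    show "(\<lambda>v. resample n X \<tau> w v i) \<in> borel_measurable (gauss {1..n})"
      unfolding resample_def by measurable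
  qed
  have Ts: "{v \<in> space (gauss {1..n}). T v = s} \<in> sets (gauss {1..n})" for s
    by measurable
  have sum_q: "sum q G = prob {v \<in> space (gauss {1..n}). T v \<in> G}" if "finite G" for G
  proof -
    have "sum q G = prob (\<Union>s\<in>G. {v \<in> space (gauss {1..n}). T v = s})"
      unfolding q using that Ts
      by (intro finite_measure_finite_Union[symmetric] image_subsetI) (auto simp: disjoint_family_on_def)
    also have "(\<Union>s\<in>G. {v \<in> space (gauss {1..n}). T v = s}) = {v \<in> space (gauss {1..n}). T v \<in> G}" by auto
    finally show ?thesis .
  qed
  have "sum q (Pow {1..p}) = 1"
  proof -
    have "{v \<in> space (gauss {1..n}). T v \<in> Pow {1..p}} = space (gauss {1..n})"
      using T_tilde_subset[OF tb] by (auto simp: T_def)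
    then show ?thesis by (simp add: sum_q prob_space)
  qed
  then have "\<alpha> \<le> sum q {s \<in> Pow {1..p}. 1 - \<alpha> \<le> sum q {t \<in> Pow {1..p}. q t \<le> q s}}"
    using \<alpha> by (intro rank_set_mass) (auto simp: q)
  also have "{s \<in> Pow {1..p}. 1 - \<alpha> \<le> sum q {t \<in> Pow {1..p}. q t \<le> q s}} = B_set n p X tb \<alpha> \<tau> w"
    by (simp add: B_set_def q_def)
  also have "sum q (B_set n p X tb \<alpha> \<tau> w) = prob {v \<in> space (gauss {1..n}). T v \<in> B_set n p X tb \<alpha> \<tau> w}"
    by (rule sum_q) (auto simp: B_set_def finite_models)
  finally show ?thesis by (simp add: T_def)
qed

text \<open>Given \<open>W_tilde\<close>, the only randomness left in \<open>Y\<close> is the direction of its residual, which by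
  \<open>gauss_polar\<close> may be replaced by an independent copy.\<close>

lemma T_in_B_coverage:
  fixes n p :: nat and X :: "nat \<Rightarrow> nat \<Rightarrow> real" and \<beta> :: "nat \<Rightarrow> real"
  assumes tb: "tie_break tb" and fin: "finite \<tau>" and \<alpha>: "\<alpha> \<le> 1" and s: "0 < \<sigma>"
  defines "G \<equiv> {u \<in> space (gauss {1..n}). T_tilde n p X tb (data X \<tau> \<beta> \<sigma> u) \<tau>
              \<in> B_set n p X tb \<alpha> \<tau> (W_tilde n X (data X \<tau> \<beta> \<sigma> u) \<tau>)}"
  shows "G \<in> sets (gauss {1..n})" and "\<alpha> \<le> measure (gauss {1..n}) G"
proof -
  interpret prob_space "gauss {1..n}" by (rule prob_space_gauss)
  have dm: "(\<lambda>u. restrict (data X \<tau> \<beta> \<sigma> u) {1..n}) \<in> measurable (gauss {1..n}) (\<Pi>\<^sub>M i\<in>{1..n}. borel)"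
    unfolding data_def by measurable
  obtain Q r where ad: "adapted n X \<tau> Q r" by (rule adapted_exists[OF fin])
  note rot = adaptedD(1)[OF ad] and rn = adaptedD(2)[OF ad]
  \<comment> \<open>\<open>I\<close> indexes the fitted coordinates and \<open>J\<close> the
    residual ones. \<open>y\<close> rebuilds the data from fitted coordinates, radius and direction,
    whereas \<open>w\<close> uses only the first two; so the rank set does not see the
    direction.\<close>
  define I where "I = {1..r}"
  define J where "J = {r<..n}"
  have IJ: "I \<inter> J = {}" "finite I" "finite J" "I \<union> J = {1..n}" using rn by (auto simp: I_def J_def)
  define e where "e i k = Q (\<lambda>l. of_bool (l = i)) k" for i k
  define m where "m = Q (Xmul X \<tau> \<beta>)"
  define a where "a x = (\<lambda>i\<in>{1..n}. \<Sum>k\<in>I. e i k * (m k + \<sigma> * x k))" for x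
  define df where "df D i = (\<Sum>k\<in>J. e i k * D k)" for D i
  define w where "w x b = (a x, \<sigma> * b)" for x b
  define y where "y x b D = (\<lambda>i. a x i + \<sigma> * b * df D i)" for x b D
  define \<Phi> where "\<Phi> x b D = (indicator {p'. T_tilde n p X tb (y x b (snd p')) \<tau> \<in> B_set n p X tb \<alpha> \<tau> (w x (fst p'))} (b, D) :: ennreal)" for x b D
  have \<Phi>: "\<Phi> x b D = (if T_tilde n p X tb (y x b D) \<tau> \<in> B_set n p X tb \<alpha> \<tau> (w x b) then 1 else 0)" for x b D
    by (simp add: \<Phi>_def indicator_def)
  have Qdata: "Q (data X \<tau> \<beta> \<sigma> u) k = m k + \<sigma> * Q u k" if "k \<in> {1..n}" for u k
    unfolding data_def m_def using rotation_lin[OF rot that] .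
  have m0: "m k = 0" if "k \<in> J" for k using that adaptedD(3)[OF ad] by (simp add: m_def J_def)
  have QJ: "Q (data X \<tau> \<beta> \<sigma> u) k = \<sigma> * Q u k" if "k \<in> J" for u k
  proof -
    have "k \<in> {1..n}" using that by (auto simp: J_def)
    then show ?thesis using m0[OF that] by (simp add: Qdata)
  qed
  have projY: "proj n X \<tau> (data X \<tau> \<beta> \<sigma> u) = a (Q u)" for u
    unfolding proj_resid_adapted(1)[OF ad] a_def e_def I_def
    using rn by (intro restrict_ext sum.cong) (auto simp: Qdata)
  have residY: "resid n X \<tau> (data X \<tau> \<beta> \<sigma> u) i = \<sigma> * (\<Sum>k\<in>J. e i k * Q u k)" if "i \<in> {1..n}" for u i
    unfolding proj_resid_adapted(2)[OF ad that] e_def sum_distrib_left J_def[symmetric]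
    by (intro sum.cong) (auto simp: QJ)
  have normY: "L2_set (resid n X \<tau> (data X \<tau> \<beta> \<sigma> u)) {1..n} = \<sigma> * L2_set (Q u) J" for u
  proof (rule power2_eq_imp_eq)
    have "(L2_set (resid n X \<tau> (data X \<tau> \<beta> \<sigma> u)) {1..n})\<^sup>2 = (\<Sum>k\<in>J. (\<sigma> * Q u k)\<^sup>2)"
      unfolding proj_resid_adapted(3)[OF ad] J_def[symmetric]
      by (intro sum.cong) (auto simp: QJ)
    also have "\<dots> = (\<sigma> * L2_set (Q u) J)\<^sup>2"
      by (simp add: power_mult_distrib L2_set_def sum_nonneg sum_distrib_left)
    finally show "(L2_set (resid n X \<tau> (data X \<tau> \<beta> \<sigma> u)) {1..n})\<^sup>2 = (\<sigma> * L2_set (Q u) J)\<^sup>2" .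
  qed (use s in auto)
  have WY: "W_tilde n X (data X \<tau> \<beta> \<sigma> u) \<tau> = w (Q u) (L2_set (Q u) J)" for u
    by (simp add: W_tilde_def projY normY w_def)
  \<comment> \<open>Also true at radius 0, where both sides vanish; hence no null set has to be
    excluded.\<close>
  have dirn: "L2_set z J * dirn J z k = z k" if "k \<in> J" for z k
    using that IJ(3) by (auto simp: dirn_def L2_set_eq_0_iff)
  have Yeq: "data X \<tau> \<beta> \<sigma> u i = y (Q u) (L2_set (Q u) J) (dirn J (Q u)) i" if i: "i \<in> {1..n}" for u i
  proof -
    have "data X \<tau> \<beta> \<sigma> u i = a (Q u) i + \<sigma> * (\<Sum>k\<in>J. e i k * Q u k)"
      using residY[OF i, of u] by (simp add: resid_def projY)
    also have "(\<Sum>k\<in>J. e i k * Q u k) = L2_set (Q u) J * df (dirn J (Q u)) i"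
      unfolding df_def sum_distrib_left
      by (intro sum.cong) (auto simp: dirn[symmetric, of _ "Q u"] simp del: dirn)
    finally show ?thesis by (simp add: y_def)
  qed
  have inG: "u \<in> G \<longleftrightarrow> T_tilde n p X tb (y (Q u) (L2_set (Q u) J) (dirn J (Q u))) \<tau> \<in> B_set n p X tb \<alpha> \<tau> (w (Q u) (L2_set (Q u) J))"
    if "u \<in> space (gauss {1..n})" for u
    using that T_tilde_cong[OF Yeq, where p = p and X = X and tb = tb and \<tau> = \<tau>] by (simp add: G_def WY)
  have resam: "resample n X \<tau> (w x b) v i = y x b (dirn J (Q v)) i" if i: "i \<in> {1..n}" for x b v i
  proof -
    have "resid n X \<tau> v i = (\<Sum>k\<in>J. e i k * Q v k)"
      unfolding proj_resid_adapted(2)[OF ad i] e_def J_def ..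
    moreover have "L2_set (resid n X \<tau> v) {1..n} = L2_set (Q v) J"
      by (rule power2_eq_imp_eq) (auto simp: proj_resid_adapted(3)[OF ad] J_def, simp add: L2_set_def sum_nonneg)
    ultimately show ?thesis
      by (simp add: resample_def w_def y_def df_def dirn_def sum_divide_distrib)
  qed
  have meas: "(\<lambda>x. \<Phi> (f x) (g x) (h x)) \<in> borel_measurable N"
    if [measurable]: "f \<in> measurable N (\<Pi>\<^sub>M i\<in>I. borel)" "g \<in> borel_measurable N" "h \<in> measurable N (\<Pi>\<^sub>M i\<in>J. borel)"
    for f :: "'b \<Rightarrow> nat \<Rightarrow> real" and g h N
  proof -
    have am[measurable]: "(\<lambda>x. a (f x) i) \<in> borel_measurable N" if "i \<in> {1..n}" for i
      using that unfolding a_def by simp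
    have [measurable]: "(\<lambda>x. df (h x) i) \<in> borel_measurable N" for i
      unfolding df_def by measurable
    have "{x \<in> space N. T_tilde n p X tb (y (f x) (g x) (h x)) \<tau> \<in> B_set n p X tb \<alpha> \<tau> (w (f x) (g x))} \<in> sets N"
      using am by (intro measurable_T_in_B[OF fin tb]) (auto simp: y_def w_def)
    then show ?thesis unfolding \<Phi> by (intro measurable_If) auto
  qed
  have resJ: "(\<lambda>z. restrict z J) \<in> measurable (\<Pi>\<^sub>M i\<in>{1..n}. borel) (\<Pi>\<^sub>M i\<in>J. borel)"
    "(\<lambda>z. restrict z I) \<in> measurable (\<Pi>\<^sub>M i\<in>{1..n}. borel) (\<Pi>\<^sub>M i\<in>I. borel)"
    using IJ(4) by (auto intro!: measurable_restrict_subset)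
  have Lr: "L2_set (restrict z J) J = L2_set z J" "dirn J (restrict z J) = dirn J z" for z
  proof -
    show *: "L2_set (restrict z J) J = L2_set z J" by (rule L2_set_cong) auto
    show "dirn J (restrict z J) = dirn J z" unfolding dirn_def * by (rule restrict_ext) auto
  qed
  have ar: "a (restrict z I) = a z" for z
    unfolding a_def by (intro restrict_ext sum.cong) auto
  have \<Phi>r: "\<Phi> (restrict z I) b D = \<Phi> z b D" for z b D by (simp add: \<Phi> y_def w_def ar)
  have \<Phi>m: "(\<lambda>z. \<Phi> z (L2_set z J) (dirn J z)) \<in> borel_measurable (\<Pi>\<^sub>M i\<in>{1..n}. borel)"
  proof -
    have "(\<lambda>z. \<Phi> (restrict z I) (L2_set (restrict z J) J) (dirn J (restrict z J))) \<in> borel_measurable (\<Pi>\<^sub>M i\<in>{1..n}. borel)"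
      by (intro meas resJ measurable_compose[OF resJ(1) measurable_L2_set] measurable_compose[OF resJ(1) measurable_dirn])
    then show ?thesis by (simp only: Lr \<Phi>r)
  qed
  have \<Phi>m2: "(\<lambda>z. \<Phi> x b (dirn J z)) \<in> borel_measurable (\<Pi>\<^sub>M i\<in>{1..n}. borel)" if "x \<in> space (\<Pi>\<^sub>M i\<in>I. borel)" for x b
  proof -
    have "(\<lambda>z. \<Phi> x b (dirn J (restrict z J))) \<in> borel_measurable (\<Pi>\<^sub>M i\<in>{1..n}. borel)"
      using that by (intro meas measurable_compose[OF resJ(1) measurable_dirn]) auto
    then show ?thesis by (simp only: Lr)
  qed
  have merge: "L2_set (merge I J (x, y')) J = L2_set y' J" "dirn J (merge I J (x, y')) = dirn J y'"
    "\<Phi> (merge I J (x, y')) b D = \<Phi> x b D" for x y' b D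
  proof -
    show *: "L2_set (merge I J (x, y')) J = L2_set y' J" using IJ(1) by (intro L2_set_cong) auto
    show "dirn J (merge I J (x, y')) = dirn J y'" unfolding dirn_def * using IJ(1) by (intro restrict_ext) auto
    have "a (merge I J (x, y')) = a x" unfolding a_def using IJ(1) by (intro restrict_ext sum.cong) auto
    then show "\<Phi> (merge I J (x, y')) b D = \<Phi> x b D" by (simp add: \<Phi> y_def w_def)
  qed
  have fold: "(\<integral>\<^sup>+z. f z \<partial>gauss {1..n}) = (\<integral>\<^sup>+x. (\<integral>\<^sup>+y. f (merge I J (x, y)) \<partial>gauss J) \<partial>gauss I)"
    if "f \<in> borel_measurable (\<Pi>\<^sub>M i\<in>{1..n}. borel)" for f
    using that gauss1.product_nn_integral_fold[OF IJ(1-3), of f] sets_gauss[of "{1..n}"]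
    unfolding IJ(4) gauss_def by (simp cong: measurable_cong_sets)
  have one: "(\<integral>\<^sup>+x. c \<partial>gauss L) = c" for c and L :: "nat set"
    using prob_space.emeasure_space_1[OF prob_space_gauss[of L]] by simp
  show Gs: "G \<in> sets (gauss {1..n})"
  proof -
    have "(\<lambda>u. \<Phi> (Q u) (L2_set (Q u) J) (dirn J (Q u))) \<in> borel_measurable (gauss {1..n})"
      using measurable_compose[OF measurable_rotation[OF rot] \<Phi>m] by simp
    then have "(\<lambda>u. \<Phi> (Q u) (L2_set (Q u) J) (dirn J (Q u))) -` {1} \<inter> space (gauss {1..n}) \<in> sets (gauss {1..n})"
      by (rule measurable_sets) auto
    also have "(\<lambda>u. \<Phi> (Q u) (L2_set (Q u) J) (dirn J (Q u))) -` {1} \<inter> space (gauss {1..n}) = G"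
      using inG by (auto simp: \<Phi> G_def split: if_splits)
    finally show ?thesis .
  qed
  \<comment> \<open>Coverage for every fixed fitted part \<open>x\<close> and radius factor
    \<open>b\<close>, the residual direction alone being random.\<close>
  have inner: "ennreal \<alpha> \<le> (\<integral>\<^sup>+y'. \<Phi> x b (dirn J y') \<partial>gauss J)" if x: "x \<in> space (gauss I)" for x b
  proof -
    have x': "x \<in> space (\<Pi>\<^sub>M i\<in>I. borel)" using x by (simp add: space_gauss space_PiM)
    have "ennreal \<alpha> \<le> ennreal (prob {v \<in> space (gauss {1..n}). T_tilde n p X tb (resample n X \<tau> (w x b) v) \<tau> \<in> B_set n p X tb \<alpha> \<tau> (w x b)})"
      by (intro ennreal_leI resample_coverage tb fin \<alpha>)
    also have "{v \<in> space (gauss {1..n}). T_tilde n p X tb (resample n X \<tau> (w x b) v) \<tau> \<in> B_set n p X tb \<alpha> \<tau> (w x b)}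
       = {v \<in> space (gauss {1..n}). \<Phi> x b (dirn J (Q v)) = 1}"
      using T_tilde_cong[OF resam, where p = p and X = X and tb = tb and \<tau> = \<tau>] by (auto simp: \<Phi>)
    also have "ennreal (prob {v \<in> space (gauss {1..n}). \<Phi> x b (dirn J (Q v)) = 1}) = (\<integral>\<^sup>+v. \<Phi> x b (dirn J (Q v)) \<partial>gauss {1..n})"
    proof -
      have [measurable]: "(\<lambda>v. \<Phi> x b (dirn J (Q v))) \<in> borel_measurable (gauss {1..n})"
        using measurable_compose[OF measurable_rotation[OF rot] \<Phi>m2[OF x']] by simp
      have "(\<integral>\<^sup>+v. \<Phi> x b (dirn J (Q v)) \<partial>gauss {1..n}) = (\<integral>\<^sup>+v. indicator {v \<in> space (gauss {1..n}). \<Phi> x b (dirn J (Q v)) = 1} v \<partial>gauss {1..n})"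
        by (intro nn_integral_cong) (auto simp: \<Phi> indicator_def)
      also have "\<dots> = emeasure (gauss {1..n}) {v \<in> space (gauss {1..n}). \<Phi> x b (dirn J (Q v)) = 1}"
        by (rule nn_integral_indicator) measurable
      finally show ?thesis by (simp add: emeasure_eq_measure)
    qed
    also have "\<dots> = (\<integral>\<^sup>+z. \<Phi> x b (dirn J z) \<partial>gauss {1..n})"
      by (rule gauss_rotation[OF rot \<Phi>m2[OF x']])
    also have "\<dots> = (\<integral>\<^sup>+y'. \<Phi> x b (dirn J y') \<partial>gauss J)"
      by (simp only: fold[OF \<Phi>m2[OF x']] merge one)
    finally show ?thesis .
  qed
  \<comment> \<open>Averaging the pointwise bound over fitted part and radius gives a fresh
    direction, which \<open>gauss_polar\<close> replaces by the direction belonging to the same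
    residual.\<close>
  have "ennreal \<alpha> = (\<integral>\<^sup>+x. (\<integral>\<^sup>+y. ennreal \<alpha> \<partial>gauss J) \<partial>gauss I)" by (simp only: one)
  also have "\<dots> \<le> (\<integral>\<^sup>+x. (\<integral>\<^sup>+y. (\<integral>\<^sup>+y'. \<Phi> x (L2_set y J) (dirn J y') \<partial>gauss J) \<partial>gauss J) \<partial>gauss I)"
    by (intro nn_integral_mono inner)
  also have "\<dots> = (\<integral>\<^sup>+x. (\<integral>\<^sup>+y. \<Phi> x (L2_set y J) (dirn J y) \<partial>gauss J) \<partial>gauss I)"
  proof (rule nn_integral_cong)
    fix x assume "x \<in> space (gauss I)"
    then have x': "x \<in> space (\<Pi>\<^sub>M i\<in>I. borel)" by (simp add: space_gauss space_PiM)
    have "(\<lambda>p'. \<Phi> x (fst p') (snd p')) \<in> borel_measurable (borel \<Otimes>\<^sub>M (\<Pi>\<^sub>M i\<in>J. borel))"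
      using x' by (intro meas) auto
    from gauss_polar[OF IJ(3) this]
    show "(\<integral>\<^sup>+y. (\<integral>\<^sup>+y'. \<Phi> x (L2_set y J) (dirn J y') \<partial>gauss J) \<partial>gauss J) = (\<integral>\<^sup>+y. \<Phi> x (L2_set y J) (dirn J y) \<partial>gauss J)"
      by simp
  qed
  also have "\<dots> = (\<integral>\<^sup>+z. \<Phi> z (L2_set z J) (dirn J z) \<partial>gauss {1..n})"
    by (subst fold[OF \<Phi>m]) (simp add: merge)
  also have "\<dots> = (\<integral>\<^sup>+u. \<Phi> (Q u) (L2_set (Q u) J) (dirn J (Q u)) \<partial>gauss {1..n})"
    by (rule gauss_rotation[OF rot \<Phi>m, symmetric])
  also have "\<dots> = (\<integral>\<^sup>+u. indicator G u \<partial>gauss {1..n})"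
    using inG by (intro nn_integral_cong) (auto simp: \<Phi> indicator_def)
  also have "\<dots> = ennreal (prob G)" using Gs by (simp add: emeasure_eq_measure)
  finally show "\<alpha> \<le> prob G" by (simp add: ennreal_le_iff)
qed

section \<open>Recovery of the true model\<close>

lemma rss1_mono: "\<tau> \<subseteq> \<tau>' \<Longrightarrow> finite \<tau>' \<Longrightarrow> rss1 n X us y \<tau>' \<le> rss1 n X us y \<tau>"
  unfolding rss1_def by (intro rss_antimono) auto

text \<open>A model containing \<tau>0 absorbs the signal, so only the scaled noise is left.\<close>

lemma rss1_data:
  assumes "\<tau>0 \<subseteq> \<tau>" "finite \<tau>" "0 \<notin> \<tau>"
  shows "rss1 n X us (data X \<tau>0 \<beta>0 \<sigma> u) \<tau> = \<sigma>\<^sup>2 * rss1 n X us u \<tau>"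
proof -
  define \<beta> where "\<beta> j = (if j \<in> \<tau>0 then \<beta>0 j else 0)" for j
  have "Xmul (aug X us) (insert 0 \<tau>) \<beta> i = Xmul X \<tau>0 \<beta>0 i" for i
    unfolding Xmul_def using assms
    by (intro sum.mono_neutral_cong_right) (auto simp: \<beta>_def aug_def)
  then have "data X \<tau>0 \<beta>0 \<sigma> u = (\<lambda>i. Xmul (aug X us) (insert 0 \<tau>) \<beta> i + \<sigma> * u i)"
    by (simp add: data_def)
  then show ?thesis using assms(2) by (simp add: rss1_def rss_shift rss_scale)
qed

lemma Cmin_le_rss:
  assumes n: "0 < n" and \<tau>: "\<tau> \<subseteq> {1..p}" "\<tau> \<noteq> \<tau>0" "card \<tau> \<le> card \<tau>0"
  shows "real n * max (real (card (\<tau>0 - \<tau>))) 1 * Cmin n p X \<tau>0 \<beta>0 \<le> rss n X (Xmul X \<tau>0 \<beta>0) \<tau>"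
proof -
  define c where "c = real n * max (real (card (\<tau>0 - \<tau>))) 1"
  have c: "0 < c" using n by (simp add: c_def less_max_iff_disj)
  define F where "F \<beta> = (L2_set (\<lambda>i. Xmul X \<tau>0 \<beta>0 i - Xmul X \<tau> \<beta> i) {1..n})\<^sup>2" for \<beta>
  have "Cmin n p X \<tau>0 \<beta>0 \<le> (INF \<beta>. F \<beta> / c)"
    unfolding Cmin_def F_def c_def using \<tau>
    by (intro Min_le) (auto intro!: finite_imageI finite_models)
  moreover have "(INF \<beta>. F \<beta> / c) \<le> F \<beta> / c" for \<beta>
    using c by (intro cINF_lower bdd_belowI[of _ 0]) (auto simp: F_def)
  ultimately have "Cmin n p X \<tau>0 \<beta>0 \<le> F \<beta> / c" for \<beta> by (rule order_trans)
  then have "c * Cmin n p X \<tau>0 \<beta>0 \<le> F \<beta>" for \<beta>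
    using c by (simp add: pos_le_divide_eq mult.commute)
  then show ?thesis unfolding rss_def c_def[symmetric] F_def[symmetric] by (intro cINF_greatest) auto
qed

text \<open>The deterministic core: \<open>E1\<close> bounds the damage of projecting out the
  synthetic noise, \<open>E2\<close> the cross term with the data noise, \<open>E3\<close> the
  overfitting of added columns. A larger model is compared through its union with \<tau>0, which
  only lowers its residual; its excess size is at least 1 and at least card T - card \<tau>0, so its
  penalty covers \<open>E3\<close>.\<close>

lemma pen_loss_true_model_minimal:
  fixes n p :: nat and lam \<sigma> C :: real
  assumes n: "0 < n" and \<tau>0: "\<tau>0 \<subseteq> {1..p}" and lam: "0 < lam" "lam \<le> 0.05 * (real n * C)"
    and signal: "\<And>\<tau>. \<tau> \<subseteq> {1..p} \<Longrightarrow> \<tau> \<noteq> \<tau>0 \<Longrightarrow> card \<tau> \<le> card \<tau>0 \<Longrightarrow>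
      real n * max (real (card (\<tau>0 - \<tau>))) 1 * C \<le> rss n X (Xmul X \<tau>0 \<beta>0) \<tau>"
    and E1: "\<And>\<tau>. \<tau> \<subseteq> {1..p} \<Longrightarrow> \<tau> \<noteq> \<tau>0 \<Longrightarrow> card \<tau> \<le> card \<tau>0 \<Longrightarrow>
      rss n X (Xmul X \<tau>0 \<beta>0) \<tau> / 3 \<le> rss1 n X us (Xmul X \<tau>0 \<beta>0) \<tau>"
    and E2: "\<And>\<tau>. \<tau> \<subseteq> {1..p} \<Longrightarrow> \<tau> \<noteq> \<tau>0 \<Longrightarrow> card \<tau> \<le> card \<tau>0 \<Longrightarrow>
      rss1 n X us (Xmul X \<tau>0 \<beta>0) \<tau> / 2 + \<sigma>\<^sup>2 * rss1 n X us u \<tau> \<le> rss1 n X us (data X \<tau>0 \<beta>0 \<sigma> u) \<tau>"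
    and E3: "\<And>T. T \<subseteq> {1..p} - \<tau>0 \<Longrightarrow> T \<noteq> {} \<Longrightarrow>
      \<sigma>\<^sup>2 * (rss1 n X us u \<tau>0 - rss1 n X us u (\<tau>0 \<union> T)) < lam * real (max 1 (card T - card \<tau>0))"
    and \<tau>: "\<tau> \<subseteq> {1..p}" "\<tau> \<noteq> \<tau>0"
  shows "pen_loss n X lam (data X \<tau>0 \<beta>0 \<sigma> u) us \<tau>0 < pen_loss n X lam (data X \<tau>0 \<beta>0 \<sigma> u) us \<tau>"
proof -
  let ?y = "data X \<tau>0 \<beta>0 \<sigma> u"
  have fin: "finite \<tau>" "finite \<tau>0" using \<tau> \<tau>0 finite_subset by auto
  have z: "0 \<notin> \<tau>" "0 \<notin> \<tau>0" using \<tau> \<tau>0 by auto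
  have y0: "rss1 n X us ?y \<tau>0 = \<sigma>\<^sup>2 * rss1 n X us u \<tau>0" using fin z by (intro rss1_data) auto
  define T where "T = \<tau> - \<tau>0"
  have T: "T \<subseteq> {1..p} - \<tau>0" "finite T" using \<tau> fin by (auto simp: T_def)
  have un: "\<tau>0 \<union> T = \<tau>0 \<union> \<tau>" by (auto simp: T_def)
  have cT: "card T + card (\<tau> \<inter> \<tau>0) = card \<tau>" "card (\<tau>0 - \<tau>) + card (\<tau> \<inter> \<tau>0) = card \<tau>0"
    using fin card_Diff_subset_Int[of \<tau> \<tau>0] card_Diff_subset_Int[of \<tau>0 \<tau>]
      card_mono[of \<tau> "\<tau> \<inter> \<tau>0"] card_mono[of \<tau>0 "\<tau> \<inter> \<tau>0"]
    by (auto simp: T_def Int_commute)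
  have goal: "pen_loss n X lam ?y us \<tau>0 < pen_loss n X lam ?y us \<tau>
     \<longleftrightarrow> \<sigma>\<^sup>2 * rss1 n X us u \<tau>0 + lam * real (card \<tau>0) < rss1 n X us ?y \<tau> + lam * real (card \<tau>)"
    using fin z by (simp add: pen_loss_eq y0)
  show ?thesis
  proof (cases "card \<tau> \<le> card \<tau>0")
    case True
    define k where "k = card (\<tau>0 - \<tau>)"
    have k1: "1 \<le> k"
    proof (rule ccontr)
      assume "\<not> 1 \<le> k"
      then have "card (\<tau>0 - \<tau>) = 0" by (simp add: k_def)
      then have "\<tau>0 \<subseteq> \<tau>" using fin by simp
      then show False using card_seteq[OF fin(1) _ True] \<tau>(2) by auto
    qed
    have Tk: "card T \<le> k" "card \<tau>0 - card \<tau> \<le> k" "k \<le> card \<tau>0" using cT True by (auto simp: k_def)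
    have noise: "\<sigma>\<^sup>2 * rss1 n X us u \<tau>0 - lam \<le> \<sigma>\<^sup>2 * rss1 n X us u \<tau>"
    proof (cases "T = {}")
      case True
      then have "\<tau> \<subseteq> \<tau>0" by (auto simp: T_def)
      then have "\<sigma>\<^sup>2 * rss1 n X us u \<tau>0 \<le> \<sigma>\<^sup>2 * rss1 n X us u \<tau>"
        using fin by (intro mult_left_mono rss1_mono) auto
      then show ?thesis using lam by simp
    next
      case False
      \<comment> \<open>The truncated difference is 0 because T has at most k \<le> card \<tau>0
        elements, so a model of this size can gain less than one lam from noise.\<close>
      have "max 1 (card T - card \<tau>0) = 1" using Tk by auto
      then have "\<sigma>\<^sup>2 * rss1 n X us u \<tau>0 - \<sigma>\<^sup>2 * rss1 n X us u (\<tau>0 \<union> \<tau>) < lam"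
        using E3[OF T(1) False] by (simp add: un algebra_simps)
      moreover have "\<sigma>\<^sup>2 * rss1 n X us u (\<tau>0 \<union> \<tau>) \<le> \<sigma>\<^sup>2 * rss1 n X us u \<tau>"
        using fin by (intro mult_left_mono rss1_mono) auto
      ultimately show ?thesis by simp
    qed
    have "real n * real k * C \<le> rss n X (Xmul X \<tau>0 \<beta>0) \<tau>"
      using signal[OF \<tau> True] k1 by (simp add: k_def[symmetric] max_def split: if_splits)
    moreover have "20 * lam * real k \<le> real n * real k * C"
      using mult_right_mono[OF lam(2), of "real k"] by (simp add: algebra_simps)
    \<comment> \<open>A sixth of the signal is worth at least 20/6 * lam * k, against lam for the
      noise and lam * k for the smaller penalty; k \<ge> 1 makes the inequality strict.\<close>
    moreover have "lam * real k \<ge> lam * 1" using k1 lam by (intro mult_left_mono) auto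
    moreover have "lam * real (card \<tau>0) \<le> lam * real (card \<tau>) + lam * real k"
      unfolding distrib_left[symmetric] using Tk(2) lam by (intro mult_left_mono) auto
    ultimately show ?thesis
      unfolding goal using E1[OF \<tau> True] E2[OF \<tau> True] noise lam(1) by linarith
  next
    case False
    then have "T \<noteq> {}" using cT by auto
    note E3[OF T(1) this]
    moreover have "lam * real (max 1 (card T - card \<tau>0)) \<le> lam * (real (card \<tau>) - real (card \<tau>0))"
      using False cT lam by (intro mult_left_mono) auto
    moreover have "rss1 n X us ?y (\<tau>0 \<union> T) \<le> rss1 n X us ?y \<tau>"
      unfolding un using fin by (intro rss1_mono) auto
    moreover have "rss1 n X us ?y (\<tau>0 \<union> T) = \<sigma>\<^sup>2 * rss1 n X us u (\<tau>0 \<union> T)"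
      using fin z T by (intro rss1_data) auto
    ultimately show ?thesis unfolding goal by (simp add: algebra_simps)
  qed
qed

lemma tau_hat_eqI:
  assumes "tie_break tb" "\<tau>0 \<subseteq> {1..p}"
    and "\<And>\<tau>. \<tau> \<subseteq> {1..p} \<Longrightarrow> \<tau> \<noteq> \<tau>0 \<Longrightarrow> pen_loss n X lam y us \<tau>0 < pen_loss n X lam y us \<tau>"
  shows "tau_hat n p X lam tb y us = \<tau>0"
proof -
  have "{\<tau>. is_arg_min (pen_loss n X lam y us) (\<lambda>\<tau>. \<tau> \<subseteq> {1..p}) \<tau>} = {\<tau>0}"
  proof (intro equalityI subsetI)
    fix \<tau> assume "\<tau> \<in> {\<tau>. is_arg_min (pen_loss n X lam y us) (\<lambda>\<tau>. \<tau> \<subseteq> {1..p}) \<tau>}"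
    then show "\<tau> \<in> {\<tau>0}" using assms(2) assms(3)[of \<tau>] by (auto simp: is_arg_min_def)
  next
    fix \<tau> assume "\<tau> \<in> {\<tau>0}"
    moreover have "\<not> pen_loss n X lam y us \<tau>' < pen_loss n X lam y us \<tau>0" if "\<tau>' \<subseteq> {1..p}" for \<tau>'
      using assms(3)[OF that] by (cases "\<tau>' = \<tau>0") auto
    ultimately show "\<tau> \<in> {\<tau>. is_arg_min (pen_loss n X lam y us) (\<lambda>\<tau>. \<tau> \<subseteq> {1..p}) \<tau>}"
      using assms(2) by (auto simp: is_arg_min_def)
  qed
  moreover have "tb {\<tau>0} \<in> {\<tau>0}" using assms(1) unfolding tie_break_def by blast
  ultimately show ?thesis by (simp add: tau_hat_def)
qed

lemma rss_restrict: "rss n X (restrict y {1..n}) \<tau> = rss n X y \<tau>"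
  by (rule rss_cong) simp

lemma measurable_tau_hat:
  assumes f: "\<And>i. i \<in> {1..n} \<Longrightarrow> (\<lambda>w. f w i) \<in> borel_measurable N"
    and g: "g \<in> measurable N (\<Pi>\<^sub>M i\<in>{1..n}. borel)"
  shows "(\<lambda>w. tau_hat n p X lam tb (f w) (g w)) \<in> measurable N (count_space UNIV)"
proof -
  have r: "(\<lambda>w. restrict (f w) {1..n}) \<in> measurable N (\<Pi>\<^sub>M i\<in>{1..n}. borel)"
    using f by (intro measurable_restrict) auto
  have "(\<lambda>w. pen_loss n X lam (f w) (g w) \<tau>) \<in> borel_measurable N" if \<tau>: "\<tau> \<subseteq> {1..p}" for \<tau>
  proof -
    have fin: "finite \<tau>" "0 \<notin> \<tau>" using \<tau> finite_subset by auto
    have "pen_loss n X lam (f w) (g w) \<tau> = rss1 n X (g w) (restrict (f w) {1..n}) \<tau> + lam * real (card \<tau>)" for w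
      unfolding pen_loss_eq[OF fin(2,1)] rss1_def rss_restrict ..
    then show ?thesis using measurable_rss1[OF fin r g] by simp
  qed
  then show ?thesis
    unfolding tau_hat_def using finite_models[of p "\<lambda>_. True"] by (intro measurable_argmin) auto
qed

text \<open>Lets the synthetic noise, the first component, be frozen: a bound uniform in it passes
  to the product measure.\<close>

lemma pair_emeasure_le:
  assumes "prob_space M1" "sigma_finite_measure M2" "A \<in> sets (M1 \<Otimes>\<^sub>M M2)"
    and le: "\<And>x. x \<in> space M1 \<Longrightarrow> emeasure M2 (Pair x -` A) \<le> b"
  shows "emeasure (M1 \<Otimes>\<^sub>M M2) A \<le> b"
proof -
  interpret M1: prob_space M1 by fact
  interpret M2: sigma_finite_measure M2 by fact
  have "emeasure (M1 \<Otimes>\<^sub>M M2) A = (\<integral>\<^sup>+x. emeasure M2 (Pair x -` A) \<partial>M1)"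
    using assms(3) by (rule M2.emeasure_pair_measure_alt)
  also have "\<dots> \<le> (\<integral>\<^sup>+x. b \<partial>M1)" by (intro nn_integral_mono le)
  also have "\<dots> = b" using M1.emeasure_space_1 by simp
  finally show ?thesis .
qed

text \<open>The union bound over three kinds of bad event: the synthetic noise swallows two thirds
  of a signal, the cross term exceeds half of what remains, or added columns fit noise beyond the
  penalty. The 96 is 3 * 32, since the cross term bound is applied to a third of the signal.\<close>

definition select_fail_bound :: "nat \<Rightarrow> nat \<Rightarrow> nat set \<Rightarrow> real \<Rightarrow> real \<Rightarrow> real \<Rightarrow> real" where
  "select_fail_bound n p \<tau>0 C \<sigma> lam =
     real (card {\<tau>. \<tau> \<subseteq> {1..p} \<and> card \<tau> \<le> card \<tau>0})
       * (sqrt 2 * (1 / sqrt 2) ^ (n - card \<tau>0 - 1) + exp (- (real n * C) / (96 * \<sigma>\<^sup>2)))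
     + (\<Sum>T | T \<subseteq> {1..p} \<and> T \<noteq> {}.
          sqrt 2 ^ card T * exp (- (lam * real (max 1 (card T - card \<tau>0))) / (4 * \<sigma>\<^sup>2)))"

text \<open>The pair consists of synthetic noise and data noise. The first bad event concerns the
  synthetic noise alone; the other two are estimated with it frozen, as least squares statements for
  the design augmented by that vector.\<close>

lemma tau_hat_fail_prob:
  fixes n p :: nat and lam \<sigma> :: real
  assumes n: "0 < n" and tb: "tie_break tb" and \<tau>0: "\<tau>0 \<subseteq> {1..p}"
    and lam: "0 < lam" "lam \<le> 0.05 * (real n * Cmin n p X \<tau>0 \<beta>0)" and s: "0 < \<sigma>"
  defines "W \<equiv> {z \<in> space (gauss {1..n} \<Otimes>\<^sub>M gauss {1..n}). tau_hat n p X lam tb (data X \<tau>0 \<beta>0 \<sigma> (snd z)) (fst z) \<noteq> \<tau>0}"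
  shows "W \<in> sets (gauss {1..n} \<Otimes>\<^sub>M gauss {1..n})"
    and "measure (gauss {1..n} \<Otimes>\<^sub>M gauss {1..n}) W \<le> select_fail_bound n p \<tau>0 (Cmin n p X \<tau>0 \<beta>0) \<sigma> lam"
proof -
  let ?G = "gauss {1..n}"
  let ?P = "?G \<Otimes>\<^sub>M ?G"
  interpret G: prob_space ?G by (rule prob_space_gauss)
  interpret P: pair_prob_space ?G ?G ..
  define C where "C = Cmin n p X \<tau>0 \<beta>0"
  have "0 < real n * C" using lam by (simp add: C_def)
  then have C: "0 < C" using n by (simp add: zero_less_mult_iff)
  define m where "m = Xmul X \<tau>0 \<beta>0"
  define R where "R = {\<tau>. \<tau> \<subseteq> {1..p} \<and> card \<tau> \<le> card \<tau>0} - {\<tau>0}"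
  define RT where "RT = {T. T \<subseteq> {1..p} - \<tau>0 \<and> T \<noteq> {}}"
  have finR: "finite R" "finite RT"
    unfolding R_def RT_def by (auto intro: finite_models finite_subset[of _ "Pow {1..p}"])
  have fin0: "finite \<tau>0" "0 \<notin> \<tau>0" using \<tau>0 finite_subset by auto
  have datam: "data X \<tau>0 \<beta>0 \<sigma> u = (\<lambda>i. m i + \<sigma> * u i)" for u by (simp add: data_def m_def)
  define B1 where "B1 \<tau> = {z \<in> space ?P. rss1 n X (fst z) m \<tau> < rss n X m \<tau> / 3}" for \<tau>
  \<comment> \<open>Including the complement of \<open>B1\<close> guarantees, for each frozen
    synthetic noise that matters, that a third of the signal is available to the tail bound.\<close>
  define B2 where "B2 \<tau> = {z \<in> space ?P. rss n X m \<tau> / 3 \<le> rss1 n X (fst z) m \<tau> \<and>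
      rss1 n X (fst z) (data X \<tau>0 \<beta>0 \<sigma> (snd z)) \<tau> < rss1 n X (fst z) m \<tau> / 2 + \<sigma>\<^sup>2 * rss1 n X (fst z) (snd z) \<tau>}" for \<tau>
  define j where "j T = real (max 1 (card T - card \<tau>0))" for T :: "nat set"
  define B3 where "B3 T = {z \<in> space ?P. lam * j T \<le> \<sigma>\<^sup>2 * (rss1 n X (fst z) (snd z) \<tau>0 - rss1 n X (fst z) (snd z) (\<tau>0 \<union> T))}" for T
  have fs[measurable]: "fst \<in> measurable ?P (\<Pi>\<^sub>M i\<in>{1..n}. borel)" "snd \<in> measurable ?P (\<Pi>\<^sub>M i\<in>{1..n}. borel)"
    using measurable_fst[of ?G ?G] measurable_snd[of ?G ?G]
    by (simp_all cong: measurable_cong_sets)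
  have sndi: "(\<lambda>z. snd z i) \<in> borel_measurable ?P" if "i \<in> {1..n}" for i
    using measurable_compose[OF fs(2) measurable_component_singleton[OF that]] by simp
  have rss1m: "(\<lambda>z. rss1 n X (fst z) (f z) \<tau>) \<in> borel_measurable ?P"
    if "\<And>i. i \<in> {1..n} \<Longrightarrow> (\<lambda>z. f z i) \<in> borel_measurable ?P" "finite \<tau>" "0 \<notin> \<tau>" for f \<tau>
  proof -
    have "(\<lambda>z. restrict (f z) {1..n}) \<in> measurable ?P (\<Pi>\<^sub>M i\<in>{1..n}. borel)"
      using that by (intro measurable_restrict) auto
    from measurable_rss1[OF that(2,3) this fs(1)]
    show ?thesis unfolding rss1_def rss_restrict .
  qed
  have datai: "(\<lambda>z. data X \<tau>0 \<beta>0 \<sigma> (snd z) i) \<in> borel_measurable ?P" if "i \<in> {1..n}" for i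
    unfolding datam using sndi[OF that] by measurable
  show Ws: "W \<in> sets ?P"
    unfolding W_def using measurable_tau_hat[OF datai fs(1), where p = p and X = X and lam = lam and tb = tb] by measurable
  have mset: "B1 \<tau> \<in> sets ?P" "B2 \<tau> \<in> sets ?P" if "\<tau> \<in> R" for \<tau>
  proof -
    have f: "finite \<tau>" "0 \<notin> \<tau>" using that finite_subset[of \<tau> "{1..p}"] by (auto simp: R_def)
    have [measurable]: "(\<lambda>z. rss1 n X (fst z) m \<tau>) \<in> borel_measurable ?P"
      "(\<lambda>z. rss1 n X (fst z) (data X \<tau>0 \<beta>0 \<sigma> (snd z)) \<tau>) \<in> borel_measurable ?P"
      "(\<lambda>z. rss1 n X (fst z) (snd z) \<tau>) \<in> borel_measurable ?P"
      by (intro rss1m f datai sndi borel_measurable_const; assumption)+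
    show "B1 \<tau> \<in> sets ?P" "B2 \<tau> \<in> sets ?P" unfolding B1_def B2_def by measurable
  qed
  have mset3: "B3 T \<in> sets ?P" if "T \<in> RT" for T
  proof -
    have f: "finite (\<tau>0 \<union> T)" "0 \<notin> \<tau>0 \<union> T"
      using that fin0 finite_subset[of T "{1..p} - \<tau>0"] by (auto simp: RT_def)
    have [measurable]: "(\<lambda>z. rss1 n X (fst z) (snd z) \<tau>0) \<in> borel_measurable ?P"
      "(\<lambda>z. rss1 n X (fst z) (snd z) (\<tau>0 \<union> T)) \<in> borel_measurable ?P"
      by (intro rss1m f fin0 sndi; assumption)+
    show ?thesis unfolding B3_def by measurable
  qed
  have sub: "W \<subseteq> (\<Union>\<tau>\<in>R. B1 \<tau>) \<union> (\<Union>\<tau>\<in>R. B2 \<tau>) \<union> (\<Union>T\<in>RT. B3 T)"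
  proof (rule subsetI, rule ccontr)
    fix z assume zW: "z \<in> W" and nz: "z \<notin> (\<Union>\<tau>\<in>R. B1 \<tau>) \<union> (\<Union>\<tau>\<in>R. B2 \<tau>) \<union> (\<Union>T\<in>RT. B3 T)"
    have z: "z \<in> W" "\<tau> \<in> R \<Longrightarrow> z \<notin> B1 \<tau>" "\<tau> \<in> R \<Longrightarrow> z \<notin> B2 \<tau>" "T \<in> RT \<Longrightarrow> z \<notin> B3 T" for \<tau> T
      using zW nz by (simp_all only: Un_iff UN_iff de_Morgan_disj) metis+
    have zs: "z \<in> space ?P" using z(1) by (simp add: W_def)
    have E1: "rss n X m \<tau> / 3 \<le> rss1 n X (fst z) m \<tau>" if "\<tau> \<in> R" for \<tau>
      using z(2)[OF that] zs by (auto simp: B1_def)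
    have "tau_hat n p X lam tb (data X \<tau>0 \<beta>0 \<sigma> (snd z)) (fst z) = \<tau>0"
    proof (rule tau_hat_eqI[OF tb \<tau>0])
      fix \<tau> assume \<tau>: "\<tau> \<subseteq> {1..p}" "\<tau> \<noteq> \<tau>0"
      show "pen_loss n X lam (data X \<tau>0 \<beta>0 \<sigma> (snd z)) (fst z) \<tau>0 < pen_loss n X lam (data X \<tau>0 \<beta>0 \<sigma> (snd z)) (fst z) \<tau>"
      proof (rule pen_loss_true_model_minimal[OF n \<tau>0 lam, OF _ _ _ _ \<tau>], goal_cases)
        case (1 \<tau>')
        then show ?case by (intro Cmin_le_rss n)
      next
        case (2 \<tau>')
        then show ?case using E1[of \<tau>'] by (simp add: R_def m_def)
      next
        case (3 \<tau>')
        then have "\<tau>' \<in> R" by (simp add: R_def)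
        then show ?case using z(3)[of \<tau>'] E1[of \<tau>'] zs by (auto simp: B2_def m_def[symmetric])
      next
        case (4 T)
        then show ?case using z(4)[of T] zs by (auto simp: B3_def RT_def j_def)
      qed
    qed
    then show False using z(1) by (simp add: W_def)
  qed
  have b1: "emeasure ?P (B1 \<tau>) \<le> ennreal (sqrt 2 * (1 / sqrt 2) ^ (n - card \<tau>0 - 1))" if \<tau>: "\<tau> \<in> R" for \<tau>
  proof -
    have f: "finite \<tau>" "0 \<notin> \<tau>" "card \<tau> \<le> card \<tau>0" using that finite_subset[of \<tau> "{1..p}"] by (auto simp: R_def)
    let ?A = "{u \<in> space ?G. rss1 n X u m \<tau> < rss n X m \<tau> / 3}"
    have "(\<lambda>_. restrict m {1..n}) \<in> measurable ?G (\<Pi>\<^sub>M i\<in>{1..n}. borel)"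
      "(\<lambda>u. u) \<in> measurable ?G (\<Pi>\<^sub>M i\<in>{1..n}. borel)"
      by (auto intro!: measurable_const simp: space_PiM)
    from measurable_rss1[OF f(1,2) this] have [measurable]: "(\<lambda>u. rss1 n X u m \<tau>) \<in> borel_measurable ?G"
      unfolding rss1_def rss_restrict .
    have A: "?A \<in> sets ?G" by measurable
    have "B1 \<tau> = ?A \<times> space ?G" by (auto simp: B1_def space_pair_measure)
    then have "emeasure ?P (B1 \<tau>) = emeasure ?G ?A"
      by (simp only: G.emeasure_pair_measure_Times[OF A sets.top] G.emeasure_space_1 mult_1_right)
    also have "\<dots> \<le> ennreal (sqrt 2 * (1 / sqrt 2) ^ (n - card \<tau> - 1))"
      by (rule gauss_rss1_shrink_tail[OF f(1,2)])
    also have "\<dots> \<le> ennreal (sqrt 2 * (1 / sqrt 2) ^ (n - card \<tau>0 - 1))"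
      using f(3) by (intro ennreal_leI mult_left_mono power_decreasing) auto
    finally show ?thesis .
  qed
  have b2: "emeasure ?P (B2 \<tau>) \<le> ennreal (exp (- (real n * C) / (96 * \<sigma>\<^sup>2)))" if \<tau>: "\<tau> \<in> R" for \<tau>
  proof (rule pair_emeasure_le[OF G.prob_space_axioms _ mset(2)[OF \<tau>]])
    have f: "finite \<tau>" using that finite_subset[of \<tau> "{1..p}"] by (auto simp: R_def)
    fix us assume us: "us \<in> space ?G"
    show "emeasure ?G (Pair us -` B2 \<tau>) \<le> ennreal (exp (- (real n * C) / (96 * \<sigma>\<^sup>2)))"
    proof (cases "rss n X m \<tau> / 3 \<le> rss1 n X us m \<tau>")
      case True
      have "real n * max (real (card (\<tau>0 - \<tau>))) 1 * C \<le> rss n X m \<tau>"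
        unfolding m_def C_def using \<tau> by (intro Cmin_le_rss n) (auto simp: R_def)
      moreover have "real n * 1 * C \<le> real n * max (real (card (\<tau>0 - \<tau>))) 1 * C"
        using C by (intro mult_left_mono mult_right_mono) auto
      ultimately have "real n * C / 3 \<le> rss1 n X us m \<tau>" using True by simp
      then have le: "real n * C / (96 * \<sigma>\<^sup>2) \<le> rss1 n X us m \<tau> / (32 * \<sigma>\<^sup>2)"
        using s by (simp add: field_simps)
      have eq: "Pair us -` B2 \<tau> = {u \<in> space ?G. rss n (aug X us) (\<lambda>i. m i + \<sigma> * u i) (insert 0 \<tau>)
          < rss n (aug X us) m (insert 0 \<tau>) / 2 + \<sigma>\<^sup>2 * rss n (aug X us) u (insert 0 \<tau>)}"
        using us True by (auto simp: B2_def space_pair_measure datam rss1_def)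
      have "emeasure ?G (Pair us -` B2 \<tau>) \<le> ennreal (exp (- rss n (aug X us) m (insert 0 \<tau>) / (32 * \<sigma>\<^sup>2)))"
        unfolding eq using f s by (intro gauss_rss_shift_tail) auto
      also have "\<dots> \<le> ennreal (exp (- (real n * C) / (96 * \<sigma>\<^sup>2)))"
        using le by (intro ennreal_leI) (simp add: rss1_def)
      finally show ?thesis .
    next
      case False
      then have "Pair us -` B2 \<tau> = {}" by (auto simp: B2_def)
      then show ?thesis by simp
    qed
  qed unfold_locales
  have b3: "emeasure ?P (B3 T) \<le> ennreal (sqrt 2 ^ card T * exp (- (lam * j T) / (4 * \<sigma>\<^sup>2)))" if T: "T \<in> RT" for T
  proof (rule pair_emeasure_le[OF G.prob_space_axioms _ mset3[OF T]])
    have f: "finite T" using T finite_subset[of T "{1..p}"] by (auto simp: RT_def)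
    fix us assume us: "us \<in> space ?G"
    have eq: "Pair us -` B3 T = {u \<in> space ?G. lam * j T / \<sigma>\<^sup>2 \<le> rss n (aug X us) u (insert 0 \<tau>0) - rss n (aug X us) u (insert 0 \<tau>0 \<union> T)}"
      using us s by (auto simp: B3_def space_pair_measure rss1_def field_simps)
    have "emeasure ?G (Pair us -` B3 T) \<le> ennreal (sqrt 2 ^ card T * exp (- (lam * j T / \<sigma>\<^sup>2) / 4))"
      unfolding eq using f fin0 by (intro gauss_rss_drop_tail) auto
    then show "emeasure ?G (Pair us -` B3 T) \<le> ennreal (sqrt 2 ^ card T * exp (- (lam * j T) / (4 * \<sigma>\<^sup>2)))"
      by (simp add: mult.commute)
  qed unfold_locales
  have toreal: "measure ?P A \<le> b" if "emeasure ?P A \<le> ennreal b" "0 \<le> b" for A b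
    using that by (simp add: P.emeasure_eq_measure)
  have union_le: "measure ?P (\<Union>i\<in>I. B i) \<le> (\<Sum>i\<in>I. b i)"
    if "finite I" "\<And>i. i \<in> I \<Longrightarrow> B i \<in> sets ?P" "\<And>i. i \<in> I \<Longrightarrow> measure ?P (B i) \<le> b i"
    for I :: "nat set set" and B b
    using measure_UNION_le[of I B ?P] sum_mono[of I "\<lambda>i. measure ?P (B i)" b] that by fastforce
  have u1: "measure ?P (\<Union>\<tau>\<in>R. B1 \<tau>) \<le> (\<Sum>\<tau>\<in>R. sqrt 2 * (1 / sqrt 2) ^ (n - card \<tau>0 - 1))"
    using finR mset b1 by (intro union_le toreal) auto
  have u2: "measure ?P (\<Union>\<tau>\<in>R. B2 \<tau>) \<le> (\<Sum>\<tau>\<in>R. exp (- (real n * C) / (96 * \<sigma>\<^sup>2)))"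
    using finR mset b2 by (intro union_le toreal) auto
  have "measure ?P (\<Union>T\<in>RT. B3 T) \<le> (\<Sum>T\<in>RT. sqrt 2 ^ card T * exp (- (lam * j T) / (4 * \<sigma>\<^sup>2)))"
    using finR mset3 b3 by (intro union_le toreal) auto
  also have "\<dots> \<le> (\<Sum>T | T \<subseteq> {1..p} \<and> T \<noteq> {}. sqrt 2 ^ card T * exp (- (lam * j T) / (4 * \<sigma>\<^sup>2)))"
    by (intro sum_mono2 finite_models) (auto simp: RT_def)
  finally have u3: "measure ?P (\<Union>T\<in>RT. B3 T) \<le> \<dots>" .
  have "measure ?P W \<le> measure ?P ((\<Union>\<tau>\<in>R. B1 \<tau>) \<union> (\<Union>\<tau>\<in>R. B2 \<tau>) \<union> (\<Union>T\<in>RT. B3 T))"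
    by (intro P.finite_measure_mono[OF sub] sets.Un sets.finite_UN finR mset mset3)
  also have "\<dots> \<le> measure ?P ((\<Union>\<tau>\<in>R. B1 \<tau>) \<union> (\<Union>\<tau>\<in>R. B2 \<tau>)) + measure ?P (\<Union>T\<in>RT. B3 T)"
    by (intro measure_Un_le sets.Un sets.finite_UN finR mset mset3)
  also have "\<dots> \<le> measure ?P (\<Union>\<tau>\<in>R. B1 \<tau>) + measure ?P (\<Union>\<tau>\<in>R. B2 \<tau>) + measure ?P (\<Union>T\<in>RT. B3 T)"
    by (intro add_right_mono measure_Un_le sets.finite_UN finR mset)
  also have "\<dots> \<le> (\<Sum>\<tau>\<in>R. sqrt 2 * (1 / sqrt 2) ^ (n - card \<tau>0 - 1)) + (\<Sum>\<tau>\<in>R. exp (- (real n * C) / (96 * \<sigma>\<^sup>2)))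
     + (\<Sum>T | T \<subseteq> {1..p} \<and> T \<noteq> {}. sqrt 2 ^ card T * exp (- (lam * j T) / (4 * \<sigma>\<^sup>2)))"
    by (intro add_mono u1 u2 u3)
  also have "(\<Sum>\<tau>\<in>R. sqrt 2 * (1 / sqrt 2) ^ (n - card \<tau>0 - 1)) + (\<Sum>\<tau>\<in>R. exp (- (real n * C) / (96 * \<sigma>\<^sup>2)))
     \<le> real (card {\<tau>. \<tau> \<subseteq> {1..p} \<and> card \<tau> \<le> card \<tau>0})
       * (sqrt 2 * (1 / sqrt 2) ^ (n - card \<tau>0 - 1) + exp (- (real n * C) / (96 * \<sigma>\<^sup>2)))"
  proof -
    have "real (card R) \<le> real (card {\<tau>. \<tau> \<subseteq> {1..p} \<and> card \<tau> \<le> card \<tau>0})"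
      by (intro of_nat_mono card_mono finite_models) (auto simp: R_def)
    then have "real (card R) * (sqrt 2 * (1 / sqrt 2) ^ (n - card \<tau>0 - 1) + exp (- (real n * C) / (96 * \<sigma>\<^sup>2)))
      \<le> real (card {\<tau>. \<tau> \<subseteq> {1..p} \<and> card \<tau> \<le> card \<tau>0})
       * (sqrt 2 * (1 / sqrt 2) ^ (n - card \<tau>0 - 1) + exp (- (real n * C) / (96 * \<sigma>\<^sup>2)))"
      by (intro mult_right_mono) auto
    then show ?thesis by (simp only: sum_constant distrib_left)
  qed
  finally show "measure ?P W \<le> select_fail_bound n p \<tau>0 (Cmin n p X \<tau>0 \<beta>0) \<sigma> lam"
    by (simp only: select_fail_bound_def C_def j_def)
qed

section \<open>Rate of the failure probability\<close>

lemma sum_Pow_power: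
  fixes x :: real
  assumes "finite A" shows "(\<Sum>T\<in>Pow A. x ^ card T) = (1 + x) ^ card A"
proof -
  have "(\<Prod>i\<in>A. x + 1) = (\<Sum>T\<in>Pow A. (\<Prod>i\<in>T. x) * (\<Prod>i\<in>A - T. 1))"
    by (rule prod_add[OF assms])
  then show ?thesis by (simp add: add.commute)
qed

text \<open>The weights p^(-|T|) sum to (1 + 1/p)^p, which stays below e for every p; they make the
  union over all T summable.\<close>

lemma sum_models_weight:
  assumes "0 < p" shows "(\<Sum>T\<in>Pow {1..p}. (1 / real p) ^ card T) \<le> exp 1"
proof -
  have "(1 + 1 / real p) ^ p \<le> exp (1 / real p) ^ p"
    by (intro power_mono) auto
  also have "\<dots> = exp 1" using assms by (simp add: exp_of_nat_mult[symmetric])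
  finally show ?thesis by (simp add: sum_Pow_power)
qed

text \<open>Each model of size at most \<open>s\<close> has weight at least p^(-s), while all
  weights together are at most e.\<close>

lemma card_models_le:
  assumes "0 < p"
  shows "real (card {\<tau>. \<tau> \<subseteq> {1..p} \<and> card \<tau> \<le> s}) \<le> exp (1 + real s * ln (real p))"
proof -
  let ?R = "{\<tau>. \<tau> \<subseteq> {1..p} \<and> card \<tau> \<le> s}"
  have "real (card ?R) * (1 / real p) ^ s = (\<Sum>\<tau>\<in>?R. (1 / real p) ^ s)" by simp
  also have "\<dots> \<le> (\<Sum>\<tau>\<in>?R. (1 / real p) ^ card \<tau>)"
    using assms by (intro sum_mono power_decreasing) auto
  also have "\<dots> \<le> (\<Sum>\<tau>\<in>Pow {1..p}. (1 / real p) ^ card \<tau>)"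
    by (intro sum_mono2) auto
  also have "\<dots> \<le> exp 1" by (rule sum_models_weight[OF assms])
  finally have "real (card ?R) / real p ^ s \<le> exp 1"
    by (simp only: power_one_over) simp
  then have "real (card ?R) \<le> exp 1 * real p ^ s"
    using assms by (simp only: pos_divide_le_eq zero_less_power of_nat_0_less_iff)
  also have "real p ^ s = exp (real s * ln (real p))"
    using assms by (simp only: exp_of_nat_mult) simp
  finally show ?thesis by (simp only: exp_add)
qed

lemma ln_2_bounds: "2 / 3 \<le> ln (2::real)" "ln (2::real) \<le> 0.7"
  using ln2_ge_two_thirds ln2_le_25_over_36 by auto

lemma sqrt_2_eq_exp: "sqrt 2 = exp (ln 2 / 2)"
proof (rule real_sqrt_unique)
  have "(exp (ln 2 / 2))\<^sup>2 = exp (ln 2 / 2 + ln 2 / 2 :: real)" by (simp only: exp_add power2_eq_square)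
  then show "(exp (ln 2 / 2 :: real))\<^sup>2 = 2" by simp
qed simp

text \<open>Either \<open>p < 16\<close> and the model sizes are bounded, or \<open>ln p \<ge> 4 ln 2\<close>, which makes
  \<open>3/2 * ln (p/2)\<close> dominate \<open>ln p + ln 2 / 2\<close>.\<close>

lemma select_fail_bound_le:
  fixes n p :: nat and C \<sigma> lam t :: real and \<tau>0 :: "nat set"
  defines "s \<equiv> card \<tau>0"
  assumes p: "0 < p" and \<tau>0: "\<tau>0 \<subseteq> {1..p}" "\<tau>0 \<noteq> {}" and t: "0 < t" and \<sigma>: "0 < \<sigma>"
    and sp: "real s * ln (real p) < 0.23 * real n"
    and lam1: "6 * \<sigma>\<^sup>2 * ((real s + 1) * ln (real p / 2)) + t * real n \<le> lam"
    and lam2: "lam \<le> 0.05 * (real n * C)"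
    and sig: "120 * ((real s + 2) * ln (real p + 1)) * \<sigma>\<^sup>2 \<le> real n * C"
    and n: "200 \<le> n" "520 * \<sigma>\<^sup>2 \<le> t * real n"
  shows "select_fail_bound n p \<tau>0 C \<sigma> lam \<le> 3 * exp 2 * exp (- min 0.07 (t / (96 * \<sigma>\<^sup>2)) * real n)"
proof -
  define c where "c = min 0.07 (t / (96 * \<sigma>\<^sup>2))"
  define L where "L = ln (real p)"
  define D where "D = t * real n / \<sigma>\<^sup>2"
  have \<sigma>2: "0 < \<sigma>\<^sup>2" using \<sigma> by simp
  have D: "520 \<le> D" using n(2) \<sigma>2 by (simp add: D_def field_simps)
  have L0: "0 \<le> L" using p by (simp add: L_def)
  have lnp2: "ln (real p / 2) = L - ln 2" using p by (simp add: L_def ln_div)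
  have sle: "s \<le> p" using \<tau>0 card_mono[of "{1..p}" \<tau>0] by (simp add: s_def)
  have s1: "1 \<le> s"
  proof -
    have "finite \<tau>0" using \<tau>0 finite_subset by auto
    then have "0 < s" using \<tau>0(2) by (simp add: s_def card_gt_0_iff)
    then show ?thesis by simp
  qed
  have big: "4 * ln 2 \<le> L" if "16 \<le> p"
  proof -
    have "4 * ln 2 = ln (16::real)" using ln_realpow[of 2 4] by simp
    also have "\<dots> \<le> L" using that by (simp add: L_def)
    finally show ?thesis .
  qed
  have small: "L \<le> 4 * ln 2" if "p < 16"
  proof -
    have "L \<le> ln (16::real)" using that p by (simp add: L_def)
    also have "\<dots> = 4 * ln 2" using ln_realpow[of 2 4] by simp
    finally show ?thesis .
  qed
  have lamD: "1.5 * ((real s + 1) * (L - ln 2)) + D / 4 \<le> lam / (4 * \<sigma>\<^sup>2)"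
  proof -
    have "1.5 * ((real s + 1) * (L - ln 2)) + D / 4 = (6 * \<sigma>\<^sup>2 * ((real s + 1) * ln (real p / 2)) + t * real n) / (4 * \<sigma>\<^sup>2)"
      using \<sigma>2 by (simp add: D_def lnp2 field_simps)
    also have "\<dots> \<le> lam / (4 * \<sigma>\<^sup>2)" using lam1 \<sigma>2 by (intro divide_right_mono) auto
    finally show ?thesis .
  qed
  \<comment> \<open>For p \<ge> 16, L \<ge> 8/3 and 0.23 / 2.66 < 0.09; otherwise s \<le> 15, and
    0.09 * 200 = 18.\<close>
  have s_small: "real s \<le> 0.09 * real n"
  proof (cases "16 \<le> p")
    case True
    have "2.66 \<le> L" using big[OF True] ln_2_bounds by simp
    then have "real s * 2.66 \<le> real s * L" by (intro mult_left_mono) auto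
    then show ?thesis using sp by (simp add: L_def)
  next
    case False
    then have "real s \<le> 15" using sle by simp
    then show ?thesis using n(1) by simp
  qed
  have N: "real (card {\<tau>. \<tau> \<subseteq> {1..p} \<and> card \<tau> \<le> s}) \<le> exp (1 + real s * L)"
    unfolding L_def by (rule card_models_le[OF p])
  have A1: "exp (1 + real s * L) * (sqrt 2 * (1 / sqrt 2) ^ (n - s - 1)) \<le> exp 2 * exp (- c * real n)"
  proof -
    note l2 = sqrt_2_eq_exp
    have "1 / sqrt 2 = exp (- (ln 2 / 2))"
      unfolding l2 by (simp only: exp_minus inverse_eq_divide)
    then have "(1 / sqrt 2) ^ (n - s - 1) = exp (real (n - s - 1) * (- (ln 2 / 2)))"
      by (simp only: exp_of_nat_mult)
    then have "exp (1 + real s * L) * (sqrt 2 * (1 / sqrt 2) ^ (n - s - 1))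
        = exp ((1 + real s * L) + (ln 2 / 2 + real (n - s - 1) * (- (ln 2 / 2))))"
      by (simp only: l2 exp_add)
    also have "\<dots> \<le> exp (2 + - c * real n)"
    proof -
      \<comment> \<open>Safe against truncated subtraction. With s \<le> 0.09 * n and ln 2 / 2 \<ge>
        1/3 the decay is about 0.91 / 3 per unit of n, and after subtracting 0.23 for the model
        count more than 0.07 is left.\<close>
      have "n \<le> (n - s - 1) + s + 1" by arith
      then have "real n \<le> real ((n - s - 1) + s + 1)" by (simp only: of_nat_le_iff)
      then have "real n \<le> real (n - s - 1) + real s + 1" by (simp only: of_nat_add of_nat_1)
      then have "0.91 * real n - 1 \<le> real (n - s - 1)" using s_small by simp
      then have "(0.91 * real n - 1) * (1 / 3) \<le> real (n - s - 1) * (ln 2 / 2)"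
        using ln_2_bounds by (intro mult_mono) auto
      moreover have "c * real n \<le> 0.07 * real n" by (intro mult_right_mono) (auto simp: c_def)
      ultimately show ?thesis using sp ln_2_bounds by (simp add: L_def[symmetric])
    qed
    finally show ?thesis by (simp only: exp_add)
  qed
  have A2: "exp (1 + real s * L) * exp (- (real n * C) / (96 * \<sigma>\<^sup>2)) \<le> exp 1 * exp (- c * real n)"
  proof -
    define E where "E = real n * C / \<sigma>\<^sup>2"
    have E1: "120 * ((real s + 2) * ln (real p + 1)) \<le> E"
      using sig \<sigma>2 by (simp add: E_def field_simps)
    have "L \<le> ln (real p + 1)" using p by (simp add: L_def)
    then have "real s * L \<le> (real s + 2) * ln (real p + 1)"
      using L0 by (intro mult_mono) auto
    then have E1': "120 * (real s * L) \<le> E" using E1 by linarith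
    have E2: "80 * (lam / (4 * \<sigma>\<^sup>2)) \<le> E"
      using lam2 \<sigma>2 by (simp add: E_def field_simps)
    have E3: "10 * D \<le> E"
    \<comment> \<open>Only here is ln (p/2) negative. Then s = 1, so the deficit is a constant that
      a large D absorbs.\<close>
    proof (cases "p = 1")
      case True
      then have "s = 1" "L = 0" using sle s1 by (auto simp: L_def)
      then show ?thesis using lamD E2 ln_2_bounds D by simp
    next
      case False
      then have "ln 2 \<le> L" using p by (simp add: L_def)
      then have "0 \<le> (real s + 1) * (L - ln 2)" by simp
      then show ?thesis using lamD E2 D by linarith
    qed
    have "c * real n \<le> t / (96 * \<sigma>\<^sup>2) * real n" by (intro mult_right_mono) (auto simp: c_def)
    also have "\<dots> = D / 96" by (simp add: D_def)
    finally have "c * real n \<le> D / 96" .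
    \<comment> \<open>The model count costs at most E / 120, and E / 96 - E / 120 = E / 480 \<ge> D
      / 48, more than the required D / 96.\<close>
    then have "(1 + real s * L) + - (E / 96) \<le> 1 + - (c * real n)"
      using E1' E3 D by linarith
    moreover have "- (real n * C) / (96 * \<sigma>\<^sup>2) = - (E / 96)" by (simp add: E_def)
    ultimately have "(1 + real s * L) + - (real n * C) / (96 * \<sigma>\<^sup>2) \<le> 1 + - c * real n"
      by (simp only: mult_minus_left)
    then have "exp ((1 + real s * L) + - (real n * C) / (96 * \<sigma>\<^sup>2)) \<le> exp (1 + - c * real n)"
      by (simp only: exp_le_cancel_iff)
    then show ?thesis by (simp only: exp_add)
  qed
  have A3: "(\<Sum>T | T \<subseteq> {1..p} \<and> T \<noteq> {}. sqrt 2 ^ card T * exp (- (lam * real (max 1 (card T - s))) / (4 * \<sigma>\<^sup>2)))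
      \<le> exp 1 * exp (- c * real n)"
  proof -
    have summand: "sqrt 2 ^ card T * exp (- (lam * real (max 1 (card T - s))) / (4 * \<sigma>\<^sup>2))
        \<le> exp (- c * real n) * (1 / real p) ^ card T" if T: "T \<subseteq> {1..p}" for T
    proof -
      define m where "m = card T"
      define j where "j = max 1 (m - s)"
      have mp: "m \<le> p" using T card_mono[of "{1..p}" T] by (simp add: m_def)
      have j1: "1 \<le> j" by (simp add: j_def)
      \<comment> \<open>If m > s, then m = (m - s) + s \<le> (m - s) * (1 + s); otherwise j = 1. So
        j units of penalty pay for all m added columns.\<close>
      have "m \<le> j * (s + 1)"
      proof (cases "m \<le> s")
        case False
        then have "1 * s \<le> (m - s) * s" by (intro mult_right_mono) auto
        then have "m \<le> (m - s) + (m - s) * s" using False by linarith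
        also have "(m - s) + (m - s) * s = (m - s) * (s + 1)" by (simp only: distrib_left mult_1_right add.commute)
        also have "m - s = j" using False by (simp add: j_def max_def)
        finally show ?thesis .
      qed (simp add: j_def max_def)
      then have mj: "real m \<le> real j * (real s + 1)" by (metis of_nat_1 of_nat_add of_nat_le_iff of_nat_mult)
      have j1': "1 \<le> real j" using j1 by simp
      have lj: "real j * (1.5 * ((real s + 1) * (L - ln 2)) + D / 4) \<le> lam * real j / (4 * \<sigma>\<^sup>2)"
        using mult_left_mono[OF lamD, of "real j"] by (simp add: mult.commute)
      have jD: "1 * (D / 4) \<le> real j * (D / 4)" using j1' D by (intro mult_right_mono) auto
      \<comment> \<open>For p \<ge> 16 the logarithms balance and D / 8 is spare. For p < 16 the
        costs are at most 15 * 63/20 = 47.25 and 84/5 = 16.8, and D / 8 must cover their sum 64.05;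
        this is the origin of the threshold 520.\<close>
      have key: "real m * (L + ln 2 / 2) + D / 8 \<le> lam * real j / (4 * \<sigma>\<^sup>2)"
      proof (cases "16 \<le> p")
        case True
        have "real m * (L + ln 2 / 2) \<le> (real j * (real s + 1)) * (L + ln 2 / 2)"
          using mj L0 by (intro mult_right_mono) auto
        also have "\<dots> \<le> (real j * (real s + 1)) * (1.5 * (L - ln 2))"
          using big[OF True] by (intro mult_left_mono) auto
        finally have "real m * (L + ln 2 / 2) \<le> real j * (1.5 * ((real s + 1) * (L - ln 2)))"
          by (simp add: mult_ac)
        then show ?thesis using lj jD D by (simp only: distrib_left)
      next
        case False
        then have m15: "real m \<le> 15" "real s \<le> 15" using mp sle by auto
        have mL: "real m * (L + ln 2 / 2) \<le> 15 * (63 / 20)"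
          using m15 L0 small False ln_2_bounds by (intro mult_mono) auto
        have "(real s + 1) * (ln 2 - L) \<le> 16 * 0.7"
        proof (cases "ln 2 \<le> L")
          case True
          then have "(real s + 1) * (ln 2 - L) \<le> 0" by (simp add: mult_le_0_iff)
          then show ?thesis by simp
        next
          case False
          then show ?thesis using m15 L0 ln_2_bounds by (intro mult_mono) auto
        qed
        moreover have "(real s + 1) * (L - ln 2) = - ((real s + 1) * (ln 2 - L))"
          by (simp only: mult_minus_right[symmetric] minus_diff_eq)
        ultimately have "D / 4 - 84 / 5 \<le> 1.5 * ((real s + 1) * (L - ln 2)) + D / 4"
          by simp
        then have "real j * (D / 4 - 84 / 5) \<le> real j * (1.5 * ((real s + 1) * (L - ln 2)) + D / 4)"
          by (intro mult_left_mono) auto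
        moreover have "1 * (D / 4 - 84 / 5) \<le> real j * (D / 4 - 84 / 5)"
          using j1' D by (intro mult_right_mono) auto
        ultimately have "1 * (D / 4 - 84 / 5) \<le> lam * real j / (4 * \<sigma>\<^sup>2)"
          using lj by (meson order_trans)
        then show ?thesis using mL D by simp
      qed
      have cn: "c * real n \<le> D / 8"
      proof -
        have "c * real n \<le> t / (96 * \<sigma>\<^sup>2) * real n" by (intro mult_right_mono) (auto simp: c_def)
        also have "\<dots> = D / 96" by (simp add: D_def)
        finally show ?thesis using D by linarith
      qed
      have l2: "sqrt 2 ^ m = exp (real m * (ln 2 / 2))"
      proof -
        show ?thesis by (simp only: sqrt_2_eq_exp exp_of_nat_mult)
      qed
      have lp: "(1 / real p) ^ m = exp (- (real m * L))"
        using p by (simp add: L_def exp_minus exp_of_nat_mult power_one_over inverse_eq_divide)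
      have "exp (real m * (ln 2 / 2)) * exp (- (lam * real j) / (4 * \<sigma>\<^sup>2))
         = exp (real m * (ln 2 / 2) - lam * real j / (4 * \<sigma>\<^sup>2))"
        by (simp add: exp_add[symmetric])
      also have "\<dots> \<le> exp (- c * real n + - (real m * L))"
        using key cn by (simp add: algebra_simps)
      also have "\<dots> = exp (- c * real n) * exp (- (real m * L))" by (rule exp_add)
      finally show ?thesis unfolding m_def[symmetric] j_def[symmetric] l2 lp .
    qed
    have "(\<Sum>T | T \<subseteq> {1..p} \<and> T \<noteq> {}. sqrt 2 ^ card T * exp (- (lam * real (max 1 (card T - s))) / (4 * \<sigma>\<^sup>2)))
      \<le> (\<Sum>T | T \<subseteq> {1..p} \<and> T \<noteq> {}. exp (- c * real n) * (1 / real p) ^ card T)"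
      by (intro sum_mono summand) auto
    also have "\<dots> \<le> (\<Sum>T\<in>Pow {1..p}. exp (- c * real n) * (1 / real p) ^ card T)"
      by (intro sum_mono2) auto
    also have "\<dots> = exp (- c * real n) * (\<Sum>T\<in>Pow {1..p}. (1 / real p) ^ card T)"
      by (simp add: sum_distrib_left)
    also have "\<dots> \<le> exp (- c * real n) * exp 1"
      by (intro mult_left_mono sum_models_weight p) auto
    finally show ?thesis by (simp add: mult.commute)
  qed
  have "select_fail_bound n p \<tau>0 C \<sigma> lam
      \<le> exp (1 + real s * L) * (sqrt 2 * (1 / sqrt 2) ^ (n - s - 1) + exp (- (real n * C) / (96 * \<sigma>\<^sup>2)))
        + exp 1 * exp (- c * real n)"
    unfolding select_fail_bound_def s_def[symmetric] using A3 N
    by (intro add_mono mult_right_mono) auto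
  also have "\<dots> \<le> exp 2 * exp (- c * real n) + exp 1 * exp (- c * real n) + exp 1 * exp (- c * real n)"
    using A1 A2 by (simp add: distrib_left)
  also have "\<dots> \<le> 3 * exp 2 * exp (- c * real n)"
  proof -
    have "exp 1 * exp (- c * real n) \<le> exp 2 * exp (- c * real n)" by (intro mult_right_mono) auto
    then show ?thesis by linarith
  qed
  finally show ?thesis by (simp add: c_def)
qed

section \<open>The model confidence set\<close>

lemma data_component_measurable:
  assumes "f \<in> measurable N (Rn n)" "i \<in> {1..n}"
  shows "(\<lambda>x. data X \<tau>0 \<beta>0 \<sigma> (f x) i) \<in> borel_measurable N"
proof -
  have "(\<lambda>x. f x i) \<in> borel_measurable N"
    using measurable_compose[OF assms(1)[unfolded Rn_def] measurable_component_singleton[OF assms(2)]] by simp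
  then show ?thesis unfolding data_def by measurable
qed

text \<open>The rank condition \<open>G\<close> at \<tau>0 depends on U only, and
  \<open>cover\<close> contains \<open>G\<close> minus the failure of the first synthetic draw. The
  conditional remainder is the conditional probability of that failure, whose mean is at most
  \<open>q\<close>, so Markov's inequality controls it.\<close>

lemma (in prob_space) conf_set_coverage:
  fixes n p d :: nat and U :: "'a \<Rightarrow> nat \<Rightarrow> real" and Us :: "nat \<Rightarrow> 'a \<Rightarrow> nat \<Rightarrow> real"
    and X :: "nat \<Rightarrow> nat \<Rightarrow> real"
  assumes n: "0 < n" and d: "1 \<le> d" and \<tau>0: "\<tau>0 \<subseteq> {1..p}"
    and ties: "tie_break tbS" "tie_break tbT" and \<alpha>: "\<alpha> \<le> 1" and \<sigma>: "0 < \<sigma>"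
    and lam: "0 < lam" "lam \<le> 0.05 * (real n * Cmin n p X \<tau>0 \<beta>0)"
    and indep: "indep_vars (\<lambda>_. Rn n) (\<lambda>b. if b = 0 then U else Us b) {0..d}"
    and law: "distr M (Rn n) U = std_gauss n" "\<And>b. b \<in> {1..d} \<Longrightarrow> distr M (Rn n) (Us b) = std_gauss n"
  defines "Y \<equiv> \<lambda>\<omega>. data X \<tau>0 \<beta>0 \<sigma> (U \<omega>)"
  defines "F \<equiv> sigma_Us M n d Us"
    and "cover \<equiv> {\<omega> \<in> space M. \<tau>0 \<in> conf_set n p X lam tbS tbT d \<alpha> (Y \<omega>) (\<lambda>b. Us b \<omega>)}"
    and "fail \<equiv> {\<omega> \<in> space M. tau_hat n p X lam tbS (Y \<omega>) (Us 1 \<omega>) \<noteq> \<tau>0}"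
    and "q \<equiv> select_fail_bound n p \<tau>0 (Cmin n p X \<tau>0 \<beta>0) \<sigma> lam"
  shows "\<alpha> - q \<le> prob cover"
    and "AE \<omega> in M. \<alpha> - cprob M F fail \<omega> \<le> cprob M F cover \<omega>"
    and "cprob M F fail \<in> borel_measurable F"
    and "0 < \<epsilon> \<Longrightarrow> prob {\<omega> \<in> space M. \<epsilon> < \<bar>cprob M F fail \<omega>\<bar>} \<le> q / \<epsilon>"
proof -
  have fin: "finite \<tau>0" using \<tau>0 finite_subset by auto
  have rv: "U \<in> measurable M (Rn n)" "\<And>b. b \<in> {1..d} \<Longrightarrow> Us b \<in> measurable M (Rn n)"
  proof -
    have rvX: "(if b = 0 then U else Us b) \<in> measurable M (Rn n)" if "b \<in> {0..d}" for b
      using indep that unfolding indep_vars_def by blast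
    show "U \<in> measurable M (Rn n)" using rvX[of 0] by simp
    show "Us b \<in> measurable M (Rn n)" if "b \<in> {1..d}" for b using rvX[of b] that by simp
  qed
  have Rg: "sets (Rn n) = sets (gauss {1..n})" by (simp add: Rn_def)
  define Z where "Z \<omega> = (\<lambda>b\<in>{1..d}. Us b \<omega>)" for \<omega>
  have Zm: "Z \<in> measurable M (\<Pi>\<^sub>M b\<in>{1..d}. Rn n)"
    unfolding Z_def using rv(2) by (intro measurable_restrict)
  have Fdef: "F = vimage_algebra (space M) Z (\<Pi>\<^sub>M b\<in>{1..d}. Rn n)"
    by (simp add: F_def sigma_Us_def Z_def[abs_def])
  \<comment> \<open>U is wrapped as a family over a single index, the form in which grouping an
    independent family delivers it. \<open>Z\<close> collects all synthetic vectors and generates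
    \<open>F\<close>.\<close>
  define U0 where "U0 \<omega> = (\<lambda>b\<in>{0::nat}. U \<omega>)" for \<omega>
  have ZU: "indep_var (\<Pi>\<^sub>M b\<in>{0}. Rn n) U0 (\<Pi>\<^sub>M b\<in>{1..d}. Rn n) Z"
  proof -
    have "indep_var (PiM {0} (\<lambda>_. Rn n)) (\<lambda>\<omega>. restrict (\<lambda>b. (if b = 0 then U else Us b) \<omega>) {0})
      (PiM {1..d} (\<lambda>_. Rn n)) (\<lambda>\<omega>. restrict (\<lambda>b. (if b = 0 then U else Us b) \<omega>) {1..d})"
      by (rule indep_var_restrict[OF indep]) auto
    moreover have "(\<lambda>\<omega>. restrict (\<lambda>b. (if b = 0 then U else Us b) \<omega>) {0}) = U0"
      by (auto simp: U0_def fun_eq_iff)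
    moreover have "(\<lambda>\<omega>. restrict (\<lambda>b. (if b = 0 then U else Us b) \<omega>) {1..d}) = Z"
      by (auto simp: Z_def fun_eq_iff)
    ultimately show ?thesis by (simp only:)
  qed
  have U1: "distr M (Rn n \<Otimes>\<^sub>M Rn n) (\<lambda>\<omega>. (Us 1 \<omega>, U \<omega>)) = gauss {1..n} \<Otimes>\<^sub>M gauss {1..n}"
  proof -
    have "indep_var (PiM {1} (\<lambda>_. Rn n)) (\<lambda>\<omega>. restrict (\<lambda>b. (if b = 0 then U else Us b) \<omega>) {1})
      (PiM {0} (\<lambda>_. Rn n)) (\<lambda>\<omega>. restrict (\<lambda>b. (if b = 0 then U else Us b) \<omega>) {0})"
      using d by (intro indep_var_restrict[OF indep]) auto
    then have "indep_var (Rn n) ((\<lambda>f. f 1) \<circ> (\<lambda>\<omega>. restrict (\<lambda>b. (if b = 0 then U else Us b) \<omega>) {1}))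
      (Rn n) ((\<lambda>f. f 0) \<circ> (\<lambda>\<omega>. restrict (\<lambda>b. (if b = 0 then U else Us b) \<omega>) {0}))"
      by (rule indep_var_compose) auto
    moreover have "(\<lambda>f. f 1) \<circ> (\<lambda>\<omega>. restrict (\<lambda>b. (if b = 0 then U else Us b) \<omega>) {1}) = Us 1"
      by (auto simp: fun_eq_iff)
    moreover have "(\<lambda>f. f 0) \<circ> (\<lambda>\<omega>. restrict (\<lambda>b. (if b = 0 then U else Us b) \<omega>) {0}) = U"
      by (auto simp: fun_eq_iff)
    ultimately have "indep_var (Rn n) (Us 1) (Rn n) U" by simp
    then show ?thesis
      unfolding indep_var_distribution_eq using law(1) law(2)[of 1] d by (simp add: std_gauss_eq)
  qed
  define T where "T \<omega> = T_tilde n p X tbT (Y \<omega>) \<tau>0" for \<omega>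
  define GU where "GU = {u \<in> space (gauss {1..n}). T_tilde n p X tbT (data X \<tau>0 \<beta>0 \<sigma> u) \<tau>0
      \<in> B_set n p X tbT \<alpha> \<tau>0 (W_tilde n X (data X \<tau>0 \<beta>0 \<sigma> u) \<tau>0)}"
  note GU = T_in_B_coverage[OF ties(2) fin \<alpha> \<sigma>, of n p X \<beta>0, folded GU_def]
  define G where "G = {\<omega> \<in> space M. T \<omega> \<in> B_set n p X tbT \<alpha> \<tau>0 (W_tilde n X (Y \<omega>) \<tau>0)}"
  have G: "G = U -` GU \<inter> space M"
  proof -
    have "U \<omega> \<in> space (gauss {1..n})" if "\<omega> \<in> space M" for \<omega>
      using measurable_space[OF rv(1) that] sets_eq_imp_space_eq[OF Rg] by simp
    then show ?thesis by (auto simp: G_def GU_def T_def Y_def)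
  qed
  have GUs: "GU \<in> sets (Rn n)" using GU(1) Rg by simp
  have Gs: "G \<in> sets M" unfolding G by (rule measurable_sets[OF rv(1) GUs])
  have PG: "\<alpha> \<le> prob G"
  proof -
    have "prob G = measure (distr M (Rn n) U) GU"
      unfolding G by (rule measure_distr[OF rv(1) GUs, symmetric])
    then show ?thesis using GU(2) by (simp add: law std_gauss_eq)
  qed
  have hat_m: "(\<lambda>\<omega>. tau_hat n p X lam tbS (Y \<omega>) (Us b \<omega>)) \<in> measurable M (count_space UNIV)" if "b \<in> {1..d}" for b
    unfolding Y_def using rv(2)[OF that]
    by (intro measurable_tau_hat data_component_measurable[OF rv(1)]) (auto simp: Rn_def)
  have fail_s: "fail \<in> sets M"
  proof -
    have "1 \<in> {1..d}" using d by simp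
    note hat_m[OF this, measurable]
    show ?thesis unfolding fail_def by measurable
  qed
  have Pfail: "prob fail \<le> q"
  proof -
    define W where "W = {z \<in> space (gauss {1..n} \<Otimes>\<^sub>M gauss {1..n}). tau_hat n p X lam tbS (data X \<tau>0 \<beta>0 \<sigma> (snd z)) (fst z) \<noteq> \<tau>0}"
    note W = tau_hat_fail_prob[OF n ties(1) \<tau>0 lam \<sigma>, folded W_def]
    have m: "(\<lambda>\<omega>. (Us 1 \<omega>, U \<omega>)) \<in> measurable M (Rn n \<Otimes>\<^sub>M Rn n)"
      using rv(1) rv(2)[of 1] d by (intro measurable_Pair) auto
    have sp: "sets (Rn n \<Otimes>\<^sub>M Rn n) = sets (gauss {1..n} \<Otimes>\<^sub>M gauss {1..n})"
      by (intro sets_pair_measure_cong Rg)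
    have "fail = (\<lambda>\<omega>. (Us 1 \<omega>, U \<omega>)) -` W \<inter> space M"
      using measurable_space[OF m] sets_eq_imp_space_eq[OF sp] by (auto simp: fail_def W_def Y_def)
    then have "prob fail = measure (distr M (Rn n \<Otimes>\<^sub>M Rn n) (\<lambda>\<omega>. (Us 1 \<omega>, U \<omega>))) W"
      using measure_distr[OF m, of W] W(1) sp by simp
    then show ?thesis using W(2) by (simp add: U1 q_def)
  qed
  have cover_eq: "cover = {\<omega> \<in> space M. \<exists>b\<in>{1..d}. tau_hat n p X lam tbS (Y \<omega>) (Us b \<omega>) = \<tau>0} \<inter> G"
    by (auto simp: cover_def conf_set_def candidates_def G_def T_def image_iff)
  have cover_s: "cover \<in> sets M"
    unfolding cover_eq
  proof (intro sets.Int Gs sets.sets_Collect_finite_Ex)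
    fix b assume "b \<in> {1..d}"
    note hat_m[OF this, measurable]
    show "{\<omega> \<in> space M. tau_hat n p X lam tbS (Y \<omega>) (Us b \<omega>) = \<tau>0} \<in> sets M" by measurable
  qed auto
  \<comment> \<open>Draw number 1 exists because d \<ge> 1; further draws can only enlarge the
    candidate set, so d does not enter the bound.\<close>
  have sub: "G - fail \<subseteq> cover" unfolding cover_eq fail_def using d by (auto simp: G_def)
  have "\<alpha> - q \<le> prob G - prob fail" using PG Pfail by simp
  also have "\<dots> \<le> prob (G - fail)"
    using finite_measure_mono[of G "(G - fail) \<union> fail"] measure_Un_le[of "G - fail" M fail] Gs fail_s by auto
  also have "\<dots> \<le> prob cover" by (rule finite_measure_mono[OF sub cover_s])
  finally show "\<alpha> - q \<le> prob cover" .
  have subalg: "subalgebra M F"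
  proof -
    have "sets (vimage_algebra (space M) Z (\<Pi>\<^sub>M b\<in>{1..d}. Rn n)) \<subseteq> sets M"
      using measurable_sets[OF Zm] measurable_space[OF Zm] by (auto simp: sets_vimage_algebra2)
    then show ?thesis by (simp add: subalgebra_def Fdef)
  qed
  interpret F: finite_measure_subalgebra M F by unfold_locales (rule subalg)
  have int: "integrable M (indicator A :: 'a \<Rightarrow> real)" if "A \<in> sets M" for A
    using that by (simp add: emeasure_eq_measure)
  \<comment> \<open>Every set of \<open>F\<close> is a preimage under \<open>Z\<close> and hence
    independent of \<open>G\<close>, so the constant \<open>prob G\<close> satisfies the identity
    that characterises the conditional expectation.\<close>
  have cG: "AE \<omega> in M. cprob M F G \<omega> = prob G"
    unfolding cprob_def
  proof (rule F.real_cond_exp_charact[OF _ int[OF Gs]])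
    fix A assume "A \<in> sets F"
    then obtain B where B: "B \<in> sets (\<Pi>\<^sub>M b\<in>{1..d}. Rn n)" "A = Z -` B \<inter> space M"
      unfolding Fdef using measurable_space[OF Zm] by (auto simp: sets_vimage_algebra2)
    then have As: "A \<in> sets M" using measurable_sets[OF Zm B(1)] by simp
    have "prob (G \<inter> A) = prob G * prob A"
    proof -
      define H where "H = (\<lambda>f. f (0::nat)) -` GU \<inter> space (\<Pi>\<^sub>M b\<in>{0}. Rn n)"
      have H: "H \<in> sets (\<Pi>\<^sub>M b\<in>{0}. Rn n)"
        unfolding H_def by (rule measurable_sets[OF _ GUs]) simp
      have "U0 \<omega> \<in> H \<longleftrightarrow> U \<omega> \<in> GU" if "\<omega> \<in> space M" for \<omega>
        using measurable_space[OF rv(1) that] by (auto simp: H_def U0_def space_PiM)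
      then have "(\<lambda>x. (U0 x, Z x)) -` (H \<times> B) \<inter> space M = G \<inter> A" "U0 -` H \<inter> space M = G"
        by (auto simp: G B)
      then show ?thesis using indep_varD[OF ZU H B(1)] by (simp add: B)
    qed
    moreover have "(\<integral>x\<in>A. indicator G x \<partial>M) = prob (G \<inter> A)"
    proof -
      have "(\<integral>x\<in>A. indicator G x \<partial>M) = (\<integral>x. indicator (G \<inter> A) x \<partial>M)"
        unfolding set_lebesgue_integral_def by (intro Bochner_Integration.integral_cong) (auto simp: indicator_def)
      also have "\<dots> = prob (G \<inter> A)" using Gs As by simp
      finally show ?thesis .
    qed
    moreover have "(\<integral>x\<in>A. prob G \<partial>M) = prob A * prob G"
      unfolding set_lebesgue_integral_def using As by simp
    ultimately show "(\<integral>x\<in>A. indicator G x \<partial>M) = (\<integral>x\<in>A. prob G \<partial>M)" by simp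
  qed auto
  have cD: "AE \<omega> in M. real_cond_exp M F (\<lambda>x. indicator G x - indicator fail x) \<omega> = cprob M F G \<omega> - cprob M F fail \<omega>"
    unfolding cprob_def using int Gs fail_s by (intro F.real_cond_exp_diff) auto
  have cM: "AE \<omega> in M. real_cond_exp M F (\<lambda>x. indicator G x - indicator fail x) \<omega> \<le> cprob M F cover \<omega>"
    unfolding cprob_def
  proof (rule F.real_cond_exp_mono)
    show "AE x in M. indicator G x - indicator fail x \<le> (indicator cover x :: real)"
      using sub by (auto simp: indicator_def)
  qed (use int Gs fail_s cover_s in auto)
  show "AE \<omega> in M. \<alpha> - cprob M F fail \<omega> \<le> cprob M F cover \<omega>"
    using cG cD cM by eventually_elim (use PG in linarith)
  show meas: "cprob M F fail \<in> borel_measurable F" unfolding cprob_def by simp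
  have nn: "AE \<omega> in M. 0 \<le> cprob M F fail \<omega>"
    unfolding cprob_def using fail_s by (intro F.real_cond_exp_pos) auto
  have cint: "integrable M (cprob M F fail)" "(\<integral>\<omega>. cprob M F fail \<omega> \<partial>M) = prob fail"
    unfolding cprob_def using F.real_cond_exp_int[OF int[OF fail_s]] fail_s by auto
  show "prob {\<omega> \<in> space M. \<epsilon> < \<bar>cprob M F fail \<omega>\<bar>} \<le> q / \<epsilon>" if \<epsilon>: "0 < \<epsilon>"
  proof -
    have mM[measurable]: "cprob M F fail \<in> borel_measurable M"
      using cint(1) by (rule borel_measurable_integrable)
    have "prob {\<omega> \<in> space M. \<epsilon> < \<bar>cprob M F fail \<omega>\<bar>} \<le> prob {\<omega> \<in> space M. \<epsilon> \<le> cprob M F fail \<omega>}"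
      using nn by (intro finite_measure_mono_AE) (auto elim!: eventually_mono)
    also have "\<dots> \<le> (\<integral>\<omega>. cprob M F fail \<omega> \<partial>M) / \<epsilon>"
      using cint(1) nn \<epsilon> by (intro integral_Markov_inequality_measure[where A = "{}"]) auto
    also have "\<dots> \<le> q / \<epsilon>" using cint(2) Pfail \<epsilon> by (simp add: divide_right_mono)
    finally show ?thesis .
  qed
qed

theorem theorem9:
  fixes \<alpha> t \<sigma>0 :: real
    and d :: nat
    and p :: "nat \<Rightarrow> nat"
    and X :: "nat \<Rightarrow> nat \<Rightarrow> nat \<Rightarrow> real"
    and \<tau>0 :: "nat \<Rightarrow> nat set"
    and \<beta>0 :: "nat \<Rightarrow> nat \<Rightarrow> real"
    and lam :: "nat \<Rightarrow> real"
    and tbS tbT :: "nat \<Rightarrow> nat set set \<Rightarrow> nat set"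
    and M :: "nat \<Rightarrow> 'w measure"
    and U :: "nat \<Rightarrow> 'w \<Rightarrow> nat \<Rightarrow> real"
    and Us :: "nat \<Rightarrow> nat \<Rightarrow> 'w \<Rightarrow> nat \<Rightarrow> real"
    and Y :: "nat \<Rightarrow> 'w \<Rightarrow> nat \<Rightarrow> real"
    and cover :: "nat \<Rightarrow> 'w set"
  assumes alpha: "0 < \<alpha>" "\<alpha> < 1"
    and t_pos: "0 < t"
    and sigma_pos: "0 < \<sigma>0"
    and d_pos: "1 \<le> d"
    and p_pos: "\<And>n. 1 \<le> n \<Longrightarrow> 1 \<le> p n"
    and true_model: "\<And>n. 1 \<le> n \<Longrightarrow> \<tau>0 n \<subseteq> {1..p n} \<and> \<tau>0 n \<noteq> {}"
    and ident: "\<And>n. 1 \<le> n \<Longrightarrow> identifiable n (p n) (X n) (\<tau>0 n) (\<beta>0 n)"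
    and lam_pos: "\<And>n. 1 \<le> n \<Longrightarrow> 0 < lam n"
    and ties: "\<And>n. 1 \<le> n \<Longrightarrow> tie_break (tbS n) \<and> tie_break (tbT n)"
    and prob: "\<And>n. 1 \<le> n \<Longrightarrow> prob_space (M n)"
    and indep: "\<And>n. 1 \<le> n \<Longrightarrow>
      prob_space.indep_vars (M n) (\<lambda>_. Rn n) (\<lambda>b. if b = 0 then U n else Us n b) {0..d}"
    and U_distr: "\<And>n. 1 \<le> n \<Longrightarrow> distr (M n) (Rn n) (U n) = std_gauss n"
    and Us_distr: "\<And>n b. 1 \<le> n \<Longrightarrow> b \<in> {1..d} \<Longrightarrow> distr (M n) (Rn n) (Us n b) = std_gauss n"
    and Y_def: "\<And>n \<omega>. Y n \<omega> = data (X n) (\<tau>0 n) (\<beta>0 n) \<sigma>0 (U n \<omega>)"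
    and lam_range: "eventually (\<lambda>n. lam n / real n \<in>
      {6 * \<sigma>0\<^sup>2 * ((real (card (\<tau>0 n)) + 1) * ln (real (p n) / 2) / real n) + t
       .. 0.05 * Cmin n (p n) (X n) (\<tau>0 n) (\<beta>0 n)}) sequentially"
    and sparsity: "eventually (\<lambda>n. real (card (\<tau>0 n)) * ln (real (p n)) / real n < 0.23) sequentially"
    and signal: "eventually (\<lambda>n. Cmin n (p n) (X n) (\<tau>0 n) (\<beta>0 n) >
      120 * ((real (card (\<tau>0 n)) + 2) * ln (real (p n) + 1) / real n) * \<sigma>0\<^sup>2) sequentially"
    and cover_def: "\<And>n. cover n =
      {\<omega> \<in> space (M n). \<tau>0 n \<in> conf_set n (p n) (X n) (lam n) (tbS n) (tbT n) d \<alpha>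
                                   (Y n \<omega>) (\<lambda>b. Us n b \<omega>)}"
  shows "\<exists>c2>0.
    (\<exists>r. r \<in> o(\<lambda>n. exp (- c2 * real n)) \<and>
       eventually (\<lambda>n. measure (M n) (cover n) \<ge> \<alpha> - r n) sequentially) \<and>
    (\<exists>R. (\<forall>n\<ge>1. R n \<in> borel_measurable (sigma_Us (M n) n d (Us n))) \<and>
       small_o_p M R (\<lambda>n. exp (- c2 * real n)) \<and>
       eventually (\<lambda>n. AE \<omega> in M n.
         cprob (M n) (sigma_Us (M n) n d (Us n)) (cover n) \<omega> \<ge> \<alpha> - R n \<omega>) sequentially)"
proof -
  define c where "c = min 0.07 (t / (96 * \<sigma>0\<^sup>2))"
  define K :: real where "K = 3 * exp 2"
  define C where "C n = Cmin n (p n) (X n) (\<tau>0 n) (\<beta>0 n)" for n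
  define q where "q n = select_fail_bound n (p n) (\<tau>0 n) (C n) \<sigma>0 (lam n)" for n
  define F where "F n = sigma_Us (M n) n d (Us n)" for n
  define R where "R n = cprob (M n) (F n)
    {\<omega> \<in> space (M n). tau_hat n (p n) (X n) (lam n) (tbS n) (data (X n) (\<tau>0 n) (\<beta>0 n) \<sigma>0 (U n \<omega>)) (Us n 1 \<omega>) \<noteq> \<tau>0 n}" for n
  have c: "0 < c" using t_pos sigma_pos by (simp add: c_def)
  have K: "0 < K" by (simp add: K_def)
  have "eventually (\<lambda>n. 520 * \<sigma>0\<^sup>2 / t \<le> real n) sequentially"
    by (rule eventually_ge_at_top[THEN filterlim_real_sequentially[unfolded filterlim_iff, rule_format]])
  moreover have "eventually (\<lambda>n. 200 \<le> n) sequentially" by (rule eventually_ge_at_top)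
  ultimately have good: "eventually (\<lambda>n. 1 \<le> n \<and> q n \<le> K * exp (- c * real n) \<and>
      lam n \<le> 0.05 * (real n * C n)) sequentially"
    using lam_range sparsity signal
  proof eventually_elim
    case (elim n)
    have n1: "1 \<le> n" and n0: "0 < real n" using elim(2) by auto
    have l: "6 * \<sigma>0\<^sup>2 * ((real (card (\<tau>0 n)) + 1) * ln (real (p n) / 2) / real n) + t \<le> lam n / real n"
      "lam n / real n \<le> 0.05 * C n" using elim(3) by (auto simp: C_def)
    have lam2: "lam n \<le> 0.05 * (real n * C n)"
      using l(2) n0 by (simp add: field_simps)
    have lam1: "6 * \<sigma>0\<^sup>2 * ((real (card (\<tau>0 n)) + 1) * ln (real (p n) / 2)) + t * real n \<le> lam n"
    proof -
      have "(6 * \<sigma>0\<^sup>2 * ((real (card (\<tau>0 n)) + 1) * ln (real (p n) / 2) / real n) + t) * real n \<le> lam n"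
        using l(1) n0 by (simp only: pos_le_divide_eq)
      then show ?thesis using n0 by (simp add: distrib_right)
    qed
    have sp: "real (card (\<tau>0 n)) * ln (real (p n)) < 0.23 * real n"
      using elim(4) n0 by (simp only: pos_divide_less_eq)
    have sig: "120 * ((real (card (\<tau>0 n)) + 2) * ln (real (p n) + 1)) * \<sigma>0\<^sup>2 \<le> real n * C n"
    proof -
      have "120 * ((real (card (\<tau>0 n)) + 2) * ln (real (p n) + 1) / real n) * \<sigma>0\<^sup>2 * real n \<le> C n * real n"
        using elim(5) n0 unfolding C_def by (intro mult_right_mono) auto
      then show ?thesis using n0 by (simp add: mult_ac)
    qed
    have "520 * \<sigma>0\<^sup>2 \<le> t * real n" using elim(1) t_pos by (simp add: pos_divide_le_eq mult.commute)
    then have "q n \<le> K * exp (- c * real n)"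
      unfolding q_def K_def c_def
      using p_pos[OF n1] true_model[OF n1] t_pos sigma_pos sp lam1 lam2 sig elim(2)
      by (intro select_fail_bound_le) auto
    then show ?case using n1 lam2 by simp
  qed
  have core: "\<alpha> - q n \<le> measure (M n) (cover n)"
      "AE \<omega> in M n. \<alpha> - R n \<omega> \<le> cprob (M n) (F n) (cover n) \<omega>"
      "0 < \<epsilon> \<Longrightarrow> measure (M n) {\<omega> \<in> space (M n). \<epsilon> < \<bar>R n \<omega>\<bar>} \<le> q n / \<epsilon>"
    if n: "1 \<le> n" and l: "lam n \<le> 0.05 * (real n * C n)" for n \<epsilon>
  proof -
    interpret prob_space "M n" by (rule prob[OF n])
    have ties': "tie_break (tbS n)" "tie_break (tbT n)" using ties[OF n] by auto
    have "0 < n" "\<tau>0 n \<subseteq> {1..p n}" "\<alpha> \<le> 1" using n true_model[OF n] alpha by auto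
    note cov = conf_set_coverage[OF this(1) d_pos this(2) ties' this(3) sigma_pos lam_pos[OF n]
        l[unfolded C_def] indep[OF n] U_distr[OF n] Us_distr[OF n]]
    show "\<alpha> - q n \<le> measure (M n) (cover n)" 
      unfolding q_def C_def cover_def Y_def by (rule cov(1))
    show "AE \<omega> in M n. \<alpha> - R n \<omega> \<le> cprob (M n) (F n) (cover n) \<omega>" 
      unfolding R_def F_def cover_def Y_def by (rule cov(2))
    show "measure (M n) {\<omega> \<in> space (M n). \<epsilon> < \<bar>R n \<omega>\<bar>} \<le> q n / \<epsilon>" if "0 < \<epsilon>"
      unfolding R_def F_def q_def C_def by (rule cov(4)[OF _ that])
  qed
  have decay: "(\<lambda>n. exp (- (c / 2) * real n)) \<longlonglongrightarrow> 0"
  proof -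
    have "(\<lambda>n. exp (- (c / 2)) ^ n) \<longlonglongrightarrow> 0" using c by (intro LIMSEQ_realpow_zero) auto
    moreover have "exp (- (c / 2)) ^ n = exp (- (c / 2) * real n)" for n
      by (simp only: exp_of_nat_mult[symmetric] mult.commute)
    ultimately show ?thesis by (simp only:)
  qed
  \<comment> \<open>The claimed rate is c / 2: one half of the exponent is the rate, and the other
    half is the vanishing factor that turns a bound of order exp (-c * n) into a small o.\<close>
  have half: "exp (- c * real n) = exp (- (c / 2) * real n) * exp (- (c / 2) * real n)" for n
    by (simp only: exp_add[symmetric]) simp
  show ?thesis
  proof (intro exI[of _ "c / 2"] conjI)
    show "0 < c / 2" using c by simp
    have "(\<lambda>n. K * exp (- c * real n) / exp (- (c / 2) * real n)) \<longlonglongrightarrow> 0"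
      using tendsto_mult_left[OF decay, of K] unfolding half by simp
    then have "(\<lambda>n. K * exp (- c * real n)) \<in> o(\<lambda>n. exp (- (c / 2) * real n))"
      by (intro smalloI_tendsto) auto
    moreover have "eventually (\<lambda>n. \<alpha> - K * exp (- c * real n) \<le> measure (M n) (cover n)) sequentially"
      using good
    proof eventually_elim
      case (elim n)
      then show ?case using core(1)[of n] by linarith
    qed
    ultimately show "\<exists>r. r \<in> o(\<lambda>n. exp (- (c / 2) * real n)) \<and>
        eventually (\<lambda>n. \<alpha> - r n \<le> measure (M n) (cover n)) sequentially" by blast
    show "\<exists>R. (\<forall>n\<ge>1. R n \<in> borel_measurable (sigma_Us (M n) n d (Us n))) \<and>
       small_o_p M R (\<lambda>n. exp (- (c / 2) * real n)) \<and>
       eventually (\<lambda>n. AE \<omega> in M n. \<alpha> - R n \<omega> \<le> cprob (M n) (sigma_Us (M n) n d (Us n)) (cover n) \<omega>) sequentially"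
    proof (intro exI[of _ R] conjI allI impI)
      show "R n \<in> borel_measurable (sigma_Us (M n) n d (Us n))" for n
        unfolding R_def F_def cprob_def by simp
      show "eventually (\<lambda>n. AE \<omega> in M n. \<alpha> - R n \<omega> \<le> cprob (M n) (sigma_Us (M n) n d (Us n)) (cover n) \<omega>) sequentially"
        using good by eventually_elim (use core(2) in \<open>auto simp: F_def\<close>)
      show "small_o_p M R (\<lambda>n. exp (- (c / 2) * real n))"
        unfolding small_o_p_def
      proof (intro allI impI)
        \<comment> \<open>Markov's inequality at threshold \<epsilon> * exp (-(c / 2) * n) spends
          half of the exponent and still leaves a null sequence.\<close>
        fix \<epsilon> :: real assume \<epsilon>: "0 < \<epsilon>"
        have "eventually (\<lambda>n. measure (M n) {\<omega> \<in> space (M n). \<epsilon> * \<bar>exp (- (c / 2) * real n)\<bar> < \<bar>R n \<omega>\<bar>}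
            \<le> K / \<epsilon> * exp (- (c / 2) * real n)) sequentially"
          using good
        proof eventually_elim
          case (elim n)
          have "measure (M n) {\<omega> \<in> space (M n). \<epsilon> * exp (- (c / 2) * real n) < \<bar>R n \<omega>\<bar>}
              \<le> q n / (\<epsilon> * exp (- (c / 2) * real n))"
            using elim \<epsilon> by (intro core(3)) auto
          also have "\<dots> \<le> K * exp (- c * real n) / (\<epsilon> * exp (- (c / 2) * real n))"
            using elim \<epsilon> by (intro divide_right_mono) auto
          also have "\<dots> = K / \<epsilon> * exp (- (c / 2) * real n)" unfolding half by simp
          finally show ?case by simp
        qed
        moreover have "(\<lambda>n. K / \<epsilon> * exp (- (c / 2) * real n)) \<longlonglongrightarrow> 0"
          using tendsto_mult_left[OF decay, of "K / \<epsilon>"] by simp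
        ultimately show "(\<lambda>n. measure (M n) {\<omega> \<in> space (M n). \<epsilon> * \<bar>exp (- (c / 2) * real n)\<bar> < \<bar>R n \<omega>\<bar>}) \<longlonglongrightarrow> 0"
          by (rule tendsto_sandwich[OF always_eventually[OF allI[OF measure_nonneg]] _ tendsto_const])
      qed
    qed
  qed
qed

end
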